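(* Let $N\ge 1$ be an integer and let $L\ge 0$, $n\ge N$ be real. Then the following hold. (a) For every $k\in\mathbb N$, $$\mathbf R_{N,k}(\zeta_1,\dots,\zeta_k)=\mathrm{Pf}\left[\omega(\zeta_j)\,\omega(\zeta_l)\begin{pmatrix}\widetilde{\boldsymbol\varkappa}_N(\zeta_j,\zeta_l)&\widetilde{\boldsymbol\varkappa}_N(\zeta_j,\bar\zeta_l)\\ \widetilde{\boldsymbol\varkappa}_N(\bar\zeta_j,\zeta_l)&\widetilde{\boldsymbol\varkappa}_N(\bar\zeta_j,\bar\zeta_l)\end{pmatrix}\right]_{j,l=1}^k\ \prod_{j=1}^k(\bar\zeta_j-\zeta_j),$$ where $$\omega(\zeta)=\frac{|1+\zeta^2|^{\,n+L-\frac12}}{(1+|\zeta|^2)^{n+L+1}},\qquad \widetilde{\boldsymbol\varkappa}_N(\zeta,\eta)=\frac{\widehat{\boldsymbol G}_N(\zeta,\eta)-\widehat{\boldsymbol G}_N(\eta,\zeta)}{\big((1+\zeta^2)(1+\eta^2)\big)^{n+L-\frac12}},$$ $$\widehat{\boldsymbol G}_N(\zeta,\eta)=\pi\,\frac{\Gamma(2n+2L+2)}{2^{2L+2n+1}}\sum_{k=0}^{N-1}\sum_{l=0}^{k}\frac{\zeta^{2k+2L+1}\,\eta^{2l+2L}}{\Gamma(k+L+\frac32)\,\Gamma(n-k)\,\Gamma(n-l+\frac12)\,\Gamma(l+L+1)} .$$ (b) The skew-kernel $\widetilde{\boldsymbol\varkappa}_N$ satisfies $$\partial_\zeta\widetilde{\boldsymbol\varkappa}_N(\zeta,\eta)=\frac{1}{(1+\zeta^2)^{n+L+\frac12}}\Big(\mathrm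 I_N(\zeta,\eta)-\mathrm{II}_N(\zeta,\eta)-\mathrm{III}_N(\zeta,\eta)\Big),$$ where, with $\mathfrak p=\frac{\zeta\eta}{1+\zeta\eta}$ and $\mathfrak q=\frac{\eta^2}{1+\eta^2}$, $$\mathrm I_N(\zeta,\eta)=\frac{(1+\zeta\eta)^{2n+2L-1}}{(1+\eta^2)^{n+L-\frac12}}(2n+2L+1)(n+L)\sum_{k=0}^{2N-1}\binom{2n+2L-1}{k+2L}\mathfrak p^{k+2L}(1-\mathfrak p)^{2n-k-1},$$ $$\mathrm{II}_N(\zeta,\eta)=\frac{\zeta^{2N+2L}}{2^{2L+2n}}\,\frac{\pi\,\Gamma(2n+2L+2)}{\Gamma(N+L+\frac12)\Gamma(n-N)\Gamma(n+L+\frac12)}\sum_{k=0}^{N-1}\binom{n+L-\frac12}{k+L}\mathfrak q^{k+L}(1-\mathfrak q)^{n-k-\frac12},$$ $$\mathrm{III}_N(\zeta,\eta)=\frac{\zeta^{2L-1}}{2^{2L+2n}}\,\frac{\pi\,\Gamma(2n+2L+2)}{\Gamma(n+\frac12)\Gamma(L)\Gamma(n+L+\frac12)}\sum_{k=0}^{N-1}\binom{n+L-\frac12}{k+L+\frac12}\mathfrak q^{k+L+\frac12}(1-\mathfrak q)^{n-k-1}.$$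
   Context: Let $dA(\zeta)=d^2\zeta/\pi$ on $\mathbb C$. The (eigenvalue) point process considered is the random configuration $(\zeta_1,\dots,\zeta_N)\in\mathbb C^N$ with law $$d\mathbf P_N(\zeta_1,\dots,\zeta_N)=\frac1{N!\,Z_N}\prod_{1\le j<k\le N}|\zeta_j-\zeta_k|^2|\zeta_j-\bar\zeta_k|^2\prod_{j=1}^N|\zeta_j-\bar\zeta_j|^2e^{-2NQ(\zeta_j)}\,dA(\zeta_j),$$ $$Q(\zeta)=\frac{n+L+1}{N}\log(1+|\zeta|^2)-\frac{2L}{N}\log|\zeta|,$$ where $Z_N$ is the normalisation constant. Its $k$-point correlation function is $$\mathbf R_{N,k}(\zeta_1,\dots,\zeta_k)=\frac{N!}{(N-k)!}\int_{\mathbb C^{N-k}}\mathbf P_N(\zeta_1,\dots,\zeta_N)\prod_{j=k+1}^NdA(\zeta_j),$$ with $\mathbf P_N$ inside the integral denoting the density with respect to $\prod_j dA(\zeta_j)$ (and $\mathbf R_{N,k}=0$ for $k>N$). $\mathrm{Pf}$ is the Pfaffian of the $2k\times2k$ skew-symmetric matrix formed by the indicated $2\times2$ blocks. Binomial coefficients are $\binom rk=\frac{\Gamma(r+1)}{\Gamma(k+1)\Gamma(r-k+1)}$, and $1/\Gamma(0)=0$. Convention on powers: non-integer powers of $\zeta,\eta,1+\zeta^2,1+\eta^2$ are principal branches, $((1+\zeta^2)(1+\eta^2))^{s}$ means $(1+\zeta^2)^s(1+\eta^2)^s$, and the identities are understood for arguments off the corresponding branch cuts. Combined powers are read consistently with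 this: $(1+\zeta\eta)^{2n+2L-1}\mathfrak p^{k+2L}(1-\mathfrak p)^{2n-k-1}=\zeta^{k+2L}\eta^{k+2L}$, $\ \mathfrak q^{k+L}(1-\mathfrak q)^{n-k-\frac12}=\eta^{2k+2L}(1+\eta^2)^{-(n+L-\frac12)}$, $\ \mathfrak q^{k+L+\frac12}(1-\mathfrak q)^{n-k-1}=\eta^{2k+2L+1}(1+\eta^2)^{-(n+L-\frac12)}$. *)

theory Defs
  imports "HOL-Analysis.Analysis"
begin

section \<open>The point process and its correlation functions\<close>

text \<open>Area measure on the complex plane, normalised as \<open>d\<^sup>2\<zeta> / \<pi>\<close>.\<close>

definition dA :: "complex measure" where
  "dA = density lborel (\<lambda>_. ennreal (1 / pi))"

text \<open>At \<open>\<zeta> = 0\<close> the library has \<open>ln 0 = 0\<close>. This has no effect below: \<open>exp (- 2 N Q)\<close>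
  always occurs with the factor \<open>\<bar>\<zeta> - cnj \<zeta>\<bar>\<^sup>2\<close>, which vanishes there.\<close>

definition Q :: "nat \<Rightarrow> real \<Rightarrow> real \<Rightarrow> complex \<Rightarrow> real" where
  "Q N L n z = (n + L + 1) / real N * ln (1 + (cmod z)\<^sup>2) - 2 * L / real N * ln (cmod z)"

text \<open>Configurations are functions on the index set \<open>{1..N}\<close>.\<close>

definition weight :: "nat \<Rightarrow> real \<Rightarrow> real \<Rightarrow> (nat \<Rightarrow> complex) \<Rightarrow> real" where
  "weight N L n \<zeta> =
     (\<Prod>j\<in>{1..N}. \<Prod>k\<in>{j<..N}. (cmod (\<zeta> j - \<zeta> k))\<^sup>2 * (cmod (\<zeta> j - cnj (\<zeta> k)))\<^sup>2) *
     (\<Prod>j\<in>{1..N}. (cmod (\<zeta> j - cnj (\<zeta> j)))\<^sup>2 * exp (- 2 * real N * Q N L n (\<zeta> j)))"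

definition Z :: "nat \<Rightarrow> real \<Rightarrow> real \<Rightarrow> real" where
  "Z N L n = (LINT \<zeta>|(\<Pi>\<^sub>M j\<in>{1..N}. dA). weight N L n \<zeta>) / fact N"

text \<open>The density of the law with respect to the \<open>N\<close>-fold product of \<^const>\<open>dA\<close>.\<close>

definition P :: "nat \<Rightarrow> real \<Rightarrow> real \<Rightarrow> (nat \<Rightarrow> complex) \<Rightarrow> real" where
  "P N L n \<zeta> = 1 / (fact N * Z N L n) * weight N L n \<zeta>"

definition R :: "nat \<Rightarrow> real \<Rightarrow> real \<Rightarrow> nat \<Rightarrow> (nat \<Rightarrow> complex) \<Rightarrow> real" where
  "R N L n k \<zeta> =
     (if k \<le> N
      then fact N / fact (N - k) *
             (LINT \<xi>|(\<Pi>\<^sub>M j\<in>{k+1..N}. dA). P N L n (merge {1..k} {k+1..N} (\<zeta>, \<xi>)))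
      else 0)"


section \<open>Pfaffians\<close>

text \<open>The Pfaffian of a skew-symmetric \<open>2m \<times> 2m\<close> matrix with rows and columns \<open>0, \<dots>, 2m - 1\<close>.\<close>

definition Pf :: "nat \<Rightarrow> (nat \<Rightarrow> nat \<Rightarrow> complex) \<Rightarrow> complex" where
  "Pf m A =
     (\<Sum>\<sigma> | \<sigma> permutes {..<2*m}. of_int (sign \<sigma>) * (\<Prod>i<m. A (\<sigma> (2*i)) (\<sigma> (2*i+1))))
       / (2 ^ m * fact m)"

text \<open>The matrix with \<open>2 \<times> 2\<close> blocks \<open>B j l\<close>, \<open>j, l = 1, 2, \<dots>\<close>, each given as a list of rows;
  its own rows and columns are counted from \<open>0\<close>.\<close>

definition from_blocks :: "(nat \<Rightarrow> nat \<Rightarrow> complex list list) \<Rightarrow> nat \<Rightarrow> nat \<Rightarrow> complex" where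
  "from_blocks B r s = B (r div 2 + 1) (s div 2 + 1) ! (r mod 2) ! (s mod 2)"


section \<open>Powers and binomial coefficients\<close>

text \<open>Principal branch. The library has \<open>0 powr 0 = 0\<close>, whereas a power with exponent \<open>0\<close>
  (such as \<open>\<eta>\<^bsup>2l+2L\<^esup>\<close> for \<open>l = L = 0\<close>) must be \<open>1\<close> also at the origin.\<close>

definition cpow :: "complex \<Rightarrow> real \<Rightarrow> complex" where
  "cpow z s = (if z = 0 \<and> s = 0 then 1 else z powr complex_of_real s)"

text \<open>The powers of \<open>\<zeta>\<close> and of \<open>1 + \<zeta>\<^sup>2\<close> that occur have exponents in \<open>2L + \<int>\<close> and
  in \<open>n + L - 1/2 + \<int>\<close>, respectively; there is a branch cut only if these are not integers. In
  either case \<open>1 + \<zeta>\<^sup>2 = 0\<close> is excluded, as the kernel is singular there.\<close>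

definition off_cuts :: "real \<Rightarrow> real \<Rightarrow> complex \<Rightarrow> bool" where
  "off_cuts L n z \<longleftrightarrow>
     (2 * L \<in> \<int> \<or> z \<notin> \<real>\<^sub>\<le>\<^sub>0) \<and>
     (n + L - 1/2 \<in> \<int> \<or> 1 + z\<^sup>2 \<notin> \<real>\<^sub>\<le>\<^sub>0) \<and>
     1 + z\<^sup>2 \<noteq> 0"

text \<open>Here, and in the kernels below, the library's \<open>Gamma 0 = 0\<close> and \<open>x / 0 = 0\<close> implement the
  convention \<open>1 / \<Gamma>(0) = 0\<close>.\<close>

definition binom :: "real \<Rightarrow> real \<Rightarrow> real" where
  "binom r k = Gamma (r + 1) / (Gamma (k + 1) * Gamma (r - k + 1))"

text \<open>With \<open>\<pp> = \<zeta>\<eta> / (1 + \<zeta>\<eta>)\<close> and \<open>\<qq> = \<eta>\<^sup>2 / (1 + \<eta>\<^sup>2)\<close>, the combined powers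
  \<open>(1 + \<zeta>\<eta>)\<^bsup>s+t\<^esup> \<pp>\<^bsup>s\<^esup> (1 - \<pp>)\<^bsup>t\<^esup>\<close> and \<open>\<qq>\<^bsup>s\<^esup> (1 - \<qq>)\<^bsup>t\<^esup>\<close> are read as
  \<open>\<zeta>\<^bsup>s\<^esup> \<eta>\<^bsup>s\<^esup>\<close> and \<open>\<eta>\<^bsup>2s\<^esup> (1 + \<eta>\<^sup>2)\<^bsup>-(s+t)\<^esup>\<close>. For positive arguments this is an identity
  (lemmas below); in general, principal powers of \<open>\<pp>\<close> and \<open>\<qq>\<close> would differ by phase factors.\<close>

definition p_powers :: "real \<Rightarrow> real \<Rightarrow> complex \<Rightarrow> complex \<Rightarrow> complex" where
  "p_powers s t \<zeta> \<eta> = cpow \<zeta> s * cpow \<eta> s"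

definition q_powers :: "real \<Rightarrow> real \<Rightarrow> complex \<Rightarrow> complex" where
  "q_powers s t \<eta> = cpow \<eta> (2 * s) * cpow (1 + \<eta>\<^sup>2) (- (s + t))"

lemma cpow_of_pos: "x > 0 \<Longrightarrow> cpow (complex_of_real x) s = complex_of_real (x powr s)"
  by (simp add: cpow_def powr_of_real)

lemma p_powers_of_pos:
  fixes x y :: real
  assumes "x > 0" "y > 0" and p: "p = x * y / (1 + x * y)"
  shows "p_powers s t (complex_of_real x) (complex_of_real y) =
           complex_of_real ((1 + x * y) powr (s + t) * p powr s * (1 - p) powr t)"
proof -
  have pos: "1 + x * y > 0" using assms by (simp add: add_pos_pos)
  have q: "1 - p = 1 / (1 + x * y)" using pos by (simp add: p field_simps)
  have "(1 + x * y) powr (s + t) * p powr s * (1 - p) powr t = x powr s * y powr s"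
    unfolding q unfolding p using assms(1,2) pos
    by (simp add: powr_divide powr_mult powr_add field_simps)
  then show ?thesis
    using assms(1,2) by (simp add: p_powers_def cpow_of_pos)
qed

lemma q_powers_of_pos:
  fixes y :: real
  assumes "y > 0" and q: "q = y\<^sup>2 / (1 + y\<^sup>2)"
  shows "q_powers s t (complex_of_real y) = complex_of_real (q powr s * (1 - q) powr t)"
proof -
  have pos: "1 + y\<^sup>2 > 0" by (simp add: add_pos_nonneg)
  have q': "1 - q = 1 / (1 + y\<^sup>2)" using pos by (simp add: q field_simps)
  have "y\<^sup>2 powr s = y powr (2 * s)"
    using assms(1) by (simp add: powr_powr flip: powr_numeral)
  moreover have "(1 + y\<^sup>2) powr (- (s + t)) = 1 / ((1 + y\<^sup>2) powr s * (1 + y\<^sup>2) powr t)"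
    by (simp only: powr_minus_divide powr_add)
  ultimately have "q powr s * (1 - q) powr t = y powr (2 * s) * (1 + y\<^sup>2) powr (- (s + t))"
    unfolding q' unfolding q using assms(1) pos
    by (simp only: powr_divide powr_one_eq_one zero_le_power2 zero_le_one less_imp_le
          times_divide_eq_right divide_divide_eq_left mult_1_right)
  moreover have "cpow (1 + (complex_of_real y)\<^sup>2) r = complex_of_real ((1 + y\<^sup>2) powr r)" for r
    using cpow_of_pos[OF pos, of r] by simp
  ultimately show ?thesis
    using assms(1) by (simp add: q_powers_def cpow_of_pos)
qed


section \<open>The kernels\<close>

definition \<omega> :: "real \<Rightarrow> real \<Rightarrow> complex \<Rightarrow> real" where
  "\<omega> L n z = cmod (1 + z\<^sup>2) powr (n + L - 1/2) / (1 + (cmod z)\<^sup>2) powr (n + L + 1)"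

definition G_hat :: "nat \<Rightarrow> real \<Rightarrow> real \<Rightarrow> complex \<Rightarrow> complex \<Rightarrow> complex" where
  "G_hat N L n \<zeta> \<eta> =
     complex_of_real (pi * (Gamma (2*n + 2*L + 2) / 2 powr (2*L + 2*n + 1))) *
     (\<Sum>k=0..N-1. \<Sum>l=0..k.
        cpow \<zeta> (2 * real k + 2*L + 1) * cpow \<eta> (2 * real l + 2*L) /
        complex_of_real (Gamma (real k + L + 3/2) * Gamma (n - real k) *
                         Gamma (n - real l + 1/2) * Gamma (real l + L + 1)))"

definition \<kappa> :: "nat \<Rightarrow> real \<Rightarrow> real \<Rightarrow> complex \<Rightarrow> complex \<Rightarrow> complex" where
  "\<kappa> N L n \<zeta> \<eta> =
     (G_hat N L n \<zeta> \<eta> - G_hat N L n \<eta> \<zeta>) /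
     (cpow (1 + \<zeta>\<^sup>2) (n + L - 1/2) * cpow (1 + \<eta>\<^sup>2) (n + L - 1/2))"

text \<open>The prefactor \<open>(1 + \<zeta>\<eta>)\<^bsup>2n+2L-1\<^esup>\<close> is part of \<^const>\<open>p_powers\<close>.\<close>

definition I_N :: "nat \<Rightarrow> real \<Rightarrow> real \<Rightarrow> complex \<Rightarrow> complex \<Rightarrow> complex" where
  "I_N N L n \<zeta> \<eta> =
     1 / cpow (1 + \<eta>\<^sup>2) (n + L - 1/2) *
     complex_of_real ((2*n + 2*L + 1) * (n + L)) *
     (\<Sum>k=0..2*N-1. complex_of_real (binom (2*n + 2*L - 1) (real k + 2*L)) *
        p_powers (real k + 2*L) (2*n - real k - 1) \<zeta> \<eta>)"

definition II_N :: "nat \<Rightarrow> real \<Rightarrow> real \<Rightarrow> complex \<Rightarrow> complex \<Rightarrow> complex" where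
  "II_N N L n \<zeta> \<eta> =
     cpow \<zeta> (2 * real N + 2*L) / complex_of_real (2 powr (2*L + 2*n)) *
     complex_of_real (pi * Gamma (2*n + 2*L + 2) /
       (Gamma (real N + L + 1/2) * Gamma (n - real N) * Gamma (n + L + 1/2))) *
     (\<Sum>k=0..N-1. complex_of_real (binom (n + L - 1/2) (real k + L)) *
        q_powers (real k + L) (n - real k - 1/2) \<eta>)"

definition III_N :: "nat \<Rightarrow> real \<Rightarrow> real \<Rightarrow> complex \<Rightarrow> complex \<Rightarrow> complex" where
  "III_N N L n \<zeta> \<eta> =
     cpow \<zeta> (2*L - 1) / complex_of_real (2 powr (2*L + 2*n)) *
     complex_of_real (pi * Gamma (2*n + 2*L + 2) /
       (Gamma (n + 1/2) * Gamma L * Gamma (n + L + 1/2))) *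
     (\<Sum>k=0..N-1. complex_of_real (binom (n + L - 1/2) (real k + L + 1/2)) *
        q_powers (real k + L + 1/2) (n - real k - 1) \<eta>)"

end

theory Submission
  imports Defs "Jordan_Normal_Form.Determinant"
begin

text \<open>
  Both parts rest on the polynomials
  \<open>p\<^bsub>2k+1\<^esub>(z) = z\<^bsup>2k+1\<^esup>\<close> and \<open>p\<^bsub>2k\<^esub>(z) = \<Sum>\<^bsub>l\<le>k\<^esub> b\<^sub>l z\<^bsup>2l\<^esup>\<close> with
  \<open>b\<^sub>l = 1 / (\<Gamma>(n-l+1/2) \<Gamma>(l+L+1))\<close>, in which the kernel \<open>\<kappa>\<close> is, up to one-body factors, the
  finite-rank skew kernel \<open>\<Sum>\<^bsub>k<N\<^esub> (p\<^bsub>2k+1\<^esub>(\<zeta>) p\<^bsub>2k\<^esub>(\<eta>) - p\<^bsub>2k\<^esub>(\<zeta>) p\<^bsub>2k+1\<^esub>(\<eta>)) / (2 h\<^sub>k)\<close>.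

  \<^bold>\<open>Correlation functions.\<close> Put \<open>z\<^bsub>2j\<^esub> = \<zeta>\<^bsub>j+1\<^esub>\<close> and let \<open>z\<^bsub>2j+1\<^esub>\<close> be its conjugate. Up to
  one-body factors, the joint density is the Vandermonde determinant of \<open>z\<^sub>0, \<dots>, z\<^bsub>2N-1\<^esub>\<close> and
  therefore proportional to the determinant of \<open>(p\<^sub>b(z\<^sub>a))\<close> (\<open>weight_eq_mixed_Pf\<close>). Each term of its
  permutation expansion is a product over particles, so to integrate out a particle means to
  replace its factor by a skew product \<open>\<langle>p\<^sub>a, p\<^sub>b\<rangle>\<close>, the integral of \<open>p\<^sub>a(\<zeta>) p\<^sub>b(\<zeta>\<^sup>*) (\<zeta> - \<zeta>\<^sup>*)\<close> against
  \<open>exp (-2 N Q) dA\<close>, where \<open>\<zeta>\<^sup>*\<close> is the conjugate. As the one-body weight depends on \<open>\<bar>\<zeta>\<bar>\<close> only,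
  the skew products of monomials reduce to Beta integrals, and the ratios \<open>b\<^bsub>l+1\<^esub> / b\<^sub>l\<close> are those
  for which \<open>\<langle>p\<^sub>a, p\<^sub>b\<rangle>\<close> vanishes unless \<open>{a, b} = {2m, 2m+1}\<close>, when it is \<open>\<plusminus> h\<^sub>m\<close>
  (\<open>has_bochner_integral_skew_poly\<close>). Hence only the permutations that send every integrated
  particle to such a pair contribute (\<open>mixed_Pf_contract\<close>), and up to one-body factors the
  \<open>k\<close>-point function is \<open>1 / k!\<close> times the sum over the injective assignments \<open>m\<close> of pairs to the remaining \<open>k\<close> particles, of \<open>\<Prod>\<^sub>i 1 / (2 h\<^bsub>m i\<^esub>)\<close> times a
  \<open>2k \<times> 2k\<close> determinant (\<open>correlation_function_eq\<close>). The Pfaffian of a finite-rank skew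
  kernel expands into the same sum (\<open>Pf_rank_two_sum\<close>), where non-injective assignments give
  determinants with equal rows. The normalisation constant is the case \<open>k = 0\<close>. The
  principal powers only multiply rows and columns by factors whose product over a conjugate pair is
  the one-body weight (\<open>kernel_factor_mult_cnj\<close>), so no phase survives.

  \<^bold>\<open>Derivative.\<close> Let \<open>s = n + L - 1/2\<close>. Up to powers of \<open>1 + \<zeta>\<^sup>2\<close> and \<open>1 + \<eta>\<^sup>2\<close>, differentiating \<open>\<kappa>\<close> applies
  \<open>(1 + \<zeta>\<^sup>2) \<partial>\<^sub>\<zeta> - 2 s \<zeta>\<close> to a sum of powers of \<open>\<zeta>\<close>. This operator sends a power to a combination
  of its two neighbours, and with the coefficients at hand the image is a difference
  \<open>u\<^sub>k - u\<^bsub>k+1\<^esub>\<close> (respectively \<open>v\<^sub>l - v\<^bsub>l+1\<^esub>\<close>). Summation by parts leaves two boundary terms, which are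
  \<open>II\<^sub>N\<close> and \<open>III\<^sub>N\<close>, and two diagonal sums, which by the duplication formula are the terms of even
  and of odd index in \<open>I\<^sub>N\<close> (\<open>kernel_operator_identity\<close>).
\<close>


section \<open>Polarised Pfaffians\<close>

text \<open>This is \<open>2\<^sup>N N!\<close> times the polarisation of the Pfaffian. For equal skew-symmetric \<open>X j\<close> it gives the
  Pfaffian, and for \<open>X j\<close> of rank one a determinant (\<open>mixed_Pf_eq_det\<close>); thus it is the common form
  of the joint density, of its partial integrals and of the Pfaffian of a kernel.\<close>

definition mixed_Pf :: "nat \<Rightarrow> (nat \<Rightarrow> nat \<Rightarrow> nat \<Rightarrow> complex) \<Rightarrow> complex" where
  "mixed_Pf N X = (\<Sum>\<sigma> | \<sigma> permutes {..<2*N}.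
     of_int (sign \<sigma>) * (\<Prod>j<N. X j (\<sigma> (2*j)) (\<sigma> (2*j+1))))"

lemma Pf_eq_mixed_Pf: "Pf k A = mixed_Pf k (\<lambda>_. A) / (2 ^ k * fact k)"
  by (simp add: Pf_def mixed_Pf_def)

lemma mixed_Pf_cong:
  assumes "\<And>j a b. j < N \<Longrightarrow> a < 2*N \<Longrightarrow> b < 2*N \<Longrightarrow> X j a b = Y j a b"
  shows "mixed_Pf N X = mixed_Pf N Y"
  unfolding mixed_Pf_def
proof (intro sum.cong refl arg_cong2[of _ _ _ _ "(*)"] prod.cong)
  fix \<sigma> j assume "\<sigma> \<in> {\<sigma>. \<sigma> permutes {..<2*N}}" "j \<in> {..<N}"
  then have "\<sigma> (2*j) \<in> {..<2*N}" "\<sigma> (2*j+1) \<in> {..<2*N}"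
    by (subst permutes_in_image; auto)+
  then show "X j (\<sigma> (2*j)) (\<sigma> (2*j+1)) = Y j (\<sigma> (2*j)) (\<sigma> (2*j+1))"
    using assms \<open>j \<in> _\<close> by simp
qed

lemma mixed_Pf_scale: "mixed_Pf N (\<lambda>j a b. c j * X j a b) = (\<Prod>j<N. c j) * mixed_Pf N X"
  by (simp add: mixed_Pf_def prod.distrib sum_distrib_left mult_ac)

lemma mixed_Pf_relabel:
  assumes \<tau>: "\<tau> permutes {..<2*N}"
  shows "mixed_Pf N (\<lambda>j a b. X j (\<tau> a) (\<tau> b)) = of_int (sign \<tau>) * mixed_Pf N X"
proof -
  have 1: "of_int (sign (\<tau> \<circ> \<sigma>)) * of_int (sign \<tau>) = (of_int (sign \<sigma>) :: complex)" if "\<sigma> permutes {..<2*N}" for \<sigma>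
  proof -
    have "sign (\<tau> \<circ> \<sigma>) * sign \<tau> = sign \<sigma>"
      using \<tau> that by (subst sign_compose) (auto simp: permutation_permutes sign_def)
    then show ?thesis by (metis of_int_mult)
  qed
  have "of_int (sign \<tau>) * mixed_Pf N X = (\<Sum>\<sigma> | \<sigma> permutes {..<2*N}. of_int (sign (\<tau> \<circ> \<sigma>)) * of_int (sign \<tau>) *
     (\<Prod>j<N. X j (\<tau> (\<sigma> (2*j))) (\<tau> (\<sigma> (2*j+1)))))"
    unfolding mixed_Pf_def by (subst setum_permutations_compose_left[OF \<tau>]) (simp add: sum_distrib_left mult_ac)
  also have "\<dots> = mixed_Pf N (\<lambda>j a b. X j (\<tau> a) (\<tau> b))"
    unfolding mixed_Pf_def by (intro sum.cong refl) (simp add: 1)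
  finally show ?thesis ..
qed

text \<open>Composing the permutation with the transposition of the positions \<open>2i\<close> and \<open>2i+1\<close> flips its sign.\<close>

lemma mixed_Pf_flip:
  assumes "i < N"
  shows "mixed_Pf N (X(i := \<lambda>a b. X i b a)) = - mixed_Pf N X"
proof -
  let ?t = "Transposition.transpose (2*i) (2*i+1) :: nat \<Rightarrow> nat"
  have t: "?t permutes {..<2*N}" using assms by (intro permutes_swap_id) auto
  have sgn: "sign (\<sigma> \<circ> ?t) = - sign \<sigma>" if "\<sigma> permutes {..<2*N}" for \<sigma>
    using t that by (subst sign_compose) (auto simp: permutation_permutes sign_swap_id)
  have "(\<Prod>j<N. (X(i := \<lambda>a b. X i b a)) j ((\<sigma> \<circ> ?t) (2*j)) ((\<sigma> \<circ> ?t) (2*j+1))) =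
        (\<Prod>j<N. X j (\<sigma> (2*j)) (\<sigma> (2*j+1)))" for \<sigma>
  proof (intro prod.cong refl)
    fix j
    have "?t (2*j) = 2*j \<and> ?t (2*j+1) = 2*j+1" if "j \<noteq> i"
      using that by (auto simp: Transposition.transpose_def)
    then show "(X(i := \<lambda>a b. X i b a)) j ((\<sigma> \<circ> ?t) (2*j)) ((\<sigma> \<circ> ?t) (2*j+1)) = X j (\<sigma> (2*j)) (\<sigma> (2*j+1))"
      by (cases "j = i") auto
  qed
  then have "mixed_Pf N (X(i := \<lambda>a b. X i b a)) = (\<Sum>\<sigma> | \<sigma> permutes {..<2*N}.
     of_int (sign (\<sigma> \<circ> ?t)) * (\<Prod>j<N. X j (\<sigma> (2*j)) (\<sigma> (2*j+1))))"
    unfolding mixed_Pf_def by (subst sum_permutations_compose_right[OF t]) simp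
  also have "\<dots> = (\<Sum>\<sigma> | \<sigma> permutes {..<2*N}. - (of_int (sign \<sigma>) * (\<Prod>j<N. X j (\<sigma> (2*j)) (\<sigma> (2*j+1)))))"
    by (intro sum.cong refl) (simp add: sgn del: One_nat_def add_Suc_right)
  also have "\<dots> = - mixed_Pf N X"
    by (simp add: mixed_Pf_def sum_negf)
  finally show ?thesis .
qed

lemma mixed_Pf_diff:
  assumes "i < N"
  shows "mixed_Pf N (X(i := \<lambda>a b. A a b - B a b)) = mixed_Pf N (X(i := A)) - mixed_Pf N (X(i := B))"
proof -
  have "(\<Prod>j<N. (X(i := C)) j (\<sigma> (2*j)) (\<sigma> (2*j+1))) =
      C (\<sigma> (2*i)) (\<sigma> (2*i+1)) * (\<Prod>j\<in>{..<N} - {i}. X j (\<sigma> (2*j)) (\<sigma> (2*j+1)))" for C \<sigma>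
    using assms by (subst prod.remove[of _ i]) (auto intro!: prod.cong)
  then show ?thesis
    by (simp add: mixed_Pf_def algebra_simps flip: sum_subtractf)
qed

text \<open>The antisymmetrised matrices may be replaced one at a time, each step doubling the value by
  \<open>mixed_Pf_flip\<close>.\<close>

lemma mixed_Pf_antisymmetrize:
  "mixed_Pf N (\<lambda>j a b. X j a b - X j b a) = 2 ^ N * mixed_Pf N X"
proof -
  define Y where "Y S j a b = (if j \<in> S then X j a b - X j b a else X j a b)" for S :: "nat set" and j a b
  have "mixed_Pf N (Y S) = 2 ^ card S * mixed_Pf N X" if "finite S" "S \<subseteq> {..<N}" for S
    using that
  proof (induction S)
    case empty
    show ?case by (simp add: Y_def)
  next
    case (insert i S)
    then have i: "i < N" by simp
    have "Y (insert i S) = (Y S)(i := \<lambda>a b. Y S i a b - Y S i b a)"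
      using insert.hyps by (auto simp: Y_def fun_eq_iff)
    then have "mixed_Pf N (Y (insert i S)) = 2 * mixed_Pf N (Y S)"
      by (simp only: mixed_Pf_diff[OF i] mixed_Pf_flip[OF i] fun_upd_triv) simp
    then show ?case using insert by simp
  qed
  from this[of "{..<N}"] show ?thesis by (simp add: Y_def cong: mixed_Pf_cong)
qed

lemma prod_lessThan_double: "(\<Prod>a<2*(k::nat). g a) = (\<Prod>i<k. g (2*i) * g (2*i+1) :: 'a::comm_monoid_mult)"
  by (induction k) (simp_all add: mult_ac)

lemma mixed_Pf_eq_det:
  "mixed_Pf k (\<lambda>j a b. A (2*j) a * A (2*j+1) b) = Determinant.det (mat (2*k) (2*k) (\<lambda>(r,c). A r c))"
proof -
  have "(\<Prod>i = 0..<2*k. mat (2*k) (2*k) (\<lambda>(r,c). A r c) $$ (i, \<sigma> i)) =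
        (\<Prod>j<k. A (2*j) (\<sigma> (2*j)) * A (2*j+1) (\<sigma> (2*j+1)))" if \<sigma>: "\<sigma> permutes {0..<2*k}" for \<sigma>
  proof -
    have "(\<Prod>i = 0..<2*k. mat (2*k) (2*k) (\<lambda>(r,c). A r c) $$ (i, \<sigma> i)) = (\<Prod>i<2*k. A i (\<sigma> i))"
      using permutes_in_image[OF \<sigma>] by (auto simp: lessThan_atLeast0 intro!: prod.cong)
    then show ?thesis by (simp only: prod_lessThan_double)
  qed
  then show ?thesis
    unfolding mixed_Pf_def Determinant.det_def'[OF mat_carrier]
    by (auto simp: lessThan_atLeast0 intro!: sum.cong)
qed


text \<open>The action of a map of pairs on the points \<open>0, 1, 2, \<dots>\<close>, grouped into pairs \<open>{2i, 2i+1}\<close>.\<close>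

definition lift_pair :: "(nat \<Rightarrow> nat) \<Rightarrow> nat \<Rightarrow> nat" where
  "lift_pair m a = 2 * m (a div 2) + a mod 2"

lemma lift_pair_div [simp]: "lift_pair m a div 2 = m (a div 2)"
  and even_lift_pair [simp]: "even (lift_pair m a) = even a"
  by (auto simp: lift_pair_def) 

lemma lift_pair_comp: "lift_pair m (lift_pair m' a) = lift_pair (m \<circ> m') a"
  by (simp add: lift_pair_def)

lemma lift_pair_double [simp]: "lift_pair m (2 * i) = 2 * m i" "lift_pair m (2 * i + 1) = 2 * m i + 1"
   "lift_pair m (Suc (2 * i)) = Suc (2 * m i)"
  by (auto simp: lift_pair_def)

lemma lift_pair_transpose:
  assumes "i \<noteq> j"
  shows "lift_pair (Transposition.transpose i j) = Transposition.transpose (2*i) (2*j) \<circ> Transposition.transpose (2*i+1) (2*j+1)"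
proof
  fix a :: nat
  obtain c where "a = 2 * c \<or> a = 2 * c + 1" by (metis oddE evenE)
  then show "lift_pair (Transposition.transpose i j) a = (Transposition.transpose (2*i) (2*j) \<circ> Transposition.transpose (2*i+1) (2*j+1)) a"
    using assms by (elim disjE) (simp_all add: Transposition.transpose_def)
qed

text \<open>The lift of a transposition is a product of two transpositions, one of even and one of odd points.\<close>

lemma lift_pair_permutes:
  assumes "m permutes {..<N}"
  shows "lift_pair m permutes {..<2*N} \<and> sign (lift_pair m) = 1"
  using assms finite_lessThan
proof (induction rule: permutes_induct)
  case id
  have "lift_pair id = id" by (auto simp: lift_pair_def fun_eq_iff)
  then show ?case by (simp only: permutes_id sign_id)
next
  case (swap i j p)
  have comp: "lift_pair (Transposition.transpose i j \<circ> p) = lift_pair (Transposition.transpose i j) \<circ> lift_pair p"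
    by (auto simp: lift_pair_comp)
  have "Transposition.transpose (2*i) (2*j) permutes {..<2*N}" "Transposition.transpose (2*i+1) (2*j+1) permutes {..<2*N}"
    using swap by (auto intro!: permutes_swap_id)
  then have t: "lift_pair (Transposition.transpose i j) permutes {..<2*N} \<and> sign (lift_pair (Transposition.transpose i j)) = 1"
    using swap unfolding lift_pair_transpose[OF \<open>i \<noteq> j\<close>]
    by (subst sign_compose) (auto simp: permutation_permutes sign_swap_id intro: permutes_compose)
  then show ?case
    unfolding comp using swap by (subst sign_compose) (auto simp: permutation_permutes intro: permutes_compose)
qed

text \<open>The block-diagonal skew matrix with blocks \<open>(0, H i; -H i, 0)\<close>.\<close>

definition pairing :: "(nat \<Rightarrow> complex) \<Rightarrow> nat \<Rightarrow> nat \<Rightarrow> complex" where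
  "pairing H a b = (if a div 2 = b div 2
     then (if even a \<and> odd b then H (a div 2) else if odd a \<and> even b then - H (a div 2) else 0) else 0)"

lemma pairing_double [simp]: "pairing H (2*i) (Suc (2*i)) = H i" "pairing H (Suc (2*i)) (2*i) = - H i"
  by (simp_all add: pairing_def)

text \<open>Only permutations that send the last two positions to a common pair \<open>{2i, 2i+1}\<close> contribute. The
  two orders contribute equally, since the sign of the permutation and of the matrix entry change
  together; exchanging the pairs \<open>i\<close> and \<open>n\<close> turns the rest into a permutation of the first \<open>2n\<close>
  points.\<close>

lemma mixed_Pf_contract_last:
  assumes X: "\<And>a b. a < 2 * Suc n \<Longrightarrow> b < 2 * Suc n \<Longrightarrow> X n a b = pairing H a b"
  shows "mixed_Pf (Suc n) X = (\<Sum>i\<le>n. 2 * H i * mixed_Pf n (\<lambda>j a b.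
           X j (lift_pair (Transposition.transpose i n) a) (lift_pair (Transposition.transpose i n) b)))"
proof -
  define S where "S = {\<sigma>. \<sigma> permutes {..<2 * Suc n}}"
  define f where "f \<sigma> = of_int (sign \<sigma>) * (\<Prod>j<Suc n. X j (\<sigma> (2*j)) (\<sigma> (2*j+1)))" for \<sigma>
  define A where "A i = {\<sigma>\<in>S. \<sigma> (2*n) = 2*i \<and> \<sigma> (2*n+1) = 2*i+1}" for i
  define B where "B i = {\<sigma>\<in>S. \<sigma> (2*n) = 2*i+1 \<and> \<sigma> (2*n+1) = 2*i}" for i
  have finS: "finite S" unfolding S_def by (simp add: finite_permutations)
  have bound: "\<sigma> (2*n) < 2 * Suc n \<and> \<sigma> (2*n+1) < 2 * Suc n \<and> \<sigma> (2*n) \<noteq> \<sigma> (2*n+1)" if "\<sigma> \<in> S" for \<sigma>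
  proof -
    have "\<sigma> (2*n) \<noteq> \<sigma> (2*n+1)"
      using that permutes_inj[of \<sigma> "{..<2 * Suc n}"] by (auto simp: S_def dest!: injD)
    then show ?thesis
      using that permutes_in_image[of \<sigma> "{..<2 * Suc n}" "2*n"]
        permutes_in_image[of \<sigma> "{..<2 * Suc n}" "2*n+1"] by (auto simp: S_def)
  qed
  have split: "f \<sigma> = (\<Sum>i\<le>n. (if \<sigma> \<in> A i then f \<sigma> else 0) + (if \<sigma> \<in> B i then f \<sigma> else 0))" if \<sigma>: "\<sigma> \<in> S" for \<sigma>
  proof -
    let ?u = "\<sigma> (2*n)" and ?v = "\<sigma> (2*n+1)"
    have b: "?u < 2 * Suc n" "?v < 2 * Suc n" "?u \<noteq> ?v" using bound[OF \<sigma>] by auto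
    have "\<sigma> \<in> A i \<longleftrightarrow> ?u div 2 = i \<and> (even ?u \<and> ?v = Suc ?u)" for i
      using \<sigma> by (auto simp: A_def)
    then have SA: "(\<Sum>i\<le>n. if \<sigma> \<in> A i then f \<sigma> else 0) = (if even ?u \<and> ?v = Suc ?u then f \<sigma> else 0)"
      using b(1) by (auto simp: sum.delta if_distrib cong: if_cong)
    have "\<sigma> \<in> B i \<longleftrightarrow> ?v div 2 = i \<and> (even ?v \<and> ?u = Suc ?v)" for i
      using \<sigma> by (auto simp: B_def)
    then have SB: "(\<Sum>i\<le>n. if \<sigma> \<in> B i then f \<sigma> else 0) = (if even ?v \<and> ?u = Suc ?v then f \<sigma> else 0)"
      using b(2) by (auto simp: sum.delta if_distrib cong: if_cong)
    have zero: "f \<sigma> = 0" if "\<not> (even ?u \<and> ?v = Suc ?u)" "\<not> (even ?v \<and> ?u = Suc ?v)"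
    proof -
      have "pairing H ?u ?v = 0"
        using that b(3) unfolding pairing_def
        by (auto elim!: evenE oddE)
      then show ?thesis using X[OF b(1,2)] by (simp add: f_def)
    qed
    show ?thesis
      unfolding sum.distrib SA SB using zero by auto
  qed
  have "mixed_Pf (Suc n) X = (\<Sum>\<sigma>\<in>S. f \<sigma>)"
    by (simp add: mixed_Pf_def f_def S_def)
  also have "\<dots> = (\<Sum>\<sigma>\<in>S. \<Sum>i\<le>n. (if \<sigma> \<in> A i then f \<sigma> else 0) + (if \<sigma> \<in> B i then f \<sigma> else 0))"
    by (intro sum.cong refl split)
  also have "\<dots> = (\<Sum>i\<le>n. (\<Sum>\<sigma>\<in>S. if \<sigma> \<in> A i then f \<sigma> else 0) + (\<Sum>\<sigma>\<in>S. if \<sigma> \<in> B i then f \<sigma> else 0))"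
    by (subst sum.swap) (simp add: sum.distrib)
  also have "\<dots> = (\<Sum>i\<le>n. sum f (A i) + sum f (B i))"
  proof -
    have "S \<inter> A i = A i" "S \<inter> B i = B i" for i by (auto simp: A_def B_def)
    then show ?thesis by (simp add: sum.inter_restrict[OF finS, symmetric])
  qed
  also have "\<dots> = (\<Sum>i\<le>n. 2 * H i * mixed_Pf n (\<lambda>j a b.
           X j (lift_pair (Transposition.transpose i n) a) (lift_pair (Transposition.transpose i n) b)))"
  proof (intro sum.cong refl)
    fix i assume i: "i \<in> {..n}"
    let ?t = "Transposition.transpose (2*n) (2*n+1) :: nat \<Rightarrow> nat"
    have t: "?t permutes {..<2 * Suc n}" by (intro permutes_swap_id) auto
    have tt: "(\<sigma> \<circ> ?t) \<circ> ?t = \<sigma>" for \<sigma> :: "nat \<Rightarrow> nat" by (auto simp: fun_eq_iff)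
    have pt: "\<sigma> \<circ> ?t permutes {..<2 * Suc n}" if "\<sigma> permutes {..<2 * Suc n}" for \<sigma>
      using permutes_compose[OF t that] .
    \<comment> \<open>The two orders of a pair contribute equally.\<close>
    have BA: "sum f (B i) = sum f (A i)"
    proof (rule sum.reindex_bij_witness[where i = "\<lambda>\<sigma>. \<sigma> \<circ> ?t" and j = "\<lambda>\<sigma>. \<sigma> \<circ> ?t"])
      fix \<sigma> assume \<sigma>: "\<sigma> \<in> B i"
      then have p: "\<sigma> permutes {..<2 * Suc n}" by (simp add: B_def S_def)
      have "sign (\<sigma> \<circ> ?t) = - sign \<sigma>"
        using t p by (subst sign_compose) (auto simp: permutation_permutes sign_swap_id)
      moreover have "(\<Prod>j<n. X j ((\<sigma> \<circ> ?t) (2*j)) ((\<sigma> \<circ> ?t) (2*j+1))) = (\<Prod>j<n. X j (\<sigma> (2*j)) (\<sigma> (2*j+1)))"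
        by (intro prod.cong refl) (auto simp: Transposition.transpose_def)
      moreover have "X n (\<sigma> (2*n)) (\<sigma> (2*n+1)) = - H i" "X n ((\<sigma> \<circ> ?t) (2*n)) ((\<sigma> \<circ> ?t) (2*n+1)) = H i"
        using \<sigma> i by (auto simp: B_def X)
      ultimately show "f (\<sigma> \<circ> ?t) = f \<sigma>" by (simp add: f_def)
      show "\<sigma> \<circ> ?t \<in> A i" using pt[OF p] \<sigma> unfolding A_def B_def S_def by simp
    next
      fix \<sigma> assume \<sigma>: "\<sigma> \<in> A i"
      then have p: "\<sigma> permutes {..<2 * Suc n}" by (simp add: A_def S_def)
      show "\<sigma> \<circ> ?t \<in> B i" using pt[OF p] \<sigma> unfolding A_def B_def S_def by simp
    qed (rule tt)+
    let ?\<tau> = "lift_pair (Transposition.transpose i n)"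
    have "Transposition.transpose i n permutes {..<Suc n}" using i by (intro permutes_swap_id) auto
    then have \<tau>: "?\<tau> permutes {..<2 * Suc n}" "sign ?\<tau> = 1" using lift_pair_permutes by blast+
    have \<tau>\<tau>: "?\<tau> (?\<tau> a) = a" for a
      by (simp add: lift_pair_comp) (simp add: lift_pair_def)
    have \<tau>n: "?\<tau> (2*n) = 2*i" "?\<tau> (2*n+1) = 2*i+1" "?\<tau> (2*i) = 2*n" "?\<tau> (2*i+1) = 2*n+1"
      by (auto simp only: lift_pair_double transpose_apply_first transpose_apply_second)
    have "H i * mixed_Pf n (\<lambda>j a b. X j (?\<tau> a) (?\<tau> b)) = sum f (A i)"
      unfolding mixed_Pf_def sum_distrib_left
    proof (rule sum.reindex_bij_witness[where i = "\<lambda>\<sigma>. ?\<tau> \<circ> \<sigma>" and j = "\<lambda>\<sigma>. ?\<tau> \<circ> \<sigma>"])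
      fix q assume q: "q \<in> {\<sigma>. \<sigma> permutes {..<2*n}}"
      then have q': "q permutes {..<2 * Suc n}" by (auto intro: permutes_subset)
      have fix_q: "q (2*n) = 2*n" "q (2*n+1) = 2*n+1" using q by (auto intro: permutes_not_in)
      have sgn: "sign (?\<tau> \<circ> q) = sign q"
        using \<tau> q' by (subst sign_compose) (auto simp: permutation_permutes)
      show "?\<tau> \<circ> q \<in> A i"
        using \<tau> q' fix_q \<tau>n by (auto simp: A_def S_def intro: permutes_compose)
      have "X n ((?\<tau> \<circ> q) (2*n)) ((?\<tau> \<circ> q) (2*n+1)) = H i"
        using i by (simp only: o_apply fix_q \<tau>n, subst X) auto
      then show "f (?\<tau> \<circ> q) = H i * (of_int (sign q) * (\<Prod>j<n. X j (?\<tau> (q (2*j))) (?\<tau> (q (2*j+1)))))"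
        by (simp add: f_def sgn)
    next
      fix \<sigma> assume \<sigma>: "\<sigma> \<in> A i"
      then have p: "?\<tau> \<circ> \<sigma> permutes {..<2 * Suc n}" using \<tau> by (auto simp: A_def S_def intro: permutes_compose)
      have "(?\<tau> \<circ> \<sigma>) (2*n) = 2*n" "(?\<tau> \<circ> \<sigma>) (2*n+1) = 2*n+1"
        using \<sigma> \<tau>n by (auto simp: A_def)
      moreover have "x = 2*n \<or> x = 2*n+1" if "x \<in> {..<2 * Suc n} - {..<2*n}" for x
        using that by auto
      ultimately have "?\<tau> \<circ> \<sigma> permutes {..<2*n}"
        by (intro permutes_superset[OF p]) metis
      then show "?\<tau> \<circ> \<sigma> \<in> {\<sigma>. \<sigma> permutes {..<2*n}}" by simp
    qed (simp_all add: \<tau>\<tau> fun_eq_iff)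
    with BA show "sum f (A i) + sum f (B i) = 2 * H i * mixed_Pf n (\<lambda>j a b. X j (?\<tau> a) (?\<tau> b))"
      by simp
  qed
  finally show ?thesis .
qed

definition injections :: "nat \<Rightarrow> nat \<Rightarrow> (nat \<Rightarrow> nat) set" where
  "injections k n = {m \<in> {..<k} \<rightarrow>\<^sub>E {..<n}. inj_on m {..<k}}"

lemma finite_injections [simp]: "finite (injections k n)"
  unfolding injections_def by (rule finite_subset[OF _ finite_PiE[of "{..<k}" "\<lambda>_. {..<n}"]]) auto

lemma card_injections_self: "card (injections k k) = fact k"
proof -
  have "(\<Prod>i = 0..<k. k - i) = fact k"
    by (simp add: fact_prod_rev flip: prod.atLeastLessThan_rev_at_least_Suc_atMost)
  then show ?thesis
    unfolding injections_def by (subst card_inj_on_subset_funcset) auto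
qed

text \<open>Exchanging \<open>i\<close> and \<open>n\<close> identifies the injections into \<open>{..<n}\<close> with those into \<open>{..n}\<close> that
  avoid \<open>i\<close>; an injection of \<open>{..<k}\<close> avoids \<open>n + 1 - k\<close> values.\<close>

lemma sum_injections_avoiding_one:
  fixes F :: "(nat \<Rightarrow> nat) \<Rightarrow> 'a :: comm_semiring_1"
  assumes F: "\<And>m m'. (\<And>i. i < k \<Longrightarrow> m i = m' i) \<Longrightarrow> F m = F m'" and k: "k \<le> Suc n"
  shows "(\<Sum>i\<le>n. \<Sum>m\<in>injections k n. F (Transposition.transpose i n \<circ> m)) =
         of_nat (Suc n - k) * (\<Sum>m\<in>injections k (Suc n). F m)"
proof -
  let ?I = "injections k (Suc n)"
  have "(\<Sum>m\<in>injections k n. F (Transposition.transpose i n \<circ> m)) = (\<Sum>m | m \<in> ?I \<and> i \<notin> m ` {..<k}. F m)"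
    if i: "i \<le> n" for i
  proof (rule sum.reindex_bij_witness[where i = "\<lambda>m. restrict (Transposition.transpose i n \<circ> m) {..<k}"
        and j = "\<lambda>m. restrict (Transposition.transpose i n \<circ> m) {..<k}"])
    fix m assume m: "m \<in> injections k n"
    then have bd: "m x < n" if "x < k" for x using that by (auto simp: injections_def)
    have inj: "inj_on m {..<k}" using m by (simp add: injections_def)
    show "restrict (Transposition.transpose i n \<circ> restrict (Transposition.transpose i n \<circ> m) {..<k}) {..<k} = m"
      using m by (auto simp: fun_eq_iff injections_def restrict_def PiE_def extensional_def)
    have "Transposition.transpose i n (m x) \<le> n \<and> Transposition.transpose i n (m x) \<noteq> i" if "x < k" for x
      using bd[OF that] i by (auto simp: Transposition.transpose_def)
    moreover have "inj_on (Transposition.transpose i n \<circ> m) {..<k}"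
      by (intro comp_inj_on inj inj_on_transpose)
    ultimately show "restrict (Transposition.transpose i n \<circ> m) {..<k} \<in> {m. m \<in> ?I \<and> i \<notin> m ` {..<k}}"
      by (auto simp: injections_def less_Suc_eq_le) metis+
    show "F (restrict (Transposition.transpose i n \<circ> m) {..<k}) = F (Transposition.transpose i n \<circ> m)"
      by (rule F) auto
  next
    fix m assume m: "m \<in> {m. m \<in> ?I \<and> i \<notin> m ` {..<k}}"
    have bd: "m x \<le> n \<and> m x \<noteq> i" if x: "x < k" for x
    proof -
      have "m \<in> {..<k} \<rightarrow>\<^sub>E {..<Suc n}" using m by (simp add: injections_def)
      from PiE_mem[OF this] have "m x \<in> {..<Suc n}" using x by simp
      moreover have "m x \<noteq> i"
      proof
        assume "m x = i"
        then have "i \<in> m ` {..<k}" using x by (intro image_eqI[of _ _ x]) simp_all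
        then show False using m by simp
      qed
      ultimately show ?thesis by (simp add: less_Suc_eq_le)
    qed
    have inj: "inj_on m {..<k}" using m by (simp add: injections_def)
    show "restrict (Transposition.transpose i n \<circ> restrict (Transposition.transpose i n \<circ> m) {..<k}) {..<k} = m"
      using m by (auto simp: fun_eq_iff injections_def restrict_def PiE_def extensional_def)
    have "Transposition.transpose i n (m x) < n" if "x < k" for x
      using bd[OF that] i by (auto simp: Transposition.transpose_def)
    moreover have "inj_on (Transposition.transpose i n \<circ> m) {..<k}"
      by (intro comp_inj_on inj inj_on_transpose)
    ultimately show "restrict (Transposition.transpose i n \<circ> m) {..<k} \<in> injections k n"
      by (auto simp: injections_def)
  qed
  then have "(\<Sum>i\<le>n. \<Sum>m\<in>injections k n. F (Transposition.transpose i n \<circ> m)) =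
      (\<Sum>i\<le>n. \<Sum>m | m \<in> ?I \<and> i \<notin> m ` {..<k}. F m)" by simp
  also have "\<dots> = (\<Sum>m\<in>?I. \<Sum>i | i \<in> {..n} \<and> i \<notin> m ` {..<k}. F m)"
    by (rule sum.swap_restrict) auto
  also have "\<dots> = (\<Sum>m\<in>?I. of_nat (Suc n - k) * F m)"
  proof (intro sum.cong refl)
    fix m assume m: "m \<in> ?I"
    have "{i. i \<in> {..n} \<and> i \<notin> m ` {..<k}} = {..n} - m ` {..<k}" by auto
    moreover have "card ({..n} - m ` {..<k}) = Suc n - k"
    proof -
      have mE: "m \<in> {..<k} \<rightarrow>\<^sub>E {..<Suc n}" and "inj_on m {..<k}" using m by (simp_all add: injections_def)
      have "m x \<le> n" if "x < k" for x using PiE_mem[OF mE, of x] that by simp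
      then show ?thesis
        using \<open>inj_on m _\<close> by (subst card_Diff_subset) (auto simp: card_image)
    qed
    ultimately show "(\<Sum>i | i \<in> {..n} \<and> i \<notin> m ` {..<k}. F m) = of_nat (Suc n - k) * F m" by simp
  qed
  finally show ?thesis by (simp add: sum_distrib_left)
qed

text \<open>This integrates out all particles from \<open>k\<close> on: iterating \<open>mixed_Pf_contract_last\<close> removes one pair
  at a time, and what remains is an assignment of distinct pairs to the first \<open>k\<close>
  particles. The additional relabelling \<open>m\<close> is what makes the induction go through. Dividing by the
  block entries makes every pair, used or contracted, enter symmetrically.\<close>

lemma mixed_Pf_contract:
  fixes X :: "nat \<Rightarrow> nat \<Rightarrow> nat \<Rightarrow> complex" and H :: "nat \<Rightarrow> complex"
  assumes kN: "k \<le> N" and X: "\<And>j. j \<ge> k \<Longrightarrow> X j = pairing H" and H: "\<And>i. H i \<noteq> 0"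
    and m: "inj_on m {..<N}"
  shows "fact k * (\<Prod>i<N. 1 / (2 * H (m i))) * mixed_Pf N (\<lambda>j a b. X j (lift_pair m a) (lift_pair m b)) =
         fact (N - k) * (\<Sum>m'\<in>injections k N. (\<Prod>i<k. 1 / (2 * H (m (m' i)))) *
            mixed_Pf k (\<lambda>j a b. X j (lift_pair (m \<circ> m') a) (lift_pair (m \<circ> m') b)))"
  using kN m
proof (induction N arbitrary: m rule: dec_induct)
  case base
  have "(\<Prod>i<k. 1 / (2 * H (m (m' i)))) * mixed_Pf k (\<lambda>j a b. X j (lift_pair (m \<circ> m') a) (lift_pair (m \<circ> m') b)) =
        (\<Prod>i<k. 1 / (2 * H (m i))) * mixed_Pf k (\<lambda>j a b. X j (lift_pair m a) (lift_pair m b))"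
    if m': "m' \<in> injections k k" for m'
  proof -
    \<comment> \<open>An injection of \<open>{..<k}\<close> into itself extends to a permutation, whose lift is even.\<close>
    define p where "p i = (if i < k then m' i else i)" for i
    have "m' ` {..<k} = {..<k}"
    proof (rule endo_inj_surj)
      have "m' \<in> {..<k} \<rightarrow>\<^sub>E {..<k}" using m' by (simp add: injections_def)
      then show "m' ` {..<k} \<subseteq> {..<k}" by (auto dest: PiE_mem)
    qed (use m' in \<open>simp_all add: injections_def\<close>)
    moreover have "inj_on m' {..<k}" using m' by (simp add: injections_def)
    ultimately have bij: "bij_betw m' {..<k} {..<k}" by (simp only: bij_betw_def simp_thms)
    from bij have "bij_betw p {..<k} {..<k}" by (rule bij_betw_cong[THEN iffD1, rotated]) (auto simp: p_def)
    then have p: "p permutes {..<k}" by (rule bij_imp_permutes) (auto simp: p_def)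
    have "mixed_Pf k (\<lambda>j a b. X j (lift_pair (m \<circ> m') a) (lift_pair (m \<circ> m') b)) =
          mixed_Pf k (\<lambda>j a b. X j (lift_pair m (lift_pair p a)) (lift_pair m (lift_pair p b)))"
    proof (rule mixed_Pf_cong)
      have "lift_pair (m \<circ> m') a = lift_pair m (lift_pair p a)" if "a < 2 * k" for a
        using that less_mult_imp_div_less[of a k 2] by (simp add: lift_pair_def p_def mult.commute)
      then show "X j (lift_pair (m \<circ> m') a) (lift_pair (m \<circ> m') b) =
          X j (lift_pair m (lift_pair p a)) (lift_pair m (lift_pair p b))" if "a < 2 * k" "b < 2 * k" for j a b
        using that by simp
    qed
    also have "\<dots> = mixed_Pf k (\<lambda>j a b. X j (lift_pair m a) (lift_pair m b))"
      using lift_pair_permutes[OF p]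
        mixed_Pf_relabel[of "lift_pair p" k "\<lambda>j a b. X j (lift_pair m a) (lift_pair m b)"] by simp
    finally have 1: "mixed_Pf k (\<lambda>j a b. X j (lift_pair (m \<circ> m') a) (lift_pair (m \<circ> m') b)) =
       mixed_Pf k (\<lambda>j a b. X j (lift_pair m a) (lift_pair m b))" .
    have "(\<Prod>i<k. 1 / (2 * H (m (m' i)))) = (\<Prod>i<k. 1 / (2 * H (m i)))"
      by (rule prod.reindex_bij_betw[OF bij])
    with 1 show ?thesis by simp
  qed
  note same = this
  show ?case by (subst sum.cong[OF refl same]) (simp_all add: card_injections_self mult.assoc)
next
  case (step N)
  let ?s = "\<lambda>i. Transposition.transpose i N"
  define F where "F m'' = (\<Prod>i<k. 1 / (2 * H (m (m'' i)))) *
            mixed_Pf k (\<lambda>j a b. X j (lift_pair (m \<circ> m'') a) (lift_pair (m \<circ> m'') b))" for m''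
  have last: "X N (lift_pair m a) (lift_pair m b) = pairing (\<lambda>i. H (m i)) a b"
    if "a < 2 * Suc N" "b < 2 * Suc N" for a b
  proof -
    have "m (a div 2) = m (b div 2) \<longleftrightarrow> a div 2 = b div 2"
      using step.prems that by (auto dest: inj_onD)
    then show ?thesis using step.hyps by (simp add: X pairing_def)
  qed
  have one: "fact k * (\<Prod>i'<Suc N. 1 / (2 * H (m i'))) * (2 * H (m i) *
       mixed_Pf N (\<lambda>j a b. X j (lift_pair m (lift_pair (?s i) a)) (lift_pair m (lift_pair (?s i) b)))) =
       fact (N - k) * (\<Sum>m'\<in>injections k N. F (?s i \<circ> m'))" if i: "i \<le> N" for i
  proof -
    have s: "?s i permutes {..<Suc N}" using i by (intro permutes_swap_id) auto
    have "(\<Prod>i'<Suc N. 1 / (2 * H (m i'))) = (\<Prod>i'<Suc N. 1 / (2 * H (m (?s i i'))))"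
      using s by (rule prod.permute[of _ _ "\<lambda>i'. 1 / (2 * H (m i'))", unfolded comp_def])
    then have c: "(\<Prod>i'<Suc N. 1 / (2 * H (m i'))) * (2 * H (m i)) = (\<Prod>i'<N. 1 / (2 * H ((m \<circ> ?s i) i')))"
      using H by simp
    have inj: "inj_on (m \<circ> ?s i) {..<N}"
    proof (rule comp_inj_on)
      show "inj_on m (?s i ` {..<N})"
        using i by (intro inj_on_subset[OF step.prems]) (auto simp: Transposition.transpose_def)
    qed simp
    have "fact k * (\<Prod>i'<Suc N. 1 / (2 * H (m i'))) * (2 * H (m i) *
       mixed_Pf N (\<lambda>j a b. X j (lift_pair m (lift_pair (?s i) a)) (lift_pair m (lift_pair (?s i) b)))) =
       fact k * ((\<Prod>i'<Suc N. 1 / (2 * H (m i'))) * (2 * H (m i))) *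
       mixed_Pf N (\<lambda>j a b. X j (lift_pair (m \<circ> ?s i) a) (lift_pair (m \<circ> ?s i) b))"
      by (simp only: lift_pair_comp mult.assoc)
    also have "\<dots> = fact (N - k) * (\<Sum>m'\<in>injections k N. F (?s i \<circ> m'))"
      unfolding c step.IH[OF inj] F_def by (simp only: comp_assoc o_apply)
    finally show ?thesis .
  qed
  have "fact k * (\<Prod>i<Suc N. 1 / (2 * H (m i))) * mixed_Pf (Suc N) (\<lambda>j a b. X j (lift_pair m a) (lift_pair m b)) =
    (\<Sum>i\<le>N. fact k * (\<Prod>i'<Suc N. 1 / (2 * H (m i'))) * (2 * H (m i) *
       mixed_Pf N (\<lambda>j a b. X j (lift_pair m (lift_pair (?s i) a)) (lift_pair m (lift_pair (?s i) b)))))"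
    by (subst mixed_Pf_contract_last[of N "\<lambda>j a b. X j (lift_pair m a) (lift_pair m b)" "\<lambda>i. H (m i)", OF last]) (simp_all only: sum_distrib_left)
  also have "\<dots> = fact (N - k) * (\<Sum>i\<le>N. \<Sum>m'\<in>injections k N. F (?s i \<circ> m'))"
    by (simp add: one sum_distrib_left del: prod.lessThan_Suc)
  also have "(\<Sum>i\<le>N. \<Sum>m'\<in>injections k N. F (?s i \<circ> m')) = of_nat (Suc N - k) * sum F (injections k (Suc N))"
  proof (rule sum_injections_avoiding_one)
    fix m1 m2 :: "nat \<Rightarrow> nat" assume eq: "\<And>i. i < k \<Longrightarrow> m1 i = m2 i"
    have "mixed_Pf k (\<lambda>j a b. X j (lift_pair (m \<circ> m1) a) (lift_pair (m \<circ> m1) b)) =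
          mixed_Pf k (\<lambda>j a b. X j (lift_pair (m \<circ> m2) a) (lift_pair (m \<circ> m2) b))"
      by (rule mixed_Pf_cong) (simp add: lift_pair_def eq)
    then show "F m1 = F m2" using eq by (simp add: F_def)
  qed (use step.hyps in simp)
  also have "fact (N - k) * (of_nat (Suc N - k) * sum F (injections k (Suc N))) =
      fact (Suc N - k) * sum F (injections k (Suc N))"
    using step.hyps by (simp add: Suc_diff_le)
  finally show ?case by (simp only: F_def[abs_def])
qed


section \<open>Pfaffians of finite-rank kernels and Vandermonde determinants\<close>

text \<open>The sum over \<open>i\<close> is the antisymmetrisation of \<open>\<Sum>\<^sub>i c\<^sub>i f\<^bsub>2i\<^esub>(r) f\<^bsub>2i+1\<^esub>(s)\<close>. Expanding the product over the
  \<open>k\<close> factors gives a sum over all maps \<open>m\<close> of a determinant with rows \<open>f\<^bsub>2 m(j)\<^esub>\<close>, \<open>f\<^bsub>2 m(j) + 1\<^esub>\<close>; two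
  rows agree unless \<open>m\<close> is injective.\<close>

lemma Pf_rank_two_sum:
  fixes f :: "nat \<Rightarrow> nat \<Rightarrow> complex"
  shows "Pf k (\<lambda>r s. \<Sum>i<M. c i * (f (2*i) r * f (2*i+1) s - f (2*i+1) r * f (2*i) s)) =
     (\<Sum>m\<in>injections k M. (\<Prod>i<k. c (m i)) *
        mixed_Pf k (\<lambda>j a b. f (lift_pair m a) (2*j) * f (lift_pair m b) (2*j+1))) / fact k"
proof -
  define Y where "Y r s = (\<Sum>i<M. c i * (f (2*i) r * f (2*i+1) s))" for r s
  define D where "D m = mixed_Pf k (\<lambda>j r s. f (lift_pair m (2*j)) r * f (lift_pair m (2*j+1)) s)" for m
  have "(\<lambda>r s. \<Sum>i<M. c i * (f (2*i) r * f (2*i+1) s - f (2*i+1) r * f (2*i) s)) = (\<lambda>r s. Y r s - Y s r)"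
    by (auto simp: Y_def algebra_simps sum_subtractf fun_eq_iff)
  then have "Pf k (\<lambda>r s. \<Sum>i<M. c i * (f (2*i) r * f (2*i+1) s - f (2*i+1) r * f (2*i) s)) = mixed_Pf k (\<lambda>_. Y) / fact k"
    using mixed_Pf_antisymmetrize[of k "\<lambda>_. Y"] by (simp add: Pf_eq_mixed_Pf)
  also have "mixed_Pf k (\<lambda>_. Y) = (\<Sum>m\<in>{..<k} \<rightarrow>\<^sub>E {..<M}. (\<Prod>i<k. c (m i)) * D m)"
  proof -
    have "(\<Prod>j<k. Y (\<sigma> (2*j)) (\<sigma> (2*j+1))) =
        (\<Sum>m\<in>{..<k} \<rightarrow>\<^sub>E {..<M}. \<Prod>j<k. c (m j) * (f (2 * m j) (\<sigma> (2*j)) * f (2 * m j + 1) (\<sigma> (2*j+1))))" for \<sigma>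
      unfolding Y_def by (rule prod_sum_PiE) auto
    then have "mixed_Pf k (\<lambda>_. Y) = (\<Sum>\<sigma> | \<sigma> permutes {..<2*k}. \<Sum>m\<in>{..<k} \<rightarrow>\<^sub>E {..<M}. of_int (sign \<sigma>) *
        (\<Prod>j<k. c (m j) * (f (2 * m j) (\<sigma> (2*j)) * f (2 * m j + 1) (\<sigma> (2*j+1)))))"
      unfolding mixed_Pf_def by (simp only: sum_distrib_left)
    also have "\<dots> = (\<Sum>m\<in>{..<k} \<rightarrow>\<^sub>E {..<M}. (\<Prod>i<k. c (m i)) * D m)"
      unfolding D_def mixed_Pf_def
      by (subst sum.swap) (simp only: lift_pair_double prod.distrib sum_distrib_left mult.left_commute)
    finally show ?thesis .
  qed
  also have "\<dots> = (\<Sum>m\<in>injections k M. (\<Prod>i<k. c (m i)) * D m)"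
  proof (rule sum.mono_neutral_right)
    show "\<forall>m\<in>({..<k} \<rightarrow>\<^sub>E {..<M}) - injections k M. (\<Prod>i<k. c (m i)) * D m = 0"
    proof
      fix m assume "m \<in> ({..<k} \<rightarrow>\<^sub>E {..<M}) - injections k M"
      then obtain i j where ij: "i < k" "j < k" "i \<noteq> j" "m i = m j"
        by (auto simp: injections_def inj_on_def)
      have "D m = Determinant.det (mat (2*k) (2*k) (\<lambda>(r,c). f (lift_pair m r) c))"
        unfolding D_def by (rule mixed_Pf_eq_det)
      also have "\<dots> = 0"
        by (rule Determinant.det_identical_rows[of _ "2*k" "2*i" "2*j"])
           (use ij in \<open>auto simp: Matrix.row_def\<close>)
      finally show "(\<Prod>i<k. c (m i)) * D m = 0" by simp
    qed
  qed (auto simp: injections_def intro: finite_PiE)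
  also have "\<dots> = (\<Sum>m\<in>injections k M. (\<Prod>i<k. c (m i)) *
        mixed_Pf k (\<lambda>j a b. f (lift_pair m a) (2*j) * f (lift_pair m b) (2*j+1)))"
  proof (intro sum.cong refl arg_cong2[of _ _ _ _ "(*)"])
    fix m
    have "D m = Determinant.det (mat (2*k) (2*k) (\<lambda>(r,c). f (lift_pair m r) c))"
      unfolding D_def by (rule mixed_Pf_eq_det)
    also have "\<dots> = Determinant.det (transpose_mat (mat (2*k) (2*k) (\<lambda>(r,c). f (lift_pair m r) c)))"
      by (rule Determinant.det_transpose[symmetric, OF mat_carrier])
    also have "transpose_mat (mat (2*k) (2*k) (\<lambda>(r,c). f (lift_pair m r) c)) = mat (2*k) (2*k) (\<lambda>(r,c). f (lift_pair m c) r)"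
      by (rule eq_matI) auto
    also have "Determinant.det \<dots> = mixed_Pf k (\<lambda>j a b. f (lift_pair m a) (2*j) * f (lift_pair m b) (2*j+1))"
      by (rule mixed_Pf_eq_det[symmetric])
    finally show "D m = mixed_Pf k (\<lambda>j a b. f (lift_pair m a) (2*j) * f (lift_pair m b) (2*j+1))" .
  qed
  finally show ?thesis .
qed

lemma degree_le_roots_imp_eq:
  fixes q :: "complex poly"
  assumes "degree q \<le> n" "inj_on z {..<n}" "\<And>a. a < n \<Longrightarrow> poly q (z a) = 0"
  shows "poly q x = coeff q n * (\<Prod>a<n. x - z a)"
proof -
  define r where "r = q - Polynomial.smult (coeff q n) (\<Prod>a<n. [:- z a, 1:])"
  have deg: "degree (\<Prod>a<n. [:- z a, 1:]) = n" and lead: "lead_coeff (\<Prod>a<n. [:- z a, 1:]) = 1"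
    by (subst degree_prod_eq_sum_degree) (auto simp: lead_coeff_prod)
  have "coeff r n = 0" using deg lead by (simp add: r_def)
  moreover have "degree r \<le> n" unfolding r_def
    by (rule degree_diff_le) (use assms(1) deg in \<open>auto intro: order.trans[OF degree_smult_le]\<close>)
  ultimately have "r = 0 \<or> degree r < n"
    by (metis leading_coeff_0_iff le_neq_implies_less)
  moreover have "r = 0" if "degree r < n"
  proof (rule ccontr)
    assume "r \<noteq> 0"
    have "z ` {..<n} \<subseteq> {x. poly r x = 0}" using assms(3) by (auto simp: r_def poly_prod)
    then have "card (z ` {..<n}) \<le> degree r"
      using poly_roots_finite[OF \<open>r \<noteq> 0\<close>] card_poly_roots_bound[OF \<open>r \<noteq> 0\<close>] card_mono le_trans by metis
    then show False using that assms(2) by (simp add: card_image)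
  qed
  ultimately have "poly r x = 0" by auto
  then show ?thesis by (simp add: r_def poly_prod algebra_simps)
qed

text \<open>As a function of the last point the determinant is a polynomial of degree at most \<open>n\<close> that vanishes
  at the other points, and its coefficient of degree \<open>n\<close> is that of \<open>p n\<close> times the determinant of size
  \<open>n\<close>. If two of the other points coincide, both sides vanish.\<close>

lemma det_poly_eq_vandermonde:
  fixes p :: "nat \<Rightarrow> complex poly" and z :: "nat \<Rightarrow> complex"
  assumes deg: "\<And>b. b < n \<Longrightarrow> degree (p b) \<le> b"
  shows "Determinant.det (mat n n (\<lambda>(a,b). poly (p b) (z a))) =
         (\<Prod>b<n. coeff (p b) b) * (\<Prod>a<n. \<Prod>b<a. z a - z b)"
  using deg
proof (induction n)
  case 0
  show ?case by simp
next
  case (Suc n)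
  define Mx where "Mx x = mat (Suc n) (Suc n) (\<lambda>(a,b). poly (p b) ((z(n := x)) a))" for x
  have Mx_carrier: "Mx x \<in> carrier_mat (Suc n) (Suc n)" for x by (simp add: Mx_def)
  define C where "C b = cofactor (Mx 0) n b" for b
  have cof: "cofactor (Mx x) n b = C b" for x b
  proof -
    have "mat_delete (Mx x) n b = mat_delete (Mx 0) n b"
      by (rule eq_matI) (auto simp: mat_delete_def Mx_def)
    then show ?thesis by (simp add: C_def cofactor_def)
  qed
  \<comment> \<open>The determinant as a polynomial in the last point, by expansion along the last row.\<close>
  define q where "q = (\<Sum>b<Suc n. Polynomial.smult (C b) (p b))"
  have "Mx x $$ (n, b) = poly (p b) x" if "b < Suc n" for x b using that by (simp add: Mx_def)
  then have det_eq: "Determinant.det (Mx x) = poly q x" for x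
    by (subst laplace_expansion_row[OF Mx_carrier, of n])
       (simp_all add: cof q_def poly_sum mult.commute del: sum.lessThan_Suc)
  have "mat_delete (Mx 0) n n = mat n n (\<lambda>(a,b). poly (p b) (z a))"
    by (rule eq_matI) (auto simp: mat_delete_def Mx_def)
  then have Cn: "C n = (\<Prod>b<n. coeff (p b) b) * (\<Prod>a<n. \<Prod>b<a. z a - z b)"
    using Suc by (simp add: C_def cofactor_def)
  have coeff_q: "coeff q n = C n * coeff (p n) n"
    using Suc.prems by (auto simp: q_def coeff_sum intro!: sum.neutral coeff_eq_0) (meson le_less_trans less_SucI)
  have deg_q: "degree q \<le> n" unfolding q_def
  proof (rule degree_sum_le)
    fix b assume b: "b \<in> {..<Suc n}"
    have "degree (Polynomial.smult (C b) (p b)) \<le> degree (p b)" by (rule degree_smult_le)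
    also have "\<dots> \<le> n" using Suc.prems[of b] b by simp
    finally show "degree (Polynomial.smult (C b) (p b)) \<le> n" .
  qed simp
  have roots: "poly q (z a) = 0" if "a < n" for a
    unfolding det_eq[symmetric]
    by (rule Determinant.det_identical_rows[OF Mx_carrier, of a n])
       (use that in \<open>auto simp: Mx_def Matrix.row_def\<close>)
  have "Determinant.det (mat (Suc n) (Suc n) (\<lambda>(a,b). poly (p b) (z a))) = poly q (z n)"
    unfolding det_eq[symmetric] by (simp add: Mx_def fun_upd_triv)
  also have "\<dots> = coeff q n * (\<Prod>a<n. z n - z a)"
  proof (cases "inj_on z {..<n}")
    case True
    then show ?thesis using deg_q roots by (intro degree_le_roots_imp_eq) auto
  next
    case False
    then obtain a b where ab: "a < n" "b < n" "a \<noteq> b" "z a = z b" by (auto simp: inj_on_def)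
    have "poly q (z n) = 0" unfolding det_eq[symmetric]
      by (rule Determinant.det_identical_rows[OF Mx_carrier, of a b])
         (use ab in \<open>auto simp: Mx_def Matrix.row_def\<close>)
    moreover have "(\<Prod>a<n. \<Prod>b<a. z a - z b) = 0"
    proof -
      have "\<exists>a<n. \<exists>b<a. z a = z b" using ab by (metis linorder_neqE_nat)
      then show ?thesis by auto
    qed
    then have "C n = 0" by (simp add: Cn)
    ultimately show ?thesis by (simp add: coeff_q)
  qed
  finally show ?case by (simp add: coeff_q Cn mult_ac)
qed


section \<open>Rotation-invariant integration in the plane\<close>

lemma lborel_complex_eq_distr:
  "distr (lborel \<Otimes>\<^sub>M lborel) borel (\<lambda>(x, y). Complex x y) = (lborel :: complex measure)"
proof (rule lborel_eqI[symmetric])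
  have meas: "(\<lambda>(x, y). Complex x y) \<in> borel_measurable (lborel \<Otimes>\<^sub>M lborel)"
    unfolding Complex_eq by measurable
  fix l u :: complex assume le: "\<And>b. b \<in> Basis \<Longrightarrow> l \<bullet> b \<le> u \<bullet> b"
  from le[of 1] le[of \<i>] have le': "Re l \<le> Re u" "Im l \<le> Im u" by (auto simp: Basis_complex_def)
  have "(\<lambda>(x, y). Complex x y) -` box l u \<inter> space (lborel \<Otimes>\<^sub>M lborel) = {Re l<..<Re u} \<times> {Im l<..<Im u}"
    by (auto simp: in_box_complex_iff space_pair_measure)
  then have "emeasure (distr (lborel \<Otimes>\<^sub>M lborel) borel (\<lambda>(x, y). Complex x y)) (box l u) =
      emeasure (lborel \<Otimes>\<^sub>M lborel) ({Re l<..<Re u} \<times> {Im l<..<Im u})"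
    using meas by (subst emeasure_distr) auto
  also have "\<dots> = ennreal (Re u - Re l) * ennreal (Im u - Im l)"
    using le' by (subst lborel.emeasure_pair_measure_Times) auto
  also have "\<dots> = (\<Prod>b\<in>Basis. (u - l) \<bullet> b)"
    using le' by (simp add: Basis_complex_def ennreal_mult)
  finally show "emeasure (distr (lborel \<Otimes>\<^sub>M lborel) borel (\<lambda>(x, y). Complex x y)) (box l u) = (\<Prod>b\<in>Basis. (u - l) \<bullet> b)" .
qed simp

lemma nn_integral_lborel_complex:
  assumes [measurable]: "f \<in> borel_measurable borel"
  shows "(\<integral>\<^sup>+z. f z \<partial>lborel) = (\<integral>\<^sup>+x. \<integral>\<^sup>+y. f (Complex x y) \<partial>lborel \<partial>lborel)"
proof -
  have [measurable]: "(\<lambda>(x, y). Complex x y) \<in> borel_measurable (lborel \<Otimes>\<^sub>M lborel)"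
    unfolding Complex_eq by measurable
  have "(\<integral>\<^sup>+z. f z \<partial>lborel) = (\<integral>\<^sup>+z. f z \<partial>distr (lborel \<Otimes>\<^sub>M lborel) borel (\<lambda>(x, y). Complex x y))"
    by (simp only: lborel_complex_eq_distr)
  also have "\<dots> = (\<integral>\<^sup>+p. f ((\<lambda>(x, y). Complex x y) p) \<partial>(lborel \<Otimes>\<^sub>M lborel))"
    by (rule nn_integral_distr) measurable
  also have "\<dots> = (\<integral>\<^sup>+x. \<integral>\<^sup>+y. f (Complex x y) \<partial>lborel \<partial>lborel)"
    by (subst lborel.nn_integral_fst[symmetric]) auto
  finally show ?thesis .
qed

text \<open>A rotation with \<open>Re c \<noteq> 0\<close> factors into two real substitutions: first in \<open>x\<close> with \<open>y\<close> fixed, which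
  scales by \<open>1/Re c\<close>, then in \<open>y\<close> with the new \<open>x\<close> fixed, which scales by \<open>Re c\<close>.\<close>

lemma nn_integral_lborel_rotate:
  fixes f :: "complex \<Rightarrow> ennreal"
  assumes [measurable]: "f \<in> borel_measurable borel" and c: "cmod c = 1" "Re c \<noteq> 0"
  shows "(\<integral>\<^sup>+z. f (c * z) \<partial>lborel) = (\<integral>\<^sup>+z. f z \<partial>lborel)"
proof -
  define \<alpha> \<beta> where "\<alpha> = Re c" and "\<beta> = Im c"
  have \<alpha>: "\<alpha> \<noteq> 0" "1 / \<alpha> \<noteq> 0" using c by (auto simp: \<alpha>_def)
  have "\<alpha>\<^sup>2 + \<beta>\<^sup>2 = 1" using c(1) by (simp add: \<alpha>_def \<beta>_def cmod_def)
  then have ab: "\<beta> * \<beta> = 1 - \<alpha> * \<alpha>" by (simp add: power2_eq_square)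
  have [measurable]: "(\<lambda>(x, y). Complex x y) \<in> borel_measurable (borel \<Otimes>\<^sub>M borel)"
    unfolding Complex_eq by measurable
  have mult: "c * Complex x y = Complex (\<alpha> * x - \<beta> * y) (\<beta> * x + \<alpha> * y)" for x y
    by (simp add: complex_eq_iff \<alpha>_def \<beta>_def)
  have [measurable]: "(\<lambda>x. f (Complex (g x) (h x))) \<in> borel_measurable M"
    if [measurable]: "g \<in> borel_measurable M" "h \<in> borel_measurable M" for g h and M :: "'x measure"
    unfolding Complex_eq by measurable
  have "(\<integral>\<^sup>+z. f (c * z) \<partial>lborel) = (\<integral>\<^sup>+x. \<integral>\<^sup>+y. f (Complex (\<alpha> * x - \<beta> * y) (\<beta> * x + \<alpha> * y)) \<partial>lborel \<partial>lborel)"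
    by (subst nn_integral_lborel_complex) (simp_all add: mult)
  also have "\<dots> = (\<integral>\<^sup>+y. \<integral>\<^sup>+x. f (Complex (\<alpha> * x - \<beta> * y) (\<beta> * x + \<alpha> * y)) \<partial>lborel \<partial>lborel)"
    by (rule lborel_pair.Fubini') measurable
  also have "\<dots> = (\<integral>\<^sup>+y. \<bar>1/\<alpha>\<bar> * (\<integral>\<^sup>+x. f (Complex x ((\<beta> / \<alpha>) * x + (1 / \<alpha>) * y)) \<partial>lborel) \<partial>lborel)"
  proof (intro nn_integral_cong)
    fix y
    have "(\<integral>\<^sup>+x. f (Complex (\<alpha> * x - \<beta> * y) (\<beta> * x + \<alpha> * y)) \<partial>lborel) =
        \<bar>1/\<alpha>\<bar> * (\<integral>\<^sup>+x. f (Complex (\<alpha> * (\<beta> * y / \<alpha> + (1 / \<alpha>) * x) - \<beta> * y) (\<beta> * (\<beta> * y / \<alpha> + (1 / \<alpha>) * x) + \<alpha> * y)) \<partial>lborel)"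
      by (rule nn_integral_real_affine[OF _ \<alpha>(2)]) measurable
    also have "(\<lambda>x. Complex (\<alpha> * (\<beta> * y / \<alpha> + (1 / \<alpha>) * x) - \<beta> * y) (\<beta> * (\<beta> * y / \<alpha> + (1 / \<alpha>) * x) + \<alpha> * y)) =
        (\<lambda>x. Complex x ((\<beta> / \<alpha>) * x + (1 / \<alpha>) * y))"
    proof
      fix x
      have "\<beta> * (\<beta> * y / \<alpha> + (1 / \<alpha>) * x) + \<alpha> * y = (\<beta> / \<alpha>) * x + (\<beta> * \<beta> + \<alpha> * \<alpha>) * y / \<alpha>"
        using \<alpha> by (simp add: field_simps)
      then show "Complex (\<alpha> * (\<beta> * y / \<alpha> + (1 / \<alpha>) * x) - \<beta> * y) (\<beta> * (\<beta> * y / \<alpha> + (1 / \<alpha>) * x) + \<alpha> * y) =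
        Complex x ((\<beta> / \<alpha>) * x + (1 / \<alpha>) * y)"
        using \<alpha> ab by (simp add: distrib_left)
    qed
    finally show "(\<integral>\<^sup>+x. f (Complex (\<alpha> * x - \<beta> * y) (\<beta> * x + \<alpha> * y)) \<partial>lborel) =
       \<bar>1/\<alpha>\<bar> * (\<integral>\<^sup>+x. f (Complex x ((\<beta> / \<alpha>) * x + (1 / \<alpha>) * y)) \<partial>lborel)"
      by metis
  qed
  also have "\<dots> = \<bar>1/\<alpha>\<bar> * (\<integral>\<^sup>+y. \<integral>\<^sup>+x. f (Complex x ((\<beta> / \<alpha>) * x + (1 / \<alpha>) * y)) \<partial>lborel \<partial>lborel)"
    by (rule nn_integral_cmult) measurable
  also have "\<dots> = \<bar>1/\<alpha>\<bar> * (\<integral>\<^sup>+x. \<integral>\<^sup>+y. f (Complex x ((\<beta> / \<alpha>) * x + (1 / \<alpha>) * y)) \<partial>lborel \<partial>lborel)"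
    by (subst lborel_pair.Fubini') measurable
  also have "\<dots> = (\<integral>\<^sup>+x. \<bar>1/\<alpha>\<bar> * (\<integral>\<^sup>+y. f (Complex x ((\<beta> / \<alpha>) * x + (1 / \<alpha>) * y)) \<partial>lborel) \<partial>lborel)"
    by (rule nn_integral_cmult[symmetric]) measurable
  also have "\<dots> = (\<integral>\<^sup>+x. \<integral>\<^sup>+y. f (Complex x y) \<partial>lborel \<partial>lborel)"
    by (intro nn_integral_cong nn_integral_real_affine[symmetric] \<alpha>) measurable
  also have "\<dots> = (\<integral>\<^sup>+z. f z \<partial>lborel)"
    by (rule nn_integral_lborel_complex[symmetric]) measurable
  finally show ?thesis .
qed

text \<open>A rotation with \<open>Re c = 0\<close> is the square of one to which the preceding lemma applies.\<close>

lemma distr_lborel_rotate: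
  assumes c: "cmod c = 1"
  shows "distr lborel borel (\<lambda>z. c * z) = (lborel :: complex measure)"
proof (rule measure_eqI)
  fix A assume "A \<in> sets (distr lborel borel (\<lambda>z. c * z))"
  then have A [measurable]: "A \<in> sets borel" by simp
  have inv: "(\<integral>\<^sup>+z. indicator A (c * z) \<partial>lborel) = (\<integral>\<^sup>+z. indicator A z \<partial>lborel :: ennreal)"
  proof (cases "Re c = 0")
    case False
    then show ?thesis using c by (intro nn_integral_lborel_rotate) auto
  next
    case True
    have "Re (csqrt c) \<noteq> 0"
    proof
      assume "Re (csqrt c) = 0"
      then have "Re c = - cmod c" by (simp add: real_sqrt_eq_zero_cancel_iff)
      then show False using True c by simp
    qed
    moreover have "cmod (csqrt c) = 1" using c by simp
    ultimately have *: "(\<integral>\<^sup>+z. f (csqrt c * z) \<partial>lborel) = (\<integral>\<^sup>+z. f z \<partial>lborel)"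
      if "f \<in> borel_measurable borel" for f :: "complex \<Rightarrow> ennreal"
      using nn_integral_lborel_rotate[OF that] by blast
    have sq: "c * z = csqrt c * (csqrt c * z)" for z
      by (simp add: mult.assoc[symmetric] power2_eq_square[symmetric])
    show ?thesis
      unfolding sq by (subst (2) *[symmetric], simp, subst *) simp_all
  qed
  have "emeasure (distr lborel borel (\<lambda>z. c * z)) A = (\<integral>\<^sup>+z. indicator A z \<partial>distr lborel borel (\<lambda>z. c * z))"
    by simp
  also have "\<dots> = (\<integral>\<^sup>+z. indicator A (c * z) \<partial>lborel)" by (rule nn_integral_distr) auto
  also have "\<dots> = emeasure lborel A" by (simp add: inv)
  finally show "emeasure (distr lborel borel (\<lambda>z. c * z)) A = emeasure lborel A" .
qed simp

lemma space_dA [simp]: "space dA = UNIV" and sets_dA [simp, measurable_cong]: "sets dA = sets borel"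
  by (simp_all add: dA_def)

lemma sigma_finite_dA: "sigma_finite_measure dA"
  unfolding dA_def using lborel.sigma_finite_measure_axioms
  by (subst sigma_finite_measure.sigma_finite_iff_density_finite) auto

lemma integral_dA:
  fixes f :: "complex \<Rightarrow> complex"
  assumes "f \<in> borel_measurable borel"
  shows "integral\<^sup>L dA f = (1 / pi) *\<^sub>R integral\<^sup>L lborel f"
  unfolding dA_def using assms by (subst integral_density) auto

text \<open>Rotating by \<open>\<pi>/(a-b)\<close> multiplies the integrand by \<open>-1\<close>.\<close>

lemma integral_dA_radial_orthogonal:
  fixes w :: "real \<Rightarrow> real"
  assumes [measurable]: "w \<in> borel_measurable borel" and "a \<noteq> b"
  shows "(LINT z|dA. z ^ a * cnj z ^ b * of_real (w ((cmod z)\<^sup>2))) = 0"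
proof -
  define f where "f z = z ^ a * cnj z ^ b * of_real (w ((cmod z)\<^sup>2))" for z
  have [measurable]: "(cnj :: complex \<Rightarrow> complex) \<in> borel_measurable borel"
    by (intro borel_measurable_continuous_onI continuous_intros)
  have [measurable]: "f \<in> borel_measurable borel" unfolding f_def by measurable
  \<comment> \<open>Chosen such that \<open>c\<^sup>a (cnj c)\<^sup>b = -1\<close>.\<close>
  define \<theta> where "\<theta> = pi / (real a - real b)"
  define c where "c = cis \<theta>"
  have c: "c ^ a * cnj c ^ b = - 1"
  proof -
    have "c ^ a * cnj c ^ b = cis (real a * \<theta> - real b * \<theta>)"
      by (simp add: c_def Complex.DeMoivre cis_cnj cis_mult)
    also have "real a * \<theta> - real b * \<theta> = (real a - real b) * \<theta>" by (simp add: left_diff_distrib)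
    also have "\<dots> = pi" using assms by (simp add: \<theta>_def)
    finally show ?thesis by simp
  qed
  have "integral\<^sup>L lborel f = integral\<^sup>L (distr lborel borel (\<lambda>z. c * z)) f"
    by (subst distr_lborel_rotate) (simp_all add: c_def)
  also have "\<dots> = (LINT z|lborel. f (c * z))" by (rule integral_distr) auto
  also have "(\<lambda>z. f (c * z)) = (\<lambda>z. (c ^ a * cnj c ^ b) * f z)"
    by (auto simp: f_def power_mult_distrib norm_mult c_def mult_ac)
  also have "(LINT z|lborel. (c ^ a * cnj c ^ b) * f z) = - integral\<^sup>L lborel f"
    unfolding c by simp
  finally have "integral\<^sup>L lborel f = 0" by simp
  then have "integral\<^sup>L dA f = 0" by (simp add: integral_dA)
  then show ?thesis by (simp add: f_def[abs_def])
qed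

text \<open>Under the normalised area measure the disc \<open>\<bar>z\<bar>\<^sup>2 < t\<close> has measure \<open>t\<close>. The minus sign makes the
  half-lines \<open>{x<..}\<close>, which determine a measure on the real line, have finite mass.\<close>

lemma distr_dA_norm_squared:
  "distr dA borel (\<lambda>z. - (cmod z)\<^sup>2) = density lborel (indicator {..0})"
proof (rule measure_eqI_lessThan)
  fix x :: real
  have 1: "emeasure (distr dA borel (\<lambda>z. - (cmod z)\<^sup>2)) {x<..} = ennreal (- x)"
  proof -
    have "(\<lambda>z. - (cmod z)\<^sup>2) -` {x<..} \<inter> space dA = (if x < 0 then ball 0 (sqrt (- x)) else {})"
    proof -
      have "x < - (cmod z)\<^sup>2 \<longleftrightarrow> x < 0 \<and> cmod z < sqrt (- x)" for z
      proof (cases "x < 0")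
        case True
        then show ?thesis using real_sqrt_less_iff[of "(cmod z)\<^sup>2" "- x"] by auto
      next
        case False
        then show ?thesis by (smt (verit) zero_le_power2)
      qed
      then show ?thesis by auto
    qed
    then have "emeasure (distr dA borel (\<lambda>z. - (cmod z)\<^sup>2)) {x<..} = emeasure dA (if x < 0 then ball 0 (sqrt (- x)) else {})"
      by (subst emeasure_distr) auto
    also have "\<dots> = ennreal (- x)"
    proof (cases "x < 0")
      case True
      then show ?thesis
        by (simp add: dA_def emeasure_density_const emeasure_ball unit_ball_vol_2 flip: ennreal_mult')
    qed (simp add: ennreal_neg)
    finally show ?thesis .
  qed
  have 2: "emeasure (density lborel (indicator {..0})) {x<..} = ennreal (- x)"
  proof -
    have "emeasure (density lborel (indicator {..0})) {x<..} = (\<integral>\<^sup>+u. indicator {x<..0} u \<partial>lborel)"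
      by (subst emeasure_density) (auto intro!: nn_integral_cong simp: indicator_def simp del: nn_integral_indicator)
    also have "\<dots> = ennreal (- x)" by (cases "x \<le> 0") (auto simp: ennreal_neg)
    finally show ?thesis .
  qed
  show "emeasure (distr dA borel (\<lambda>z. - (cmod z)\<^sup>2)) {x<..} < \<infinity>" by (simp add: 1)
  show "emeasure (distr dA borel (\<lambda>z. - (cmod z)\<^sup>2)) {x<..} = emeasure (density lborel (indicator {..0})) {x<..}"
    by (simp add: 1 2)
qed auto

lemma has_bochner_integral_dA_radial:
  fixes f :: "real \<Rightarrow> real"
  assumes [measurable]: "f \<in> borel_measurable borel"
    and I: "has_bochner_integral lborel (\<lambda>t. indicator {0..} t * f t) I"
  shows "has_bochner_integral dA (\<lambda>z. f ((cmod z)\<^sup>2)) I"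
proof -
  have "has_bochner_integral lborel (\<lambda>u. indicator {0..} (0 + (-1) * u) * f (0 + (-1) * u)) (I /\<^sub>R \<bar>-1\<bar>)"
    using I by (subst lborel_has_bochner_integral_real_affine_iff[of "-1" _ _ 0, symmetric]) auto
  moreover have "(\<lambda>u. indicator {0..} (0 + (-1) * u) * f (0 + (-1) * u)) = (\<lambda>u. indicator {..0} u *\<^sub>R f (- u))"
    by (auto simp: indicator_def)
  ultimately have "has_bochner_integral (density lborel (\<lambda>u. ennreal (indicator {..0} u))) (\<lambda>u. f (- u)) I"
    by (intro has_bochner_integral_density) auto
  then have "has_bochner_integral (distr dA borel (\<lambda>z. - (cmod z)\<^sup>2)) (\<lambda>u. f (- u)) I"
    by (simp add: distr_dA_norm_squared ennreal_indicator)
  then show ?thesis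
    by (simp add: has_bochner_integral_iff integrable_distr_eq integral_distr)
qed

text \<open>The substitution \<open>t = u / (1 - u)\<close> in Euler's integral.\<close>

lemma has_bochner_integral_Beta_half_line:
  fixes p q :: real
  assumes p: "p > 0" and q: "q > 0"
  shows "has_bochner_integral lborel (\<lambda>t. indicator {0..} t * (t powr (p - 1) / (1 + t) powr (p + q))) (Beta p q)"
proof -
  define f where "f t = t powr (p - 1) / (1 + t) powr (p + q)" for t :: real
  define g where "g u = u / (1 - u)" for u :: real
  define g' where "g' u = 1 / (1 - u)\<^sup>2" for u :: real
  define k where "k u = u powr (p - 1) * (1 - u) powr (q - 1)" for u :: real
  have fg: "f (g u) * g' u = k u" if u: "0 < u" "u < 1" for u
  proof -
    have "1 + u / (1 - u) = 1 / (1 - u)" using u by (simp add: field_simps)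
    moreover have "(1 / (1 - u)) powr (p + q) = 1 / (1 - u) powr (p + q)"
      using u by (simp add: powr_divide)
    moreover have "1 / (1 - u)\<^sup>2 = (1 - u) powr (- 2)"
      using u by (simp add: powr_minus_divide)
    moreover have "(u / (1 - u)) powr (p - 1) = u powr (p - 1) * (1 - u) powr (- (p - 1))"
      unfolding powr_minus_divide using u by (simp add: powr_divide)
    ultimately have "f (g u) * g' u = u powr (p - 1) * ((1 - u) powr (- (p - 1)) * (1 - u) powr (p + q) * (1 - u) powr (- 2))"
      unfolding f_def g_def g'_def by (simp only: divide_divide_eq_right div_by_1 mult_1_right mult.assoc)
    also have "(1 - u) powr (- (p - 1)) * (1 - u) powr (p + q) * (1 - u) powr (- 2) = (1 - u) powr (q - 1)"
      by (simp flip: powr_add)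
    finally show ?thesis by (simp add: k_def)
  qed
  have k_int: "set_integrable lborel {0<..<1} k"
    using integrable_Beta[OF p q] unfolding k_def by (rule set_integrable_subset) auto
  have ein: "einterval 0 1 = {0<..<1}" "einterval 0 \<infinity> = {0<..}" by (auto simp: einterval_def)
  have deriv: "DERIV g x :> g' x" if "0 < ereal x" "ereal x < 1" for x
    using that unfolding g_def g'_def
    by (auto intro!: derivative_eq_intros simp: power2_eq_square)
  have contf: "isCont f (g x)" if "0 < ereal x" "ereal x < 1" for x
  proof -
    have "g x > 0" using that by (simp add: g_def)
    then show ?thesis unfolding f_def by (intro continuous_intros) auto
  qed
  have contg: "isCont g' x" if "0 < ereal x" "ereal x < 1" for x
    using that unfolding g'_def by (intro continuous_intros) auto
  have fnn: "0 \<le> f (g x)" for x by (simp add: f_def)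
  have gnn: "0 \<le> g' x" for x by (simp add: g'_def)
  have "(g \<longlongrightarrow> g 0) (at_right 0)" unfolding g_def by (intro tendsto_intros) auto
  then have lim0: "((ereal \<circ> g \<circ> real_of_ereal) \<longlongrightarrow> 0) (at_right 0)"
    by (simp add: ereal_tendsto_simps g_def flip: zero_ereal_def) (simp add: zero_ereal_def ereal_tendsto_simps)
  have "filterlim g at_top (at_left 1)"
  proof -
    have "((\<lambda>u::real. 1 - u) \<longlongrightarrow> 1 - 1) (at_left 1)" by (intro tendsto_intros)
    moreover have less: "eventually (\<lambda>u::real. u < 1) (at_left 1)" by (simp add: eventually_at_filter)
    ultimately have "filterlim (\<lambda>u::real. inverse (1 - u)) at_top (at_left 1)"
      by (intro filterlim_inverse_at_top) (auto elim: eventually_mono)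
    then have "filterlim (\<lambda>u::real. - 1 + inverse (1 - u)) at_top (at_left 1)"
      by (intro filterlim_tendsto_add_at_top[OF tendsto_const])
    then show ?thesis
      by (rule filterlim_mono_eventually[OF _ order_refl order_refl])
         (use less in \<open>auto simp: g_def field_simps elim!: eventually_mono\<close>)
  qed
  then have lim1: "((ereal \<circ> g \<circ> real_of_ereal) \<longlongrightarrow> \<infinity>) (at_left 1)"
    by (simp add: one_ereal_def ereal_tendsto_simps)
  have fg_int: "set_integrable lborel (einterval 0 1) (\<lambda>x. f (g x) * g' x)"
    unfolding ein using k_int by (rule set_integrable_cong[THEN iffD1, rotated -1]) (auto simp: fg)
  \<comment> \<open>The rule asks for \<open>g' \<ge> 0\<close> on the closed interval; at \<open>1\<close> this holds as \<open>1 / 0 = 0\<close>.\<close>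
  note subst = interval_integral_substitution_nonneg[of 0 1 g g' f, OF _ deriv contf contg fnn gnn lim0 lim1 fg_int]
  have f_int: "set_integrable lborel {0<..} f" using subst(1) by (simp add: ein)
  have f_eq: "(LBINT x=0..\<infinity>. f x) = (LBINT x=0..1. f (g x) * g' x)" by (rule subst(2)) simp_all
  have "(LBINT x=0..1. f (g x) * g' x) = (LBINT x:{0<..<1}. k x)"
    unfolding interval_lebesgue_integral_def ein
    by (auto intro!: set_lebesgue_integral_cong simp: fg)
  also have "\<dots> = integral {0<..<1} k"
    using k_int by (rule set_borel_integral_eq_integral)
  also have "\<dots> = Beta p q"
    using has_integral_Beta_real[OF p q] unfolding k_def
    by (intro integral_unique) (simp add: has_integral_Icc_iff_Ioo)
  finally have "(LBINT x:{0<..}. f x) = Beta p q"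
    using f_eq by (simp add: interval_lebesgue_integral_def ein)
  moreover have "(\<lambda>t. indicator {0..} t * (t powr (p - 1) / (1 + t) powr (p + q))) = (\<lambda>t. indicator {0<..} t *\<^sub>R f t)"
    by (auto simp: indicator_def f_def fun_eq_iff)
  ultimately show ?thesis
    using f_int by (simp add: has_bochner_integral_iff set_integrable_def set_lebesgue_integral_def)
qed


section \<open>Gamma function identities and principal powers\<close>

lemma Gamma_duplication_real:
  fixes x :: real
  assumes "x > 0"
  shows "Gamma (2 * x) = Gamma x * Gamma (x + 1/2) * 2 powr (2 * x - 1) / sqrt pi"
proof -
  have "of_real x \<notin> (\<int>\<^sub>\<le>\<^sub>0 :: complex set)" "of_real x + 1/2 \<notin> (\<int>\<^sub>\<le>\<^sub>0 :: complex set)"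
  proof -
    show "of_real x \<notin> (\<int>\<^sub>\<le>\<^sub>0 :: complex set)" using assms by (auto elim!: nonpos_Ints_cases simp: complex_eq_iff)
    show "of_real x + 1/2 \<notin> (\<int>\<^sub>\<le>\<^sub>0 :: complex set)"
    proof
      assume "of_real x + 1/2 \<in> (\<int>\<^sub>\<le>\<^sub>0 :: complex set)"
      then obtain k where k: "of_real x + 1/2 = (of_int k :: complex)" "k \<le> 0" by (auto elim!: nonpos_Ints_cases)
      from arg_cong[OF k(1), of Re] have "x + 1/2 = real_of_int k" by simp
      then show False using assms k(2) by linarith
    qed
  qed
  from Gamma_legendre_duplication[OF this]
  have "complex_of_real (Gamma x * Gamma (x + 1/2)) = complex_of_real (exp ((1 - 2 * x) * ln 2) * sqrt pi * Gamma (2 * x))"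
    by (simp flip: Gamma_complex_of_real exp_of_real)
  then have "Gamma x * Gamma (x + 1/2) = 2 powr (- (2 * x - 1)) * sqrt pi * Gamma (2 * x)"
    by (simp only: of_real_eq_iff) (simp add: powr_def)
  then show ?thesis by (simp only: powr_minus) (simp add: field_simps)
qed

lemma Gamma_duplication_pair:
  fixes x y :: real
  assumes "x > 0" "y > 0"
  shows "Gamma (2 * x) * Gamma (2 * y) =
     2 powr (2 * x + 2 * y - 2) / pi * (Gamma x * Gamma (x + 1/2) * Gamma y * Gamma (y + 1/2))"
proof -
  have "2 powr (2 * x + 2 * y - 2) = 2 powr (2 * x - 1) * (2 powr (2 * y - 1) :: real)"
    by (simp flip: powr_add)
  then show ?thesis
    using real_sqrt_mult_self[of pi]
    by (simp add: Gamma_duplication_real[OF assms(1)] Gamma_duplication_real[OF assms(2)])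
qed

lemma Gamma_plus1_pos: "x > 0 \<Longrightarrow> Gamma (x + 1) = x * Gamma x" for x :: real
  by (rule Gamma_plus1) (auto elim!: nonpos_Ints_cases)

text \<open>With \<open>1 / \<Gamma>\<close> read as zero at the poles, the functional equation holds for every real \<open>x\<close>. This is
  what takes care of \<open>L = 0\<close> and of \<open>n = N\<close>.\<close>

lemma div_Gamma_plus1: "x / Gamma (x + 1) = 1 / Gamma x" for x :: real
  using rGamma_plus1[of x] by (simp add: rGamma_inverse_Gamma divide_inverse)

lemma cpow_of_nat: "cpow z (real k) = z ^ k"
  by (cases "z = 0") (auto simp: cpow_def powr_nat)

lemma mult_cpow:
  assumes "s \<ge> 0"
  shows "z * cpow z s = cpow z (s + 1)"
  using assms by (cases "z = 0") (auto simp: cpow_def powr_add)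

lemma mult_cpow_pred: "of_real s * (z * cpow z (s - 1)) = of_real s * cpow z s"
  by (cases "z = 0") (auto simp: cpow_def powr_diff)

lemma cpow_add_one: "z \<noteq> 0 \<Longrightarrow> cpow z (s + 1) = cpow z s * z"
  by (simp add: cpow_def powr_add)

lemma cpow_minus: "z \<noteq> 0 \<Longrightarrow> cpow z s * cpow z (- s) = 1"
  by (auto simp: cpow_def powr_minus)

lemma cpow_nonzero: "z \<noteq> 0 \<Longrightarrow> cpow z s \<noteq> 0"
  by (auto simp: cpow_def)

lemma has_field_derivative_cpow:
  assumes "s \<ge> 0" "s \<in> \<int> \<or> z \<notin> \<real>\<^sub>\<le>\<^sub>0"
  shows "((\<lambda>w. cpow w s) has_field_derivative of_real s * cpow z (s - 1)) (at z)"
proof (cases "s \<in> \<int>")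
  case True
  then obtain k where k: "s = real k" using assms(1) by (metis Ints_cases of_int_0_le_iff of_int_of_nat_eq zero_le_imp_eq_int)
  have "((\<lambda>w. w ^ k) has_field_derivative of_nat k * z ^ (k - 1)) (at z)"
    by (auto intro!: derivative_eq_intros)
  moreover have "of_real s * cpow z (s - 1) = of_nat k * z ^ (k - 1)"
  proof (cases k)
    case (Suc j)
    then have "s - 1 = real j" by (simp add: k)
    then show ?thesis using Suc by (simp add: cpow_of_nat k)
  qed (simp add: k)
  ultimately show ?thesis unfolding k cpow_of_nat by (simp only:)
next
  case False
  then have z: "z \<notin> \<real>\<^sub>\<le>\<^sub>0" and "s \<noteq> 0" using assms by auto
  have "cpow w s = w powr of_real s" for w using \<open>s \<noteq> 0\<close> by (simp add: cpow_def)
  moreover have "cpow z (s - 1) = z powr (of_real s - 1)" using z by (auto simp: cpow_def)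
  ultimately show ?thesis using has_field_derivative_powr[OF z, of "of_real s"] by simp
qed

text \<open>Principal powers commute with conjugation off the negative axis, and so do integer powers
  everywhere.\<close>

lemma cpow_mult_cpow_cnj:
  assumes "z \<noteq> 0" "s \<in> \<int> \<or> z \<notin> \<real>\<^sub>\<le>\<^sub>0"
  shows "cpow z s * cpow (cnj z) s = of_real (cmod z powr (2 * s))"
proof -
  have cp: "cpow z s = z powr of_real s" "cpow (cnj z) s = cnj z powr of_real s" using assms(1) by (auto simp: cpow_def)
  have "cnj (z powr of_real s) = cnj z powr of_real s"
  proof (cases "s \<in> \<int>")
    case True
    then obtain k where "s = of_int k" by (auto elim: Ints_cases)
    then have s: "complex_of_real s = of_int k" by simp
    show ?thesis unfolding s using assms(1) by (simp add: powr_of_int)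
  next
    case False
    then have "z \<notin> \<real>\<^sub>\<le>\<^sub>0" using assms(2) by simp
    then have "Re z \<ge> 0" if "Im z = 0" using that by (auto simp: complex_nonpos_Reals_iff)
    then show ?thesis using cnj_powr[of z "of_real s"] by simp
  qed
  then have "cpow z s * cpow (cnj z) s = of_real ((cmod (z powr of_real s))\<^sup>2)"
    unfolding cp complex_norm_square by simp
  also have "cmod (z powr of_real s) = cmod z powr s"
    by (simp add: norm_powr_real_powr')
  also have "(cmod z powr s)\<^sup>2 = cmod z powr (2 * s)"
    by (simp add: power2_eq_square flip: powr_add)
  finally show ?thesis .
qed


section \<open>Coefficients of the kernel and its derivative\<close>

lemma summation_by_parts_telescope:
  fixes u t :: "nat \<Rightarrow> 'a :: comm_ring_1"
  shows "(\<Sum>k=0..M. (u k - u (Suc k)) * (\<Sum>l=0..k. t l)) =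
         (\<Sum>k=0..M. u k * t k) - u (Suc M) * (\<Sum>l=0..M. t l)"
  by (induction M) (simp_all add: algebra_simps)

lemma sum_telescope_0: "(\<Sum>l=0..k. v l - v (Suc l)) = v 0 - v (Suc k)" for v :: "nat \<Rightarrow> 'a :: ab_group_add"
  by (induction k) simp_all

lemma sum_even_odd: "(\<Sum>k=0..2*M+1. f k) = (\<Sum>k=0..M. f (2*k) + f (2*k+1))" for f :: "nat \<Rightarrow> 'a :: comm_monoid_add"
  by (induction M) (simp_all add: add_ac)

definition G_prefactor :: "real \<Rightarrow> real \<Rightarrow> real" where
  "G_prefactor L n = pi * (Gamma (2*n + 2*L + 2) / 2 powr (2*L + 2*n + 1))"

definition odd_coeff :: "real \<Rightarrow> real \<Rightarrow> nat \<Rightarrow> real" where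
  "odd_coeff L n k = 1 / (Gamma (real k + L + 3/2) * Gamma (n - real k))"

definition even_coeff :: "real \<Rightarrow> real \<Rightarrow> nat \<Rightarrow> real" where
  "even_coeff L n l = 1 / (Gamma (n - real l + 1/2) * Gamma (real l + L + 1))"

lemma G_hat_eq:
  "G_hat N L n \<zeta> \<eta> = of_real (G_prefactor L n) * (\<Sum>k=0..N-1. of_real (odd_coeff L n k) * cpow \<zeta> (2 * real k + 2*L + 1) *
     (\<Sum>l=0..k. of_real (even_coeff L n l) * cpow \<eta> (2 * real l + 2*L)))"
  by (simp add: G_hat_def G_prefactor_def odd_coeff_def even_coeff_def sum_distrib_left mult_ac)

text \<open>The duplication formula at \<open>x\<close> and at \<open>y\<close>. For \<open>x = k + L + 1/2\<close> and for \<open>x = k + L + 1\<close> it matches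
  the diagonal terms produced by the derivative with the terms of \<^const>\<open>I_N\<close> of even and of odd
  index.\<close>

lemma G_prefactor_coeff:
  fixes x y :: real
  assumes "x > 0" "y > 0" "x + y = n + L + 1/2" "n > 0" "L \<ge> 0"
  shows "2 * G_prefactor L n / (Gamma x * Gamma (x + 1/2) * Gamma y * Gamma (y + 1/2)) =
     (2 * n + 2 * L + 1) * (n + L) * Gamma (2 * n + 2 * L) / (Gamma (2 * x) * Gamma (2 * y))"
proof -
  have G: "Gamma (2 * n + 2 * L + 2) = 2 * ((2 * n + 2 * L + 1) * (n + L) * Gamma (2 * n + 2 * L))"
  proof -
    have "2 * n + 2 * L + 2 = (2 * n + 2 * L + 1) + 1" by simp
    also have "Gamma \<dots> = (2 * n + 2 * L + 1) * ((2 * n + 2 * L) * Gamma (2 * n + 2 * L))"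
      using assms(4,5) by (subst Gamma_plus1_pos, simp)+ simp
    finally show ?thesis by simp
  qed
  have e: "2 * x + 2 * y - 2 = 2 * n + 2 * L - 1" using assms(3) by simp
  have p: "(2::real) powr (2 * L + 2 * n + 1) = 4 * 2 powr (2 * n + 2 * L - 1)"
  proof -
    have "(2::real) powr (2 * L + 2 * n + 1) = 2 powr (2 + (2 * n + 2 * L - 1))" by (simp add: algebra_simps)
    then show ?thesis by (simp only: powr_add) simp
  qed
  have "Gamma x > 0" "Gamma y > 0" "Gamma (x + 1/2) > 0" "Gamma (y + 1/2) > 0" using assms by (auto intro: Gamma_real_pos)
  then show ?thesis
    unfolding Gamma_duplication_pair[OF assms(1,2)] e G_prefactor_def G p by (simp add: field_simps)
qed

text \<open>\<open>D m\<close> is the image of \<open>\<zeta>\<^sup>m\<close> under \<open>(1 + \<zeta>\<^sup>2) \<partial>\<^sub>\<zeta> - 2 s \<zeta>\<close>, so the left-hand side is the image of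
  the numerator of \<^const>\<open>\<kappa>\<close> under this operator.\<close>

lemma kernel_operator_identity:
  fixes N :: nat and L n :: real and \<zeta> \<eta> :: complex
  assumes N: "N \<ge> 1" and L: "L \<ge> 0" and n: "n \<ge> real N"
  defines "s \<equiv> n + L - 1/2"
  defines "D \<equiv> \<lambda>m. of_real m * cpow \<zeta> (m - 1) + of_real (m - 2 * s) * cpow \<zeta> (m + 1)"
  defines "S \<equiv> \<lambda>k z. \<Sum>l=0..k. of_real (even_coeff L n l) * cpow z (2 * real l + 2*L)"
  assumes eta: "1 + \<eta>\<^sup>2 \<noteq> 0"
  shows "of_real (G_prefactor L n) *
      ((\<Sum>k=0..N-1. of_real (odd_coeff L n k) * D (2 * real k + 2*L + 1) * S k \<eta>) -
       (\<Sum>k=0..N-1. of_real (odd_coeff L n k) * cpow \<eta> (2 * real k + 2*L + 1) *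
          (\<Sum>l=0..k. of_real (even_coeff L n l) * D (2 * real l + 2*L)))) =
     cpow (1 + \<eta>\<^sup>2) s * (I_N N L n \<zeta> \<eta> - II_N N L n \<zeta> \<eta> - III_N N L n \<zeta> \<eta>)"
proof -
  obtain M where M: "N = Suc M" using N by (cases N) auto
  define \<alpha> where "\<alpha> k = 1 / (Gamma (real k + L + 1/2) * Gamma (n - real k))" for k
  define \<beta> where "\<beta> l = 1 / (Gamma (n - real l + 1/2) * Gamma (real l + L))" for l
  define C where "C = G_prefactor L n"
  define u where "u k = of_real (\<alpha> k) * cpow \<zeta> (2 * real k + 2*L)" for k
  define v where "v l = of_real (\<beta> l) * cpow \<zeta> (2 * real l + 2*L - 1)" for l
  define t where "t l = of_real (even_coeff L n l) * cpow \<eta> (2 * real l + 2*L)" for l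
  define y where "y k = of_real (odd_coeff L n k) * cpow \<eta> (2 * real k + 2*L + 1)" for k
  define B where "B = cpow (1 + \<eta>\<^sup>2) s"
  have B: "B \<noteq> 0" "B * cpow (1 + \<eta>\<^sup>2) (- s) = 1"
    using eta cpow_minus cpow_nonzero by (auto simp: B_def)
  have scaled_D: "of_real a * D m = of_real (a * m) * cpow \<zeta> (m - 1) + of_real (a * (m - 2 * s)) * cpow \<zeta> (m + 1)" for a m
    by (simp add: D_def algebra_simps)
  \<comment> \<open>The two neighbouring powers get the coefficients of consecutive terms of one sequence, so that
    sums over \<open>k\<close> telescope.\<close>
  have odd: "of_real (odd_coeff L n k) * D (2 * real k + 2*L + 1) = 2 * (u k - u (Suc k))" for k
  proof -
    have "odd_coeff L n k * (2 * real k + 2*L + 1) = 2 * ((real k + L + 1/2) / Gamma (real k + L + 1/2 + 1)) * (1 / Gamma (n - real k))"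
    proof -
      have "real k + L + 3/2 = real k + L + 1/2 + 1" by simp
      then show ?thesis unfolding odd_coeff_def by (simp only:) (simp add: distrib_left add_divide_distrib)
    qed
    also have "\<dots> = 2 * \<alpha> k" unfolding div_Gamma_plus1 by (simp add: \<alpha>_def)
    finally have 1: "odd_coeff L n k * (2 * real k + 2*L + 1) = 2 * \<alpha> k" .
    have "odd_coeff L n k * (2 * real k + 2*L + 1 - 2 * s) =
        - 2 * ((n - real k - 1) / Gamma (n - real k - 1 + 1)) * (1 / Gamma (real k + L + 3/2))"
      by (simp add: odd_coeff_def s_def diff_divide_distrib add_divide_distrib algebra_simps)
    also have "\<dots> = - 2 * \<alpha> (Suc k)" unfolding div_Gamma_plus1 by (simp add: \<alpha>_def algebra_simps)
    finally have 2: "odd_coeff L n k * (2 * real k + 2*L + 1 - 2 * s) = - 2 * \<alpha> (Suc k)" .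
    have e: "2 * real k + 2*L + 1 - 1 = 2 * real k + 2*L" "2 * real k + 2*L + 1 + 1 = 2 * real (Suc k) + 2*L" by simp_all
    show ?thesis
      unfolding scaled_D 1 2 e
      by (simp add: u_def algebra_simps)
  qed
  have even: "of_real (even_coeff L n l) * D (2 * real l + 2*L) = 2 * (v l - v (Suc l))" for l
  proof -
    have "even_coeff L n l * (2 * real l + 2*L) = 2 * ((real l + L) / Gamma (real l + L + 1)) * (1 / Gamma (n - real l + 1/2))"
      by (simp add: even_coeff_def field_simps)
    also have "\<dots> = 2 * \<beta> l" unfolding div_Gamma_plus1 by (simp add: \<beta>_def)
    finally have 1: "even_coeff L n l * (2 * real l + 2*L) = 2 * \<beta> l" .
    have "even_coeff L n l * (2 * real l + 2*L - 2 * s) =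
        - 2 * ((n - real l - 1/2) / Gamma (n - real l - 1/2 + 1)) * (1 / Gamma (real l + L + 1))"
      by (simp add: even_coeff_def s_def diff_divide_distrib add_divide_distrib algebra_simps)
    also have "\<dots> = - 2 * \<beta> (Suc l)" unfolding div_Gamma_plus1 by (simp add: \<beta>_def algebra_simps)
    finally have 2: "even_coeff L n l * (2 * real l + 2*L - 2 * s) = - 2 * \<beta> (Suc l)" .
    have e: "2 * real l + 2*L + 1 = 2 * real (Suc l) + 2*L - 1" by simp
    show ?thesis
      unfolding scaled_D 1 2 e
      by (simp add: v_def algebra_simps)
  qed
  have I: "B * I_N N L n \<zeta> \<eta> = 2 * of_real C * ((\<Sum>k=0..M. u k * t k) + (\<Sum>k=0..M. y k * v (Suc k)))"
  proof -
    define g where "g k = of_real (binom (2*n + 2*L - 1) (real k + 2*L)) * p_powers (real k + 2*L) (2*n - real k - 1) \<zeta> \<eta>" for k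
    define c where "c = (2*n + 2*L + 1) * (n + L)"
    have even_term: "of_real c * g (2*k) = 2 * of_real C * (u k * t k)" if "k \<le> M" for k
    proof -
      have "2 * C * (\<alpha> k * even_coeff L n k) =
         2 * C / (Gamma (real k + L + 1/2) * Gamma (real k + L + 1/2 + 1/2) * Gamma (n - real k) * Gamma (n - real k + 1/2))"
      proof -
        have "real k + L + 1/2 + 1/2 = real k + L + 1" by simp
        then show ?thesis by (simp only:) (simp add: \<alpha>_def even_coeff_def)
      qed
      also have "\<dots> = c * Gamma (2 * n + 2 * L) / (Gamma (2 * (real k + L + 1/2)) * Gamma (2 * (n - real k)))"
        unfolding C_def c_def by (rule G_prefactor_coeff) (use that L n M in auto)
      also have "\<dots> = c * binom (2*n + 2*L - 1) (real (2*k) + 2*L)"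
        by (simp add: binom_def algebra_simps)
      finally have "complex_of_real (2 * C * (\<alpha> k * even_coeff L n k)) = of_real (c * binom (2*n + 2*L - 1) (real (2*k) + 2*L))" by (rule arg_cong)
      then have "of_real c * of_real (binom (2*n + 2*L - 1) (real (2*k) + 2*L)) =
          2 * of_real C * (of_real (\<alpha> k) * of_real (even_coeff L n k) :: complex)"
        by (simp only: of_real_mult of_real_numeral)
      then show ?thesis
        by (simp add: g_def u_def t_def p_powers_def mult_ac)
    qed
    have odd_term: "of_real c * g (2*k+1) = 2 * of_real C * (y k * v (Suc k))" if "k \<le> M" for k
    proof -
      have "2 * C * (\<beta> (Suc k) * odd_coeff L n k) =
         2 * C / (Gamma (real k + L + 1) * Gamma (real k + L + 1 + 1/2) * Gamma (n - real k - 1/2) * Gamma (n - real k - 1/2 + 1/2))"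
        by (simp add: \<beta>_def odd_coeff_def algebra_simps)
      also have "\<dots> = c * Gamma (2 * n + 2 * L) / (Gamma (2 * (real k + L + 1)) * Gamma (2 * (n - real k - 1/2)))"
        unfolding C_def c_def by (rule G_prefactor_coeff) (use that L n M in auto)
      also have "\<dots> = c * binom (2*n + 2*L - 1) (real (2*k+1) + 2*L)"
        by (simp add: binom_def algebra_simps)
      finally have "complex_of_real (2 * C * (\<beta> (Suc k) * odd_coeff L n k)) = of_real (c * binom (2*n + 2*L - 1) (real (2*k+1) + 2*L))" by (rule arg_cong)
      then have "of_real c * of_real (binom (2*n + 2*L - 1) (real (2*k+1) + 2*L)) =
          2 * of_real C * (of_real (\<beta> (Suc k)) * of_real (odd_coeff L n k) :: complex)"
        by (simp only: of_real_mult of_real_numeral)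
      note coeff = this
      have e: "2 * real (Suc k) + 2 * L - 1 = real (2*k+1) + 2*L" "2 * real k + 2 * L + 1 = real (2*k+1) + 2*L" by simp_all
      have "of_real c * g (2*k+1) = (of_real c * of_real (binom (2*n + 2*L - 1) (real (2*k+1) + 2*L))) *
          (cpow \<zeta> (real (2*k+1) + 2*L) * cpow \<eta> (real (2*k+1) + 2*L))"
        by (simp only: g_def p_powers_def mult.assoc)
      also have "\<dots> = 2 * of_real C * (y k * v (Suc k))"
        unfolding coeff y_def v_def e by (simp only: mult_ac)
      finally show ?thesis .
    qed
    have "2 * N - 1 = 2 * M + 1" using M by simp
    then have "B * I_N N L n \<zeta> \<eta> = of_real c * (\<Sum>k=0..2*M+1. g k)"
      using B by (simp add: I_N_def c_def g_def B_def s_def)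
    also have "\<dots> = (\<Sum>k=0..M. of_real c * g (2*k) + of_real c * g (2*k+1))"
      unfolding sum_even_odd by (simp only: sum_distrib_left distrib_left)
    also have "\<dots> = (\<Sum>k=0..M. 2 * of_real C * (u k * t k) + 2 * of_real C * (y k * v (Suc k)))"
      by (intro sum.cong refl) (simp only: even_term odd_term atLeastAtMost_iff)
    finally show ?thesis by (simp only: sum.distrib sum_distrib_left distrib_left)
  qed
  have pref: "of_real (pi * Gamma (2*n + 2*L + 2) / (a * b * Gamma (n + L + 1/2))) / of_real (2 powr (2*L + 2*n)) * of_real (Gamma (n + L + 1/2)) =
      2 * (of_real C * of_real (1 / (a * b)) :: complex)" for a b
  proof -
    have "Gamma (n + L + 1/2) > 0" using L n N by (intro Gamma_real_pos) linarith
    then have "pi * Gamma (2*n + 2*L + 2) / (a * b * Gamma (n + L + 1/2)) / 2 powr (2*L + 2*n) * Gamma (n + L + 1/2) = 2 * (C * (1 / (a * b)))"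
      by (simp add: C_def G_prefactor_def powr_add)
    from arg_cong[OF this, of complex_of_real] show ?thesis
      by (simp only: of_real_mult of_real_divide of_real_numeral)
  qed
  have II: "B * II_N N L n \<zeta> \<eta> = 2 * of_real C * (u (Suc M) * (\<Sum>k=0..M. t k))"
  proof -
    have "(\<Sum>k=0..N-1. of_real (binom (n + L - 1/2) (real k + L)) * q_powers (real k + L) (n - real k - 1/2) \<eta>) =
       of_real (Gamma (n + L + 1/2)) * cpow (1 + \<eta>\<^sup>2) (- s) * (\<Sum>k=0..M. t k)"
      unfolding sum_distrib_left
    proof (intro sum.cong)
      fix k
      have "- (real k + L + (n - real k - 1/2)) = - s" "2 * (real k + L) = 2 * real k + 2 * L" by (simp_all add: s_def)
      moreover have "binom (n + L - 1/2) (real k + L) = Gamma (n + L + 1/2) * even_coeff L n k"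
        by (simp add: binom_def even_coeff_def algebra_simps)
      ultimately show "of_real (binom (n + L - 1/2) (real k + L)) * q_powers (real k + L) (n - real k - 1/2) \<eta> =
         of_real (Gamma (n + L + 1/2)) * cpow (1 + \<eta>\<^sup>2) (- s) * t k"
        by (simp only: q_powers_def t_def of_real_mult mult_ac)
    qed (simp add: M)
    then have "B * II_N N L n \<zeta> \<eta> = (B * cpow (1 + \<eta>\<^sup>2) (- s)) * cpow \<zeta> (2 * real N + 2*L) *
       (of_real (pi * Gamma (2*n + 2*L + 2) / (Gamma (real N + L + 1/2) * Gamma (n - real N) * Gamma (n + L + 1/2)))
         / of_real (2 powr (2*L + 2*n)) * of_real (Gamma (n + L + 1/2))) * (\<Sum>k=0..M. t k)"
      unfolding II_N_def by (simp only: times_divide_eq_left times_divide_eq_right mult_ac)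
    then show ?thesis
      unfolding B pref by (simp add: u_def \<alpha>_def M mult_ac)
  qed
  have III: "B * III_N N L n \<zeta> \<eta> = 2 * of_real C * (v 0 * (\<Sum>k=0..M. y k))"
  proof -
    have "(\<Sum>k=0..N-1. of_real (binom (n + L - 1/2) (real k + L + 1/2)) * q_powers (real k + L + 1/2) (n - real k - 1) \<eta>) =
       of_real (Gamma (n + L + 1/2)) * cpow (1 + \<eta>\<^sup>2) (- s) * (\<Sum>k=0..M. y k)"
      unfolding sum_distrib_left
    proof (intro sum.cong)
      fix k
      have "- (real k + L + 1/2 + (n - real k - 1)) = - s" "2 * (real k + L + 1/2) = 2 * real k + 2 * L + 1" by (simp_all add: s_def)
      moreover have "binom (n + L - 1/2) (real k + L + 1/2) = Gamma (n + L + 1/2) * odd_coeff L n k"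
        by (simp add: binom_def odd_coeff_def algebra_simps)
      ultimately show "of_real (binom (n + L - 1/2) (real k + L + 1/2)) * q_powers (real k + L + 1/2) (n - real k - 1) \<eta> =
         of_real (Gamma (n + L + 1/2)) * cpow (1 + \<eta>\<^sup>2) (- s) * y k"
        by (simp only: q_powers_def y_def of_real_mult mult_ac)
    qed (simp add: M)
    then have "B * III_N N L n \<zeta> \<eta> = (B * cpow (1 + \<eta>\<^sup>2) (- s)) * cpow \<zeta> (2*L - 1) *
       (of_real (pi * Gamma (2*n + 2*L + 2) / (Gamma (n + 1/2) * Gamma L * Gamma (n + L + 1/2)))
         / of_real (2 powr (2*L + 2*n)) * of_real (Gamma (n + L + 1/2))) * (\<Sum>k=0..M. y k)"
      unfolding III_N_def by (simp only: times_divide_eq_left times_divide_eq_right mult_ac)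
    then show ?thesis
      unfolding B pref by (simp add: v_def \<beta>_def mult_ac)
  qed
  have S1: "(\<Sum>k=0..N-1. of_real (odd_coeff L n k) * D (2 * real k + 2*L + 1) * S k \<eta>) =
     2 * ((\<Sum>k=0..M. u k * t k) - u (Suc M) * (\<Sum>k=0..M. t k))"
    unfolding odd S_def M diff_Suc_1 t_def[symmetric] mult.assoc sum_distrib_left[symmetric]
      summation_by_parts_telescope ..
  have S2: "(\<Sum>k=0..N-1. of_real (odd_coeff L n k) * cpow \<eta> (2 * real k + 2*L + 1) *
          (\<Sum>l=0..k. of_real (even_coeff L n l) * D (2 * real l + 2*L))) =
     2 * (v 0 * (\<Sum>k=0..M. y k) - (\<Sum>k=0..M. y k * v (Suc k)))"
    unfolding even M diff_Suc_1 y_def[symmetric] sum_distrib_left[symmetric] sum_telescope_0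
    by (simp add: sum_distrib_left sum_subtractf algebra_simps)
  show ?thesis
    unfolding S1 S2 B_def[symmetric] C_def[symmetric] right_diff_distrib I II III
    by (simp add: algebra_simps)
qed

lemma kernel_derivative:
  fixes N :: nat and L n :: real and \<zeta> \<eta> :: complex
  assumes N: "N \<ge> 1" and L: "L \<ge> 0" and n: "n \<ge> real N"
    and zeta: "off_cuts L n \<zeta>" and eta: "off_cuts L n \<eta>"
  shows "((\<lambda>z. \<kappa> N L n z \<eta>) has_field_derivative
               1 / cpow (1 + \<zeta>\<^sup>2) (n + L + 1/2) *
               (I_N N L n \<zeta> \<eta> - II_N N L n \<zeta> \<eta> - III_N N L n \<zeta> \<eta>)) (at \<zeta>)"
proof -
  define s where "s = n + L - 1/2"
  have s: "s \<ge> 0" using N L n unfolding s_def by linarith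
  define A where "A z = cpow (1 + z\<^sup>2) s" for z
  define F where "F z = G_hat N L n z \<eta> - G_hat N L n \<eta> z" for z
  define S where "S = (\<lambda>k z. \<Sum>l=0..k. of_real (even_coeff L n l) * cpow z (2 * real l + 2*L))"
  define D1 where "D1 m = of_real m * cpow \<zeta> (m - 1)" for m
  define F' where "F' = of_real (G_prefactor L n) *
      ((\<Sum>k=0..N-1. of_real (odd_coeff L n k) * D1 (2 * real k + 2*L + 1) * S k \<eta>) -
       (\<Sum>k=0..N-1. of_real (odd_coeff L n k) * cpow \<eta> (2 * real k + 2*L + 1) *
          (\<Sum>l=0..k. of_real (even_coeff L n l) * D1 (2 * real l + 2*L))))"
  define D where "D = (\<lambda>m. of_real m * cpow \<zeta> (m - 1) + of_real (m - 2 * s) * cpow \<zeta> (m + 1))"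
  have z2: "1 + \<zeta>\<^sup>2 \<noteq> 0" and e2: "1 + \<eta>\<^sup>2 \<noteq> 0" using zeta eta by (auto simp: off_cuts_def)
  have DA: "(A has_field_derivative of_real s * cpow (1 + \<zeta>\<^sup>2) (s - 1) * (2 * \<zeta>)) (at \<zeta>)"
    unfolding A_def
  proof (rule DERIV_chain2[where g = "\<lambda>z. 1 + z\<^sup>2"])
    show "((\<lambda>w. cpow w s) has_field_derivative of_real s * cpow (1 + \<zeta>\<^sup>2) (s - 1)) (at (1 + \<zeta>\<^sup>2))"
      using zeta s by (intro has_field_derivative_cpow) (auto simp: off_cuts_def s_def)
  qed (auto intro!: derivative_eq_intros)
  have DX: "((\<lambda>z. cpow z m) has_field_derivative D1 m) (at \<zeta>)" if "m \<ge> 0" "m - 2 * L \<in> \<int>" for m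
    unfolding D1_def
  proof (rule has_field_derivative_cpow)
    have "m \<in> \<int>" if "2 * L \<in> \<int>" using Ints_add[OF \<open>m - 2 * L \<in> \<int>\<close> that] by simp
    then show "m \<in> \<int> \<or> \<zeta> \<notin> \<real>\<^sub>\<le>\<^sub>0" using zeta by (auto simp: off_cuts_def)
  qed fact
  have ints: "2 * real k + 2 * L + 1 - 2 * L \<in> \<int>" "2 * real k + 2 * L - 2 * L \<in> \<int>" for k
    by simp_all
  have DF: "(F has_field_derivative F') (at \<zeta>)"
  proof -
    have "((\<lambda>z. of_real (G_prefactor L n) *
      ((\<Sum>k=0..N-1. of_real (odd_coeff L n k) * cpow z (2 * real k + 2*L + 1) * S k \<eta>) -
       (\<Sum>k=0..N-1. of_real (odd_coeff L n k) * cpow \<eta> (2 * real k + 2*L + 1) *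
          (\<Sum>l=0..k. of_real (even_coeff L n l) * cpow z (2 * real l + 2*L))))) has_field_derivative F') (at \<zeta>)"
      unfolding F'_def
      by (intro DERIV_cmult DERIV_diff DERIV_sum DERIV_cmult_right DX ints) (use L in auto)
    then show ?thesis by (simp add: F_def[abs_def] G_hat_eq S_def right_diff_distrib)
  qed
  have key: "(1 + \<zeta>\<^sup>2) * F' - 2 * of_real s * \<zeta> * F \<zeta> = A \<eta> * (I_N N L n \<zeta> \<eta> - II_N N L n \<zeta> \<eta> - III_N N L n \<zeta> \<eta>)"
  proof -
    have Dm: "(1 + \<zeta>\<^sup>2) * D1 m - 2 * of_real s * \<zeta> * cpow \<zeta> m = D m" if "m \<ge> 0" for m
    proof -
      have sq: "\<zeta>\<^sup>2 * D1 m = of_real m * cpow \<zeta> (m + 1)"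
        using mult_cpow_pred[of m \<zeta>] mult_cpow[OF that, of \<zeta>] unfolding D1_def power2_eq_square
        by (metis mult.assoc mult.left_commute)
      have "(1 + \<zeta>\<^sup>2) * D1 m - 2 * of_real s * \<zeta> * cpow \<zeta> m = D1 m + \<zeta>\<^sup>2 * D1 m - 2 * of_real s * (\<zeta> * cpow \<zeta> m)"
        by (simp add: algebra_simps)
      then show ?thesis unfolding sq mult_cpow[OF that] by (simp add: D_def D1_def algebra_simps)
    qed
    have "(1 + \<zeta>\<^sup>2) * F' - 2 * of_real s * \<zeta> * F \<zeta> = of_real (G_prefactor L n) *
      ((\<Sum>k=0..N-1. of_real (odd_coeff L n k) * ((1 + \<zeta>\<^sup>2) * D1 (2 * real k + 2*L + 1) - 2 * of_real s * \<zeta> * cpow \<zeta> (2 * real k + 2*L + 1)) * S k \<eta>) -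
       (\<Sum>k=0..N-1. of_real (odd_coeff L n k) * cpow \<eta> (2 * real k + 2*L + 1) *
          (\<Sum>l=0..k. of_real (even_coeff L n l) * ((1 + \<zeta>\<^sup>2) * D1 (2 * real l + 2*L) - 2 * of_real s * \<zeta> * cpow \<zeta> (2 * real l + 2*L)))))"
    proof -
      have lin: "(1 + \<zeta>\<^sup>2) * (c * (a - b)) - e * (c * a' - c * b') = c * (((1 + \<zeta>\<^sup>2) * a - e * a') - ((1 + \<zeta>\<^sup>2) * b - e * b'))"
        for a b a' b' c e :: complex by (simp add: algebra_simps)
      have lin3: "c * (\<Sum>k\<in>K. f k * g k * r k) - e * (\<Sum>k\<in>K. f k * h k * r k) = (\<Sum>k\<in>K. f k * (c * g k - e * h k) * r k)"
        for c e :: complex and f g h r and K :: "nat set"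
        unfolding sum_distrib_left sum_subtractf[symmetric] by (intro sum.cong refl) (simp add: algebra_simps)
      have lin2: "c * (\<Sum>k\<in>K. f k * g k) - e * (\<Sum>k\<in>K. f k * h k) = (\<Sum>k\<in>K. f k * (c * g k - e * h k))"
        for c e :: complex and f g h and K :: "nat set"
        using lin3[of c f g "\<lambda>_. 1" K e h] by simp
      show ?thesis
        unfolding F'_def F_def G_hat_eq S_def lin unfolding lin3 lin2 ..
    qed
    also have "\<dots> = A \<eta> * (I_N N L n \<zeta> \<eta> - II_N N L n \<zeta> \<eta> - III_N N L n \<zeta> \<eta>)"
    proof -
      have "2 * real k + 2*L + 1 \<ge> 0" "2 * real k + 2*L \<ge> 0" for k using L by simp_all
      note Dm' = this[THEN Dm]
      show ?thesis
        unfolding Dm' unfolding D_def S_def A_def s_def by (rule kernel_operator_identity[OF N L n e2])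
    qed
    finally show ?thesis .
  qed
  have A0: "A \<zeta> \<noteq> 0" "A \<eta> \<noteq> 0" using z2 e2 cpow_nonzero by (auto simp: A_def)
  have A1: "cpow (1 + \<zeta>\<^sup>2) (n + L + 1/2) = A \<zeta> * (1 + \<zeta>\<^sup>2)"
  proof -
    have "n + L + 1/2 = s + 1" by (simp add: s_def)
    then show ?thesis by (simp only: cpow_add_one[OF z2] A_def)
  qed
  have A2: "cpow (1 + \<zeta>\<^sup>2) (s - 1) = A \<zeta> / (1 + \<zeta>\<^sup>2)"
    using cpow_add_one[OF z2, of "s - 1"] z2 by (simp add: A_def field_simps)
  have "((\<lambda>z. F z / (A z * A \<eta>)) has_field_derivative
      (F' * (A \<zeta> * A \<eta>) - F \<zeta> * ((of_real s * cpow (1 + \<zeta>\<^sup>2) (s - 1) * (2 * \<zeta>)) * A \<eta>)) / ((A \<zeta> * A \<eta>) * (A \<zeta> * A \<eta>))) (at \<zeta>)"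
    by (intro DERIV_divide DF DERIV_cmult_right DA) (use A0 in auto)
  moreover have "(F' * (A \<zeta> * A \<eta>) - F \<zeta> * ((of_real s * cpow (1 + \<zeta>\<^sup>2) (s - 1) * (2 * \<zeta>)) * A \<eta>)) / ((A \<zeta> * A \<eta>) * (A \<zeta> * A \<eta>))
      = ((1 + \<zeta>\<^sup>2) * F' - 2 * of_real s * \<zeta> * F \<zeta>) / (A \<zeta> * (1 + \<zeta>\<^sup>2) * A \<eta>)"
  proof -
    have "(f' * (a * b) - f * ((r * (a / w) * (2 * z)) * b)) / ((a * b) * (a * b)) = (w * f' - 2 * r * z * f) / (a * w * b)"
      if "a \<noteq> 0" "b \<noteq> 0" "w \<noteq> 0" for a b w f f' r z :: complex
      using that by (simp add: field_simps)
    then show ?thesis unfolding A2 using A0 z2 by blast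
  qed
  moreover have "\<dots> = 1 / cpow (1 + \<zeta>\<^sup>2) (n + L + 1/2) *
               (I_N N L n \<zeta> \<eta> - II_N N L n \<zeta> \<eta> - III_N N L n \<zeta> \<eta>)"
    unfolding key A1 using A0 by simp
  ultimately show ?thesis
    by (simp only: \<kappa>_def F_def A_def s_def)
qed


section \<open>Moments and skew-orthogonal polynomials\<close>

text \<open>For \<open>\<zeta> \<noteq> 0\<close> this is the one-body weight \<open>exp (-2 N Q(\<zeta>))\<close> as a function of \<open>t = \<bar>\<zeta>\<bar>\<^sup>2\<close>.\<close>

definition radial_weight :: "real \<Rightarrow> real \<Rightarrow> real \<Rightarrow> real" where
  "radial_weight L n t = t powr (2 * L) / (1 + t) powr (2 * n + 2 * L + 2)"

definition radial_moment :: "real \<Rightarrow> real \<Rightarrow> nat \<Rightarrow> real" where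
  "radial_moment L n a = Gamma (real a + 2 * L + 1) * Gamma (2 * n + 1 - real a) / Gamma (2 * n + 2 * L + 2)"

lemma radial_weight_nonneg: "radial_weight L n t \<ge> 0"
  by (simp add: radial_weight_def)

lemma radial_weight_measurable [measurable]: "radial_weight L n \<in> borel_measurable borel"
  unfolding radial_weight_def[abs_def] by measurable

lemma cnj_measurable [measurable]: "(cnj :: complex \<Rightarrow> complex) \<in> borel_measurable borel"
  by (intro borel_measurable_continuous_onI continuous_intros)

lemma has_bochner_integral_radial_moment:
  assumes "L \<ge> 0" "real a < 2 * n + 1"
  shows "has_bochner_integral dA (\<lambda>z. (cmod z) ^ (2 * a) * radial_weight L n ((cmod z)\<^sup>2)) (radial_moment L n a)"
proof -
  define p q where "p = real a + 2 * L + 1" and "q = 2 * n + 1 - real a"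
  have pq: "p > 0" "q > 0" "p + q = 2 * n + 2 * L + 2" using assms by (auto simp: p_def q_def)
  have "(\<lambda>t. indicator {0..} t * (t powr (p - 1) / (1 + t) powr (p + q))) =
        (\<lambda>t. indicator {0..} t * (t ^ a * radial_weight L n t))"
  proof
    fix t :: real
    show "indicator {0..} t * (t powr (p - 1) / (1 + t) powr (p + q)) = indicator {0..} t * (t ^ a * radial_weight L n t)"
    proof (cases "t > 0")
      case True
      then have "t powr (p - 1) = t ^ a * t powr (2 * L)"
        by (simp add: p_def powr_add powr_realpow)
      then show ?thesis by (simp add: radial_weight_def pq(3))
    qed (auto simp: radial_weight_def indicator_def)
  qed
  moreover have "Beta p q = radial_moment L n a"
    by (simp add: Beta_def radial_moment_def pq(3)) (simp add: p_def q_def)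
  ultimately have "has_bochner_integral lborel (\<lambda>t. indicator {0..} t * (t ^ a * radial_weight L n t)) (radial_moment L n a)"
    using has_bochner_integral_Beta_half_line[OF pq(1,2)] by simp
  then have "has_bochner_integral dA (\<lambda>z. ((cmod z)\<^sup>2) ^ a * radial_weight L n ((cmod z)\<^sup>2)) (radial_moment L n a)"
    by (intro has_bochner_integral_dA_radial) measurable
  then show ?thesis by (simp add: power_mult)
qed

text \<open>The integrand is dominated by the integrands of the moments of orders \<open>0\<close> and \<open>2N\<close>.\<close>

lemma integrable_dA_monomial:
  assumes "L \<ge> 0" "n \<ge> real N" "i + j \<le> 4 * N"
  shows "integrable dA (\<lambda>z. z ^ i * cnj z ^ j * of_real (radial_weight L n ((cmod z)\<^sup>2)))"
proof (rule Bochner_Integration.integrable_bound)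
  show "integrable dA (\<lambda>z. (cmod z) ^ (2 * 0) * radial_weight L n ((cmod z)\<^sup>2)
      + (cmod z) ^ (2 * (2 * N)) * radial_weight L n ((cmod z)\<^sup>2))"
    using assms has_bochner_integral_radial_moment[of L 0 n] has_bochner_integral_radial_moment[of L "2 * N" n]
    by (intro Bochner_Integration.integrable_add) (auto simp: has_bochner_integral_iff)
  show "(\<lambda>z. z ^ i * cnj z ^ j * of_real (radial_weight L n ((cmod z)\<^sup>2))) \<in> borel_measurable dA"
    by measurable
  have "(cmod z) ^ (i + j) \<le> 1 + (cmod z) ^ (4 * N)" for z
  proof (cases "cmod z \<le> 1")
    case True
    then have "(cmod z) ^ (i + j) \<le> 1" by (simp add: power_le_one)
    then show ?thesis by (smt (verit) norm_ge_zero zero_le_power)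
  next
    case False
    then have "(cmod z) ^ (i + j) \<le> (cmod z) ^ (4 * N)" using assms by (intro power_increasing) auto
    then show ?thesis by simp
  qed
  then have "(cmod z) ^ (i + j) * radial_weight L n ((cmod z)\<^sup>2) \<le> (1 + (cmod z) ^ (4 * N)) * radial_weight L n ((cmod z)\<^sup>2)" for z
    using radial_weight_nonneg by (intro mult_right_mono) auto
  then show "AE z in dA. norm (z ^ i * cnj z ^ j * of_real (radial_weight L n ((cmod z)\<^sup>2)))
      \<le> norm ((cmod z) ^ (2 * 0) * radial_weight L n ((cmod z)\<^sup>2) + (cmod z) ^ (2 * (2 * N)) * radial_weight L n ((cmod z)\<^sup>2))"
    using radial_weight_nonneg[of L n]
    by (intro always_eventually) (simp add: norm_mult norm_power power_add[symmetric] distrib_right)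
qed

lemma integral_dA_monomial:
  assumes "L \<ge> 0" "n \<ge> real N" "i + j \<le> 4 * N"
  shows "(LINT z|dA. z ^ i * cnj z ^ j * of_real (radial_weight L n ((cmod z)\<^sup>2))) =
         (if i = j then of_real (radial_moment L n i) else 0)"
proof (cases "i = j")
  case True
  have "z ^ i * cnj z ^ i = of_real ((cmod z) ^ (2 * i))" for z
  proof -
    have "z ^ i * cnj z ^ i = (of_real ((cmod z)\<^sup>2)) ^ i"
      by (simp only: complex_norm_square power_mult_distrib)
    then show ?thesis by (simp add: power_mult)
  qed
  then have "(LINT z|dA. z ^ i * cnj z ^ j * of_real (radial_weight L n ((cmod z)\<^sup>2))) =
      (LINT z|dA. complex_of_real ((cmod z) ^ (2 * i) * radial_weight L n ((cmod z)\<^sup>2)))"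
    using True by simp
  also have "\<dots> = of_real (radial_moment L n i)"
    using has_bochner_integral_radial_moment[of L i n] assms True
    unfolding integral_complex_of_real by (simp add: has_bochner_integral_iff)
  finally show ?thesis using True by simp
next
  case False
  then show ?thesis using integral_dA_radial_orthogonal[of "radial_weight L n" i j] by simp
qed

text \<open>Its integral is half the skew product
  \<open>\<integral> (p(\<zeta>) q(\<zeta>\<^sup>*) - q(\<zeta>) p(\<zeta>\<^sup>*)) (\<zeta> - \<zeta>\<^sup>*) exp (-2NQ) dA\<close>, because conjugation of \<open>\<zeta>\<close> exchanges the two
  terms; here \<open>\<zeta>\<^sup>*\<close> is the conjugate of \<open>\<zeta>\<close>.\<close>

definition skew_integrand :: "real \<Rightarrow> real \<Rightarrow> complex poly \<Rightarrow> complex poly \<Rightarrow> complex \<Rightarrow> complex" where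
  "skew_integrand L n p q z =
     poly p z * poly q (cnj z) * (z - cnj z) * of_real (radial_weight L n ((cmod z)\<^sup>2))"

text \<open>After multiplication by \<open>z - cnj z\<close>, the products of monomials of neighbouring degree are the only
  ones that do not integrate to zero.\<close>

lemma has_bochner_integral_skew_integrand:
  assumes "L \<ge> 0" "n \<ge> real N" "degree p < 2 * N" "degree q < 2 * N"
  shows "has_bochner_integral dA (skew_integrand L n p q)
     (\<Sum>j<2*N. (coeff p j * coeff q (j + 1) - coeff p (j + 1) * coeff q j) * of_real (radial_moment L n (j + 1)))"
proof -
  define W where "W i j z = z ^ i * cnj z ^ j * of_real (radial_weight L n ((cmod z)\<^sup>2))" for i j and z :: complex
  define \<mu> where "\<mu> i j = (if i = j then complex_of_real (radial_moment L n i) else 0)" for i j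
  have W: "has_bochner_integral dA (W i j) (\<mu> i j)" if "i + j \<le> 4 * N" for i j
    using integral_dA_monomial[OF assms(1,2) that] integrable_dA_monomial[OF assms(1,2) that]
    by (simp add: has_bochner_integral_iff W_def[abs_def] \<mu>_def)
  have poly_eq: "poly r z = (\<Sum>i<2*N. coeff r i * z ^ i)" if "degree r < 2 * N" for r :: "complex poly" and z
    unfolding poly_altdef using that by (intro sum.mono_neutral_left) (auto simp: coeff_eq_0)
  have "skew_integrand L n p q = (\<lambda>z. \<Sum>i<2*N. \<Sum>j<2*N. coeff p i * coeff q j * (W (i + 1) j z - W i (j + 1) z))"
  proof
    fix z
    have "skew_integrand L n p q z = (\<Sum>i<2*N. \<Sum>j<2*N. (coeff p i * z ^ i) * (coeff q j * cnj z ^ j)) *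
        ((z - cnj z) * of_real (radial_weight L n ((cmod z)\<^sup>2)))"
      unfolding skew_integrand_def poly_eq[OF assms(3)] poly_eq[OF assms(4)] sum_product by (simp only: mult.assoc)
    also have "\<dots> = (\<Sum>i<2*N. \<Sum>j<2*N. coeff p i * coeff q j * (W (i + 1) j z - W i (j + 1) z))"
      unfolding sum_distrib_right by (intro sum.cong refl) (simp add: W_def algebra_simps)
    finally show "skew_integrand L n p q z = (\<Sum>i<2*N. \<Sum>j<2*N. coeff p i * coeff q j * (W (i + 1) j z - W i (j + 1) z))" .
  qed
  moreover have "has_bochner_integral dA (\<lambda>z. \<Sum>i<2*N. \<Sum>j<2*N. coeff p i * coeff q j * (W (i + 1) j z - W i (j + 1) z))
      (\<Sum>i<2*N. \<Sum>j<2*N. coeff p i * coeff q j * (\<mu> (i + 1) j - \<mu> i (j + 1)))"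
    by (intro has_bochner_integral_sum has_bochner_integral_mult_right has_bochner_integral_diff W) auto
  moreover have "(\<Sum>i<2*N. \<Sum>j<2*N. coeff p i * coeff q j * (\<mu> (i + 1) j - \<mu> i (j + 1))) =
      (\<Sum>j<2*N. (coeff p j * coeff q (j + 1) - coeff p (j + 1) * coeff q j) * of_real (radial_moment L n (j + 1)))"
  proof -
    have 1: "(\<Sum>j<2*N. coeff r j * \<mu> (i + 1) j) = coeff r (i + 1) * of_real (radial_moment L n (i + 1))"
      if "degree r < 2 * N" for r :: "complex poly" and i
      using that by (cases "i + 1 < 2 * N") (auto simp: \<mu>_def if_distrib[of "\<lambda>x. _ * x"] coeff_eq_0 cong: if_cong)
    have sym: "\<mu> i j = \<mu> j i" for i j by (auto simp: \<mu>_def)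
    have main: "(\<Sum>i<2*N. \<Sum>j<2*N. coeff p i * coeff q j * (\<mu> (i + 1) j - \<mu> i (j + 1))) =
      (\<Sum>i<2*N. coeff p i * (\<Sum>j<2*N. coeff q j * \<mu> (i + 1) j)) - (\<Sum>j<2*N. coeff q j * (\<Sum>i<2*N. coeff p i * \<mu> (j + 1) i))"
    proof -
      have "(\<Sum>i<2*N. \<Sum>j<2*N. coeff p i * coeff q j * (\<mu> (i + 1) j - \<mu> i (j + 1))) =
        (\<Sum>i<2*N. \<Sum>j<2*N. coeff p i * (coeff q j * \<mu> (i + 1) j)) - (\<Sum>i<2*N. \<Sum>j<2*N. coeff p i * coeff q j * \<mu> i (j + 1))"
        by (simp only: right_diff_distrib sum_subtractf mult.assoc)
      also have "(\<Sum>i<2*N. \<Sum>j<2*N. coeff p i * coeff q j * \<mu> i (j + 1)) =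
          (\<Sum>j<2*N. \<Sum>i<2*N. coeff q j * (coeff p i * \<mu> (j + 1) i))"
        by (subst sum.swap, intro sum.cong refl, subst sym) (simp only: mult_ac)
      finally show ?thesis by (simp only: sum_distrib_left)
    qed
    show ?thesis
      unfolding main 1[OF assms(3)] 1[OF assms(4)] sum_subtractf[symmetric]
      by (intro sum.cong refl) (simp add: algebra_simps)
  qed
  ultimately show ?thesis by simp
qed

definition skew_poly :: "real \<Rightarrow> real \<Rightarrow> nat \<Rightarrow> complex poly" where
  "skew_poly L n a = (if even a then \<Sum>l\<le>a div 2. Polynomial.monom (of_real (even_coeff L n l)) (2 * l)
     else Polynomial.monom 1 a)"

lemma coeff_skew_poly:
  "coeff (skew_poly L n a) i =
     (if even a then if even i \<and> i \<le> a then of_real (even_coeff L n (i div 2)) else 0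
      else if i = a then 1 else 0)"
proof (cases "even a")
  case True
  have eq: "2 * l = i \<longleftrightarrow> even i \<and> l = i div 2" for l by auto
  have "coeff (skew_poly L n a) i = (\<Sum>l\<le>a div 2. if l = i div 2 then if even i then of_real (even_coeff L n l) else 0 else 0)"
    using True by (auto simp: skew_poly_def coeff_sum eq intro!: sum.cong)
  also have "\<dots> = (if even i \<and> i \<le> a then of_real (even_coeff L n (i div 2)) else 0)"
    using True by (auto simp: div_le_mono elim!: evenE)
  finally show ?thesis using True by simp
qed (auto simp: skew_poly_def)

lemma degree_skew_poly: "degree (skew_poly L n a) \<le> a"
  by (rule degree_le) (auto simp: coeff_skew_poly)

lemma poly_skew_poly_even: "poly (skew_poly L n (2 * k)) z = (\<Sum>l=0..k. of_real (even_coeff L n l) * z ^ (2 * l))"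
  by (simp add: skew_poly_def poly_sum poly_monom atLeast0AtMost)

lemma poly_skew_poly_odd: "poly (skew_poly L n (2 * k + 1)) z = z ^ (2 * k + 1)"
  by (simp add: skew_poly_def poly_monom)

definition skew_norm :: "real \<Rightarrow> real \<Rightarrow> nat \<Rightarrow> real" where
  "skew_norm L n m = 1 / (2 * G_prefactor L n * odd_coeff L n m)"

lemma skew_norm_eq:
  "skew_norm L n m = 2 powr (2 * n + 2 * L) / (pi * Gamma (2*n + 2*L + 2)) * (Gamma (real m + L + 3/2) * Gamma (n - real m))"
proof -
  have "(2::real) powr (2 * L + 2 * n + 1) = 2 * 2 powr (2 * n + 2 * L)"
    by (simp add: powr_add)
  then show ?thesis by (simp add: skew_norm_def G_prefactor_def odd_coeff_def)
qed

text \<open>Both products are evaluated by the duplication formula, at \<open>(m + L + 1, n - m)\<close> and at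
  \<open>(m + L + 3/2, n - m - 1/2)\<close>. That they agree is the recursion that makes the polynomials
  skew-orthogonal.\<close>

lemma even_coeff_moment:
  assumes "L \<ge> 0" "n \<ge> real N" "m < N"
  shows "even_coeff L n m * radial_moment L n (2 * m + 1) = skew_norm L n m"
    and "even_coeff L n (m + 1) * radial_moment L n (2 * m + 2) = skew_norm L n m"
proof -
  define x y where "x = real m + L + 1" and "y = n - real m"
  have pos: "x > 0" "y > 0" using assms by (auto simp: x_def y_def)
  then have G: "Gamma x > 0" "Gamma (y + 1/2) > 0" by (auto intro: Gamma_real_pos)
  have e: "real (2 * m + 1) + 2 * L + 1 = 2 * x" "2 * n + 1 - real (2 * m + 1) = 2 * y"
    "real m + L + 3/2 = x + 1/2" "n - real m + 1/2 = y + 1/2" "2 * x + 2 * y - 2 = 2 * n + 2 * L"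
    by (simp_all add: x_def y_def)
  show "even_coeff L n m * radial_moment L n (2 * m + 1) = skew_norm L n m"
    unfolding even_coeff_def radial_moment_def skew_norm_eq e Gamma_duplication_pair[OF pos]
      x_def[symmetric] y_def[symmetric] using G by simp
next
  define x y where "x = real m + L + 3/2" and "y = n - real m - 1/2"
  have pos: "x > 0" "y > 0" using assms by (auto simp: x_def y_def)
  then have G: "Gamma (x + 1/2) > 0" "Gamma y > 0" by (auto intro: Gamma_real_pos)
  have e: "real (2 * m + 2) + 2 * L + 1 = 2 * x" "2 * n + 1 - real (2 * m + 2) = 2 * y"
    "real (m + 1) + L + 1 = x + 1/2" "n - real (m + 1) + 1/2 = y" "n - real m = y + 1/2" "2 * x + 2 * y - 2 = 2 * n + 2 * L"
    by (simp_all add: x_def y_def)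
  show "even_coeff L n (m + 1) * radial_moment L n (2 * m + 2) = skew_norm L n m"
    unfolding even_coeff_def radial_moment_def skew_norm_eq e Gamma_duplication_pair[OF pos]
      x_def[symmetric] using G by simp
qed

text \<open>Paired with \<open>z\<^bsup>2m+1\<^esup>\<close>, the polynomial of degree \<open>2k\<close> picks up its coefficients of degree \<open>2m\<close> and \<open>2m+2\<close>.
  For \<open>m < k\<close> the two contributions cancel by \<open>even_coeff_moment\<close>, for \<open>m > k\<close> both are absent, and for
  \<open>m = k\<close> the first one remains.\<close>

lemma has_bochner_integral_skew_poly:
  assumes "L \<ge> 0" "n \<ge> real N" "a < 2 * N" "b < 2 * N"
  shows "has_bochner_integral dA (skew_integrand L n (skew_poly L n a) (skew_poly L n b))
           (pairing (\<lambda>m. of_real (skew_norm L n m)) a b)"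
proof -
  define c where "c a i = coeff (skew_poly L n a) i" for a i
  define M where "M j = complex_of_real (radial_moment L n j)" for j
  define V where "V a b = (\<Sum>j<2*N. (c a j * c b (j + 1) - c a (j + 1) * c b j) * M (j + 1))" for a b
  have "has_bochner_integral dA (skew_integrand L n (skew_poly L n a) (skew_poly L n b)) (V a b)"
    unfolding V_def c_def M_def
    by (intro has_bochner_integral_skew_integrand) (use assms in \<open>auto intro: le_less_trans[OF degree_skew_poly]\<close>)
  moreover have "V a b = pairing (\<lambda>m. of_real (skew_norm L n m)) a b"
  proof -
    have even_odd: "V (2 * k) (2 * m + 1) = (if k = m then of_real (skew_norm L n m) else 0)"
      if km: "k < N" "m < N" for k m
    proof -
      have odd: "c (2 * m + 1) i = (if i = 2 * m + 1 then 1 else 0)" for i by (simp add: c_def coeff_skew_poly)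
      have even: "c (2 * k) (2 * i) = (if i \<le> k then of_real (even_coeff L n i) else 0)" for i by (simp add: c_def coeff_skew_poly)
      have "V (2 * k) (2 * m + 1) = (\<Sum>j<2*N. (if j = 2 * m then c (2 * k) j * M (j + 1) else 0)
           - (if j = 2 * m + 1 then c (2 * k) (j + 1) * M (j + 1) else 0))"
        unfolding V_def odd by (intro sum.cong refl) auto
      also have "\<dots> = c (2 * k) (2 * m) * M (2 * m + 1) - c (2 * k) (2 * (m + 1)) * M (2 * m + 2)"
        using km by (simp add: sum_subtractf)
      also have "\<dots> = (if m \<le> k then of_real (even_coeff L n m * radial_moment L n (2 * m + 1)) else 0)
           - (if m + 1 \<le> k then of_real (even_coeff L n (m + 1) * radial_moment L n (2 * m + 2)) else 0)"
        unfolding even M_def by auto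
      also have "\<dots> = (if k = m then of_real (skew_norm L n m) else 0)"
        unfolding even_coeff_moment[OF assms(1,2) km(2)] by auto
      finally show ?thesis .
    qed
    have anti: "V b a = - V a b" for a b
      unfolding V_def sum_negf[symmetric] by (intro sum.cong refl) (simp add: algebra_simps)
    have ee: "V a b = 0" if "even a = even b" for a b
      unfolding V_def using that by (intro sum.neutral) (auto simp: c_def coeff_skew_poly)
    \<comment> \<open>Equal parities give zero because the sum pairs neighbouring degrees; the other cases are
      mirror images by antisymmetry.\<close>
    consider "even a = even b" | k m where "a = 2 * k" "b = 2 * m + 1" | k m where "a = 2 * m + 1" "b = 2 * k"
      by (metis evenE oddE)
    then show ?thesis
    proof cases
      case 1
      then show ?thesis by (auto simp: ee pairing_def)
    next
      case 2
      then have "k < N" "m < N" using assms by auto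
      then show ?thesis using 2 even_odd[of k m] by (simp add: pairing_def)
    next
      case 3
      then have "k < N" "m < N" using assms by auto
      then show ?thesis using 3 even_odd[of k m] anti[of "2 * m + 1" "2 * k"] by (auto simp: pairing_def)
    qed
  qed
  ultimately show ?thesis by simp
qed


section \<open>The joint density and the correlation functions\<close>

lemma vandermonde_conjugate_pairs:
  fixes \<zeta> :: "nat \<Rightarrow> complex"
  defines "z \<equiv> \<lambda>r. if even r then \<zeta> (r div 2 + 1) else cnj (\<zeta> (r div 2 + 1))"
  shows "(\<Prod>a<2*N. \<Prod>b<a. z a - z b) =
     of_real (\<Prod>j\<in>{1..N}. \<Prod>k\<in>{j<..N}. (cmod (\<zeta> j - \<zeta> k))\<^sup>2 * (cmod (\<zeta> j - cnj (\<zeta> k)))\<^sup>2) *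
     (\<Prod>j<N. cnj (\<zeta> (j + 1)) - \<zeta> (j + 1))"
proof (induction N)
  case 0
  show ?case by simp
next
  case (Suc N)
  define x where "x = \<zeta> (N + 1)"
  have prod_z: "(\<Prod>b<2*N. w - z b) = (\<Prod>j<N. (w - \<zeta> (j + 1)) * (w - cnj (\<zeta> (j + 1))))" for w
    by (simp only: prod_lessThan_double) (simp add: z_def)
  define D where "D j k = (cmod (\<zeta> j - \<zeta> k))\<^sup>2 * (cmod (\<zeta> j - cnj (\<zeta> k)))\<^sup>2" for j k
  have pair: "((x - \<zeta> j) * (x - cnj (\<zeta> j))) * ((cnj x - \<zeta> j) * (cnj x - cnj (\<zeta> j))) = of_real (D j (N + 1))" for j
  proof -
    have "of_real (D j (N + 1)) = ((\<zeta> j - x) * cnj (\<zeta> j - x)) * ((\<zeta> j - cnj x) * cnj (\<zeta> j - cnj x))"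
      unfolding D_def x_def of_real_mult complex_norm_square by simp
    also have "\<dots> = ((x - \<zeta> j) * (x - cnj (\<zeta> j))) * ((cnj x - \<zeta> j) * (cnj x - cnj (\<zeta> j)))"
      by (simp add: algebra_simps)
    finally show ?thesis ..
  qed
  have z: "z (2 * N) = x" "z (2 * N + 1) = cnj x" by (simp_all add: z_def x_def)
  have "(\<Prod>a<2 * Suc N. \<Prod>b<a. z a - z b) = (\<Prod>a<2*N. \<Prod>b<a. z a - z b) *
      ((\<Prod>b<2*N. x - z b) * ((\<Prod>b<2*N. cnj x - z b) * (cnj x - x)))"
    using z by (simp add: mult.assoc)
  also have "(\<Prod>b<2*N. x - z b) * ((\<Prod>b<2*N. cnj x - z b) * (cnj x - x)) = of_real (\<Prod>j<N. D (j + 1) (N + 1)) * (cnj x - x)"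
  proof -
    have "(\<Prod>b<2*N. x - z b) * (\<Prod>b<2*N. cnj x - z b) = of_real (\<Prod>j<N. D (j + 1) (N + 1))"
      unfolding prod_z prod.distrib[symmetric] of_real_prod by (simp only: pair)
    then show ?thesis by (simp only: mult.assoc[symmetric])
  qed
  also have "(\<Prod>j<N. D (j + 1) (N + 1)) = (\<Prod>j\<in>{1..N}. D j (N + 1))"
    by (simp add: prod.atLeast1_atMost_eq)
  finally have step: "(\<Prod>a<2 * Suc N. \<Prod>b<a. z a - z b) =
      (\<Prod>a<2*N. \<Prod>b<a. z a - z b) * (of_real (\<Prod>j\<in>{1..N}. D j (N + 1)) * (cnj x - x))"
    by (simp only: mult.assoc)
  have "(\<Prod>j\<in>{1..Suc N}. \<Prod>k\<in>{j<..Suc N}. D j k) = (\<Prod>j\<in>{1..N}. (\<Prod>k\<in>{j<..N}. D j k) * D j (N + 1))"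
  proof -
    have "{j<..Suc N} = insert (Suc N) {j<..N}" if "j \<le> N" for j using that by auto
    then show ?thesis by (auto intro!: prod.cong simp: mult.commute)
  qed
  note nested = this
  show ?case
    unfolding step Suc.IH unfolding D_def[symmetric] nested prod.distrib of_real_mult prod.lessThan_Suc x_def[symmetric]
    by (simp only: mult_ac)
qed

text \<open>The factor \<open>z - cnj z\<close> hides the value at the origin, where the two densities may differ.\<close>

lemma weight_one_body:
  assumes "N \<ge> 1"
  shows "(z - cnj z) * of_real (exp (- 2 * real N * Q N L n z)) = (z - cnj z) * of_real (radial_weight L n ((cmod z)\<^sup>2))"
proof (cases "z = 0")
  case False
  have pos: "1 + (cmod z)\<^sup>2 > 0" "cmod z > 0" using False by (auto intro: add_pos_nonneg)
  have "- 2 * real N * Q N L n z = 2 * L * ln ((cmod z)\<^sup>2) - (2 * n + 2 * L + 2) * ln (1 + (cmod z)\<^sup>2)"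
    using assms pos by (simp add: Q_def ln_realpow field_simps)
  then have "exp (- 2 * real N * Q N L n z) = radial_weight L n ((cmod z)\<^sup>2)"
    using pos False by (simp add: radial_weight_def powr_def exp_diff)
  then show ?thesis by simp
qed simp

text \<open>With \<open>\<zeta>\<^sup>*\<close> for the conjugate, the square \<open>\<bar>\<zeta>\<^sub>j - \<zeta>\<^sub>j\<^sup>*\<bar>\<^sup>2\<close> splits into \<open>\<zeta>\<^sub>j\<^sup>* - \<zeta>\<^sub>j\<close>, which completes the Vandermonde product, and
  \<open>\<zeta>\<^sub>j - \<zeta>\<^sub>j\<^sup>*\<close>, which goes into \<^const>\<open>skew_integrand\<close>.\<close>

lemma weight_eq_mixed_Pf:
  assumes "N \<ge> 1"
  shows "complex_of_real (weight N L n \<zeta>) * (\<Prod>m<N. of_real (even_coeff L n m)) =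
     mixed_Pf N (\<lambda>j a b. skew_integrand L n (skew_poly L n a) (skew_poly L n b) (\<zeta> (j + 1)))"
proof -
  define z where "z = (\<lambda>r. if even r then \<zeta> (r div 2 + 1) else cnj (\<zeta> (r div 2 + 1)))"
  define A where "A r a = poly (skew_poly L n a) (z r)" for r a
  define w where "w j = (\<zeta> (j + 1) - cnj (\<zeta> (j + 1))) * of_real (radial_weight L n ((cmod (\<zeta> (j + 1)))\<^sup>2))" for j
  define D where "D = (\<Prod>j\<in>{1..N}. \<Prod>k\<in>{j<..N}. (cmod (\<zeta> j - \<zeta> k))\<^sup>2 * (cmod (\<zeta> j - cnj (\<zeta> k)))\<^sup>2)"
  have "mixed_Pf N (\<lambda>j a b. skew_integrand L n (skew_poly L n a) (skew_poly L n b) (\<zeta> (j + 1))) =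
      mixed_Pf N (\<lambda>j a b. w j * (A (2 * j) a * A (2 * j + 1) b))"
    by (rule mixed_Pf_cong) (simp add: skew_integrand_def w_def A_def z_def)
  also have "\<dots> = (\<Prod>j<N. w j) * Determinant.det (mat (2*N) (2*N) (\<lambda>(r,c). A r c))"
    by (simp only: mixed_Pf_scale mixed_Pf_eq_det)
  also have "Determinant.det (mat (2*N) (2*N) (\<lambda>(r,c). A r c)) =
      (\<Prod>b<2*N. coeff (skew_poly L n b) b) * (\<Prod>a<2*N. \<Prod>b<a. z a - z b)"
    unfolding A_def by (rule det_poly_eq_vandermonde) (rule degree_skew_poly)
  also have "(\<Prod>b<2*N. coeff (skew_poly L n b) b) = (\<Prod>m<N. of_real (even_coeff L n m))"
    by (simp only: prod_lessThan_double) (simp add: coeff_skew_poly)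
  also have "(\<Prod>a<2*N. \<Prod>b<a. z a - z b) = of_real D * (\<Prod>j<N. cnj (\<zeta> (j + 1)) - \<zeta> (j + 1))"
    unfolding z_def D_def by (rule vandermonde_conjugate_pairs)
  finally have 1: "mixed_Pf N (\<lambda>j a b. skew_integrand L n (skew_poly L n a) (skew_poly L n b) (\<zeta> (j + 1))) =
     of_real D * (\<Prod>j<N. (cnj (\<zeta> (j + 1)) - \<zeta> (j + 1)) * w j) * (\<Prod>m<N. of_real (even_coeff L n m))"
    by (simp add: prod.distrib mult_ac)
  have one: "(cnj (\<zeta> (j + 1)) - \<zeta> (j + 1)) * w j = of_real ((cmod (\<zeta> (j + 1) - cnj (\<zeta> (j + 1))))\<^sup>2 * exp (- 2 * real N * Q N L n (\<zeta> (j + 1))))" for j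
    unfolding w_def weight_one_body[OF assms, symmetric] of_real_mult complex_norm_square by (simp add: mult_ac)
  have "complex_of_real (weight N L n \<zeta>) = of_real D * (\<Prod>j<N. (cnj (\<zeta> (j + 1)) - \<zeta> (j + 1)) * w j)"
    unfolding one weight_def D_def of_real_prod[symmetric] of_real_mult[symmetric]
    by (simp add: prod.atLeast1_atMost_eq)
  then show ?thesis by (simp only: 1)
qed

lemma integral_weight_merge:
  fixes N k :: nat and \<zeta> :: "nat \<Rightarrow> complex"
  assumes N: "N \<ge> 1" and L: "L \<ge> 0" and n: "n \<ge> real N" and k: "k \<le> N"
  shows "complex_of_real (LINT \<xi>|(\<Pi>\<^sub>M j\<in>{k+1..N}. dA). weight N L n (merge {1..k} {k+1..N} (\<zeta>, \<xi>))) *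
      (\<Prod>m<N. of_real (even_coeff L n m)) =
     mixed_Pf N (\<lambda>j. if j < k then (\<lambda>a b. skew_integrand L n (skew_poly L n a) (skew_poly L n b) (\<zeta> (j + 1)))
        else pairing (\<lambda>m. of_real (skew_norm L n m)))"
    (is "_ = mixed_Pf N ?Y")
proof -
  interpret product_sigma_finite "\<lambda>_::nat. dA"
    by (simp add: product_sigma_finite_def sigma_finite_dA)
  let ?M = "\<Pi>\<^sub>M j\<in>{k+1..N}. dA"
  let ?x = "\<lambda>\<xi>. merge {1..k} {k+1..N} (\<zeta>, \<xi>)"
  define g where "g a b = skew_integrand L n (skew_poly L n a) (skew_poly L n b)" for a b
  define c where "c = (\<Prod>m<N. complex_of_real (even_coeff L n m))"
  have split: "(\<Prod>j<N. f j) = (\<Prod>j<k. f j) * (\<Prod>i\<in>{k+1..N}. f (i - 1))" for f :: "nat \<Rightarrow> complex"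
  proof -
    have "{..<N} = {..<k} \<union> {k..<N}" using k by auto
    then have "(\<Prod>j<N. f j) = (\<Prod>j<k. f j) * (\<Prod>j\<in>{k..<N}. f j)"
      by (simp add: prod.union_disjoint ivl_disj_int)
    also have "(\<Prod>j\<in>{k..<N}. f j) = (\<Prod>i\<in>{k+1..N}. f (i - 1))"
      by (rule prod.reindex_bij_witness[of _ "\<lambda>i. i - 1" Suc]) auto
    finally show ?thesis .
  qed
  have summand: "has_bochner_integral ?M (\<lambda>\<xi>. \<Prod>j<N. g (\<sigma> (2*j)) (\<sigma> (2*j+1)) (?x \<xi> (j + 1)))
      (\<Prod>j<N. ?Y j (\<sigma> (2*j)) (\<sigma> (2*j+1)))" if \<sigma>: "\<sigma> permutes {..<2*N}" for \<sigma>
  proof -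
    have bd: "\<sigma> (2*(i-1)) < 2*N" "\<sigma> (2*(i-1)+1) < 2*N" if "i \<in> {k+1..N}" for i
    proof -
      have "2*(i-1) \<in> {..<2*N}" "2*(i-1)+1 \<in> {..<2*N}" using that by auto
      then show "\<sigma> (2*(i-1)) < 2*N" "\<sigma> (2*(i-1)+1) < 2*N"
        using permutes_in_image[OF \<sigma>] by blast+
    qed
    define c1 where "c1 = (\<Prod>j<k. g (\<sigma> (2*j)) (\<sigma> (2*j+1)) (\<zeta> (j + 1)))"
    define F where "F i = g (\<sigma> (2*(i-1))) (\<sigma> (2*(i-1)+1))" for i
    have F: "has_bochner_integral dA (F i) (pairing (\<lambda>m. of_real (skew_norm L n m)) (\<sigma> (2*(i-1))) (\<sigma> (2*(i-1)+1)))"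
      if "i \<in> {k+1..N}" for i
      unfolding F_def g_def by (rule has_bochner_integral_skew_poly[OF L n bd[OF that]])
    have "has_bochner_integral ?M (\<lambda>\<xi>. \<Prod>i\<in>{k+1..N}. F i (\<xi> i)) (\<Prod>i\<in>{k+1..N}. integral\<^sup>L dA (F i))"
      unfolding has_bochner_integral_iff
      by (intro conjI product_integrable_prod product_integral_prod) (use F in \<open>auto simp: has_bochner_integral_iff\<close>)
    then have "has_bochner_integral ?M (\<lambda>\<xi>. c1 * (\<Prod>i\<in>{k+1..N}. F i (\<xi> i))) (c1 * (\<Prod>i\<in>{k+1..N}. integral\<^sup>L dA (F i)))"
      by (intro has_bochner_integral_mult_right) auto
    moreover have "c1 * (\<Prod>i\<in>{k+1..N}. F i (\<xi> i)) = (\<Prod>j<N. g (\<sigma> (2*j)) (\<sigma> (2*j+1)) (?x \<xi> (j + 1)))" for \<xi>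
      unfolding split c1_def F_def
      by (intro arg_cong2[of _ _ _ _ "(*)"] prod.cong refl) (auto simp: merge_def)
    moreover have "c1 * (\<Prod>i\<in>{k+1..N}. integral\<^sup>L dA (F i)) = (\<Prod>j<N. ?Y j (\<sigma> (2*j)) (\<sigma> (2*j+1)))"
      unfolding split c1_def
      by (intro arg_cong2[of _ _ _ _ "(*)"] prod.cong refl) (use F in \<open>auto simp: g_def has_bochner_integral_iff\<close>)
    ultimately show ?thesis by simp
  qed
  have "has_bochner_integral ?M (\<lambda>\<xi>. mixed_Pf N (\<lambda>j a b. g a b (?x \<xi> (j + 1)))) (mixed_Pf N ?Y)"
    unfolding mixed_Pf_def
    by (intro has_bochner_integral_sum has_bochner_integral_mult_right) (use summand in auto)
  moreover have "mixed_Pf N (\<lambda>j a b. g a b (?x \<xi> (j + 1))) = complex_of_real (weight N L n (?x \<xi>)) * c" for \<xi>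
    unfolding g_def c_def by (rule weight_eq_mixed_Pf[OF N, symmetric])
  ultimately have "(LINT \<xi>|?M. complex_of_real (weight N L n (?x \<xi>)) * c) = mixed_Pf N ?Y"
    by (simp add: has_bochner_integral_iff)
  then show ?thesis unfolding c_def[symmetric] integral_mult_left_zero integral_complex_of_real .
qed

text \<open>The common value of \<open>k! R\<^sub>k\<close> and of \<open>k!\<close> times the Pfaffian expression, as a sum over the assignments of
  distinct pairs \<open>{2i, 2i+1}\<close> of polynomials to the \<open>k\<close> particles. The weights are \<open>1 / (2 h\<^sub>i)\<close>.\<close>

definition correlation_sum :: "nat \<Rightarrow> real \<Rightarrow> real \<Rightarrow> nat \<Rightarrow> (nat \<Rightarrow> complex) \<Rightarrow> complex" where
  "correlation_sum N L n k \<zeta> = (\<Sum>m\<in>injections k N. (\<Prod>i<k. of_real (G_prefactor L n * odd_coeff L n (m i))) *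
     mixed_Pf k (\<lambda>j a b. skew_integrand L n (skew_poly L n (lift_pair m a)) (skew_poly L n (lift_pair m b)) (\<zeta> (j + 1))))"

lemma G_prefactor_pos: "n > 0 \<Longrightarrow> L \<ge> 0 \<Longrightarrow> G_prefactor L n > 0"
  by (simp add: G_prefactor_def Gamma_real_pos)

lemma coeff_pos:
  assumes "L \<ge> 0" "n \<ge> real N" "m < N"
  shows "odd_coeff L n m > 0" "even_coeff L n m > 0"
  using assms by (auto simp: odd_coeff_def even_coeff_def intro!: mult_pos_pos Gamma_real_pos)

lemma integral_weight_merge_eq:
  fixes N k :: nat and \<zeta> :: "nat \<Rightarrow> complex"
  assumes N: "N \<ge> 1" and L: "L \<ge> 0" and n: "n \<ge> real N" and k: "k \<le> N"
  shows "fact k * complex_of_real (LINT \<xi>|(\<Pi>\<^sub>M j\<in>{k+1..N}. dA). weight N L n (merge {1..k} {k+1..N} (\<zeta>, \<xi>))) *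
      (\<Prod>m<N. of_real (even_coeff L n m * (G_prefactor L n * odd_coeff L n m))) = fact (N - k) * correlation_sum N L n k \<zeta>"
proof -
  \<comment> \<open>Beyond \<open>N\<close> the norms may vanish; any non-zero value serves there.\<close>
  define H where "H m = (if m < N then complex_of_real (skew_norm L n m) else 1)" for m
  define X where "X j = (if j < k then (\<lambda>a b. skew_integrand L n (skew_poly L n a) (skew_poly L n b) (\<zeta> (j + 1))) else pairing H)" for j
  have Hinv: "1 / (2 * H m) = of_real (G_prefactor L n * odd_coeff L n m)" if "m < N" for m
    using that by (simp add: H_def skew_norm_def)
  have H0: "H m \<noteq> 0" for m
    using G_prefactor_pos[of n L] coeff_pos[OF L n, of m] N L n by (auto simp: H_def skew_norm_def)
  let ?I = "complex_of_real (LINT \<xi>|(\<Pi>\<^sub>M j\<in>{k+1..N}. dA). weight N L n (merge {1..k} {k+1..N} (\<zeta>, \<xi>)))"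
  let ?E = "\<Prod>m<N. complex_of_real (even_coeff L n m)"
  let ?W = "\<Prod>i<N. complex_of_real (G_prefactor L n * odd_coeff L n i)"
  have I: "?I * ?E = mixed_Pf N (\<lambda>j a b. X j (lift_pair id a) (lift_pair id b))"
    unfolding integral_weight_merge[OF N L n k]
  proof (rule mixed_Pf_cong)
    fix j a b assume ab: "a < 2 * N" "b < 2 * N"
    have "lift_pair id = id" by (auto simp: lift_pair_def fun_eq_iff)
    moreover have "a div 2 < N" using ab by auto
    ultimately show "(if j < k then \<lambda>a b. skew_integrand L n (skew_poly L n a) (skew_poly L n b) (\<zeta> (j + 1))
        else pairing (\<lambda>m. complex_of_real (skew_norm L n m))) a b = X j (lift_pair id a) (lift_pair id b)"
      by (simp add: X_def pairing_def H_def)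
  qed
  have contract: "fact k * (\<Prod>i<N. 1 / (2 * H (id i))) * mixed_Pf N (\<lambda>j a b. X j (lift_pair id a) (lift_pair id b)) =
      fact (N - k) * (\<Sum>m'\<in>injections k N. (\<Prod>i<k. 1 / (2 * H (id (m' i)))) *
            mixed_Pf k (\<lambda>j a b. X j (lift_pair (id \<circ> m') a) (lift_pair (id \<circ> m') b)))"
    by (rule mixed_Pf_contract[OF k _ H0]) (auto simp: X_def)
  have sum_eq: "(\<Sum>m'\<in>injections k N. (\<Prod>i<k. 1 / (2 * H (id (m' i)))) *
            mixed_Pf k (\<lambda>j a b. X j (lift_pair (id \<circ> m') a) (lift_pair (id \<circ> m') b))) = correlation_sum N L n k \<zeta>"
    unfolding correlation_sum_def
  proof (intro sum.cong refl arg_cong2[of _ _ _ _ "(*)"] prod.cong)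
    fix m i assume "m \<in> injections k N" "i \<in> {..<k}"
    then have "m \<in> {..<k} \<rightarrow>\<^sub>E {..<N}" by (simp add: injections_def)
    from PiE_mem[OF this \<open>i \<in> _\<close>] show "1 / (2 * H (id (m i))) = of_real (G_prefactor L n * odd_coeff L n (m i))"
      by (simp only: id_apply Hinv lessThan_iff)
  next
    fix m
    show "mixed_Pf k (\<lambda>j a b. X j (lift_pair (id \<circ> m) a) (lift_pair (id \<circ> m) b)) =
      mixed_Pf k (\<lambda>j a b. skew_integrand L n (skew_poly L n (lift_pair m a)) (skew_poly L n (lift_pair m b)) (\<zeta> (j + 1)))"
      by (rule mixed_Pf_cong) (simp add: X_def)
  qed
  have W: "(\<Prod>i<N. 1 / (2 * H (id i))) = ?W"
    by (intro prod.cong refl) (simp only: id_apply Hinv lessThan_iff)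
  have "(\<Prod>m<N. of_real (even_coeff L n m * (G_prefactor L n * odd_coeff L n m))) = ?E * ?W"
    by (simp only: of_real_mult[of "even_coeff L n _"] prod.distrib)
  then have "fact k * ?I * (\<Prod>m<N. of_real (even_coeff L n m * (G_prefactor L n * odd_coeff L n m))) = fact k * ?W * (?I * ?E)"
    by (simp only: mult_ac)
  then show ?thesis unfolding I contract[unfolded W sum_eq] .
qed

lemma correlation_sum_0: "correlation_sum N L n 0 \<zeta> = 1"
proof -
  have "injections 0 N = {\<lambda>_. undefined}" by (simp add: injections_def)
  then show ?thesis by (simp add: correlation_sum_def mixed_Pf_def)
qed

text \<open>The case \<open>k = 0\<close> of \<open>integral_weight_merge_eq\<close> evaluates the normalisation constant. For \<open>k > N\<close>
  there are no injections.\<close>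

lemma correlation_function_eq:
  fixes N k :: nat and \<zeta> :: "nat \<Rightarrow> complex"
  assumes N: "N \<ge> 1" and L: "L \<ge> 0" and n: "n \<ge> real N"
  shows "complex_of_real (R N L n k \<zeta>) = correlation_sum N L n k \<zeta> / fact k"
proof (cases "k \<le> N")
  case True
  define c where "c = (\<Prod>m<N. complex_of_real (even_coeff L n m * (G_prefactor L n * odd_coeff L n m)))"
  have c0: "c \<noteq> 0"
    using G_prefactor_pos[of n L] coeff_pos[OF L n] N L n by (force simp: c_def)
  define J where "J = (LINT \<xi>|(\<Pi>\<^sub>M j\<in>{k+1..N}. dA). weight N L n (merge {1..k} {k+1..N} (\<zeta>, \<xi>)))"
  have J: "fact k * of_real J * c = fact (N - k) * correlation_sum N L n k \<zeta>"
    unfolding J_def c_def by (rule integral_weight_merge_eq[OF N L n True])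
  have "weight N L n (merge {1..0} {0+1..N} (\<zeta>, \<xi>)) = weight N L n \<xi>" for \<xi>
    unfolding weight_def by (intro arg_cong2[of _ _ _ _ "(*)"] prod.cong refl) (auto simp: merge_def)
  with integral_weight_merge_eq[OF N L n, of 0 \<zeta>]
  have Zc: "of_real (fact N * Z N L n) * c = fact N"
    by (simp add: Z_def c_def correlation_sum_0)
  then have Z: "of_real (fact N * Z N L n) = fact N / c" using c0 by (simp add: field_simps)
  have "R N L n k \<zeta> = fact N / fact (N - k) * (1 / (fact N * Z N L n) * J)"
    using True by (simp add: R_def P_def J_def)
  then have "complex_of_real (R N L n k \<zeta>) = fact N / fact (N - k) * (1 / of_real (fact N * Z N L n) * of_real J)"
    by simp
  also have "\<dots> = (of_real J * c) / fact (N - k)" unfolding Z using c0 by simp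
  also have "\<dots> = correlation_sum N L n k \<zeta> / fact k"
    using J by (simp add: field_simps)
  finally show ?thesis .
next
  case False
  have "injections k N = {}"
  proof (rule ccontr)
    assume "injections k N \<noteq> {}"
    then obtain m where "m \<in> {..<k} \<rightarrow>\<^sub>E {..<N}" "inj_on m {..<k}" by (auto simp: injections_def)
    then have "card {..<k} \<le> card {..<N}" by (intro card_inj_on_le[of m]) (auto dest: PiE_mem)
    then show False using False by simp
  qed
  then show ?thesis using False by (simp add: R_def correlation_sum_def)
qed

text \<open>A particle on the real axis coincides with its conjugate, so the repulsion factor vanishes.\<close>

lemma correlation_sum_real:
  assumes "j \<in> {1..k}" "\<zeta> j \<in> \<real>"
  shows "correlation_sum N L n k \<zeta> = 0"
proof -
  obtain i where i: "i < k" "j = i + 1" using assms(1) by (cases j) auto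
  have "skew_integrand L n p q (\<zeta> (i + 1)) = 0" for p q
    using assms(2) i(2) by (simp add: skew_integrand_def Reals_cnj_iff)
  then have "mixed_Pf k (\<lambda>j a b. skew_integrand L n (p a) (q b) (\<zeta> (j + 1))) = 0" for p q
    unfolding mixed_Pf_def using i(1) by (intro sum.neutral) (auto intro!: prod_zero)
  then show ?thesis by (simp add: correlation_sum_def)
qed


section \<open>The Pfaffian of the kernel\<close>

definition kernel_factor :: "real \<Rightarrow> real \<Rightarrow> complex \<Rightarrow> complex" where
  "kernel_factor L n z = of_real (\<omega> L n z) * cpow z (2 * L) / cpow (1 + z\<^sup>2) (n + L - 1/2)"

text \<open>The phases of the principal powers at conjugate points are conjugate and cancel.\<close>

lemma kernel_factor_mult_cnj:
  assumes "z \<noteq> 0" "off_cuts L n z"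
  shows "kernel_factor L n z * kernel_factor L n (cnj z) = of_real (radial_weight L n ((cmod z)\<^sup>2))"
proof -
  define s where "s = n + L - 1/2"
  have o: "2 * L \<in> \<int> \<or> z \<notin> \<real>\<^sub>\<le>\<^sub>0" "s \<in> \<int> \<or> 1 + z\<^sup>2 \<notin> \<real>\<^sub>\<le>\<^sub>0" "1 + z\<^sup>2 \<noteq> 0"
    using assms(2) by (auto simp: off_cuts_def s_def)
  have 1: "cpow z (2 * L) * cpow (cnj z) (2 * L) = of_real ((cmod z)\<^sup>2 powr (2 * L))"
    using cpow_mult_cpow_cnj[OF assms(1) o(1)] assms(1) by (simp add: powr_powr flip: powr_numeral)
  have 2: "cpow (1 + z\<^sup>2) s * cpow (1 + (cnj z)\<^sup>2) s = of_real ((cmod (1 + z\<^sup>2) powr s)\<^sup>2)"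
    using cpow_mult_cpow_cnj[OF o(3) o(2)] by (simp add: power2_eq_square flip: powr_add)
  have "cmod (1 + (cnj z)\<^sup>2) = cmod (cnj (1 + z\<^sup>2))" by simp
  then have w: "\<omega> L n (cnj z) = \<omega> L n z" unfolding \<omega>_def by (simp only: complex_mod_cnj)
  have pos: "1 + (cmod z)\<^sup>2 > 0" by (simp add: add_pos_nonneg)
  have ww: "\<omega> L n z * \<omega> L n z = (cmod (1 + z\<^sup>2) powr s)\<^sup>2 / (1 + (cmod z)\<^sup>2) powr (2 * n + 2 * L + 2)"
  proof -
    have "2 * n + 2 * L + 2 = (n + L + 1) + (n + L + 1)" by simp
    then show ?thesis by (simp only: \<omega>_def s_def power2_eq_square powr_add times_divide_times_eq)
  qed
  have "kernel_factor L n z * kernel_factor L n (cnj z) = of_real (\<omega> L n z * \<omega> L n z) *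
      (cpow z (2 * L) * cpow (cnj z) (2 * L)) / (cpow (1 + z\<^sup>2) s * cpow (1 + (cnj z)\<^sup>2) s)"
    by (simp add: kernel_factor_def w s_def)
  also have "\<dots> = of_real (\<omega> L n z * \<omega> L n z * (cmod z)\<^sup>2 powr (2 * L) / (cmod (1 + z\<^sup>2) powr s)\<^sup>2)"
    unfolding 1 2 by (simp only: of_real_mult of_real_divide)
  also have "\<omega> L n z * \<omega> L n z * (cmod z)\<^sup>2 powr (2 * L) / (cmod (1 + z\<^sup>2) powr s)\<^sup>2 = radial_weight L n ((cmod z)\<^sup>2)"
    unfolding ww radial_weight_def using o(3) by simp
  finally show ?thesis .
qed

text \<open>Pulling \<open>\<zeta>\<^bsup>2L\<^esup>\<close> out of all powers leaves the polynomials \<^const>\<open>skew_poly\<close>. This splitting of exponents is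
  what needs non-zero arguments.\<close>

lemma weighted_kernel_eq:
  assumes N: "N \<ge> 1" and x: "x \<noteq> 0" and y: "y \<noteq> 0"
  shows "of_real (\<omega> L n x * \<omega> L n y) * \<kappa> N L n x y =
    (\<Sum>i<N. of_real (- (G_prefactor L n * odd_coeff L n i)) *
       ((kernel_factor L n x * poly (skew_poly L n (2 * i)) x) * (kernel_factor L n y * poly (skew_poly L n (2 * i + 1)) y) -
        (kernel_factor L n x * poly (skew_poly L n (2 * i + 1)) x) * (kernel_factor L n y * poly (skew_poly L n (2 * i)) y)))"
proof -
  have cp: "cpow w (2 * real k + 2 * L) = cpow w (2 * L) * w ^ (2 * k)"
    "cpow w (2 * real k + 2 * L + 1) = cpow w (2 * L) * w ^ (2 * k + 1)" if "w \<noteq> 0" for w k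
  proof -
    have "cpow w (real j + 2 * L) = cpow w (2 * L) * w ^ j" for j
      using that by (simp add: cpow_def powr_add powr_nat')
    from this[of "2 * k"] this[of "2 * k + 1"] show "cpow w (2 * real k + 2 * L) = cpow w (2 * L) * w ^ (2 * k)"
      "cpow w (2 * real k + 2 * L + 1) = cpow w (2 * L) * w ^ (2 * k + 1)" by (simp_all add: add_ac)
  qed
  have G: "G_hat N L n u w = cpow u (2 * L) * cpow w (2 * L) * (\<Sum>i<N. of_real (G_prefactor L n * odd_coeff L n i) *
      (poly (skew_poly L n (2 * i + 1)) u * poly (skew_poly L n (2 * i)) w))" if "u \<noteq> 0" "w \<noteq> 0" for u w
  proof -
    have "{0..N-1} = {..<N}" using N by auto
    note range = this
    have inner: "(\<Sum>l=0..k. of_real (even_coeff L n l) * cpow w (2 * real l + 2*L)) = cpow w (2 * L) * poly (skew_poly L n (2 * k)) w" for k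
      unfolding poly_skew_poly_even cp(1)[OF that(2)] sum_distrib_left by (simp only: mult.left_commute)
    show ?thesis
      unfolding G_hat_eq inner range cp(2)[OF that(1)] poly_skew_poly_odd of_real_mult
      unfolding sum_distrib_left by (intro sum.cong refl) (simp only: mult_ac)
  qed
  define S where "S u w = (\<Sum>i<N. of_real (G_prefactor L n * odd_coeff L n i) *
      (poly (skew_poly L n (2 * i + 1)) u * poly (skew_poly L n (2 * i)) w))" for u w
  have "of_real (\<omega> L n x * \<omega> L n y) * \<kappa> N L n x y = kernel_factor L n x * kernel_factor L n y * (S x y - S y x)"
    unfolding \<kappa>_def G[OF x y] G[OF y x] S_def[symmetric] kernel_factor_def by (simp add: algebra_simps diff_divide_distrib)
  also have "\<dots> = (\<Sum>i<N. of_real (- (G_prefactor L n * odd_coeff L n i)) *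
       ((kernel_factor L n x * poly (skew_poly L n (2 * i)) x) * (kernel_factor L n y * poly (skew_poly L n (2 * i + 1)) y) -
        (kernel_factor L n x * poly (skew_poly L n (2 * i + 1)) x) * (kernel_factor L n y * poly (skew_poly L n (2 * i)) y)))"
    unfolding S_def sum_subtractf[symmetric] sum_distrib_left
    by (intro sum.cong refl) (simp add: algebra_simps)
  finally show ?thesis .
qed

lemma Pf_kernel_eq:
  fixes \<zeta> :: "nat \<Rightarrow> complex"
  assumes N: "N \<ge> 1" and \<zeta>: "\<And>j. j \<in> {1..k} \<Longrightarrow> off_cuts L n (\<zeta> j)" "\<And>j. j \<in> {1..k} \<Longrightarrow> \<zeta> j \<noteq> 0"
  shows "Pf k (from_blocks (\<lambda>j l.
                map (map (\<lambda>x. complex_of_real (\<omega> L n (\<zeta> j) * \<omega> L n (\<zeta> l)) * x))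
                  [[\<kappa> N L n (\<zeta> j) (\<zeta> l),       \<kappa> N L n (\<zeta> j) (cnj (\<zeta> l))],
                   [\<kappa> N L n (cnj (\<zeta> j)) (\<zeta> l), \<kappa> N L n (cnj (\<zeta> j)) (cnj (\<zeta> l))]]))
              * (\<Prod>j\<in>{1..k}. cnj (\<zeta> j) - \<zeta> j) = correlation_sum N L n k \<zeta> / fact k"
    (is "Pf k ?A * _ = _")
proof -
  define z where "z r = (if even r then \<zeta> (r div 2 + 1) else cnj (\<zeta> (r div 2 + 1)))" for r
  define f where "f a r = kernel_factor L n (z r) * poly (skew_poly L n a) (z r)" for a r
  define c where "c i = complex_of_real (- (G_prefactor L n * odd_coeff L n i))" for i
  have \<omega>_cnj: "\<omega> L n (cnj w) = \<omega> L n w" for w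
  proof -
    have "cmod (1 + (cnj w)\<^sup>2) = cmod (cnj (1 + w\<^sup>2))" by simp
    then show ?thesis unfolding \<omega>_def by (simp only: complex_mod_cnj)
  qed
  have entry: "?A r s = (\<Sum>i<N. c i * (f (2*i) r * f (2*i+1) s - f (2*i+1) r * f (2*i) s))"
    if "r < 2 * k" "s < 2 * k" for r s
  proof -
    have "?A r s = of_real (\<omega> L n (z r) * \<omega> L n (z s)) * \<kappa> N L n (z r) (z s)"
      by (cases "even r"; cases "even s")
         (auto simp: from_blocks_def z_def \<omega>_cnj even_iff_mod_2_eq_zero odd_iff_mod_2_eq_one)
    moreover have "z r \<noteq> 0" "z s \<noteq> 0" using that \<zeta>(2) by (auto simp: z_def)
    ultimately show ?thesis using weighted_kernel_eq[OF N] by (simp only: f_def c_def)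
  qed
  have "Pf k ?A = Pf k (\<lambda>r s. \<Sum>i<N. c i * (f (2*i) r * f (2*i+1) s - f (2*i+1) r * f (2*i) s))"
    unfolding Pf_eq_mixed_Pf
    by (intro arg_cong2[of _ _ _ _ "(/)"] mixed_Pf_cong refl entry)
  also have "\<dots> = (\<Sum>m\<in>injections k N. (\<Prod>i<k. c (m i)) *
        mixed_Pf k (\<lambda>j a b. f (lift_pair m a) (2*j) * f (lift_pair m b) (2*j+1))) / fact k"
    by (rule Pf_rank_two_sum)
  finally have Pf_eq: "Pf k ?A = (\<Sum>m\<in>injections k N. (\<Prod>i<k. c (m i)) *
        mixed_Pf k (\<lambda>j a b. f (lift_pair m a) (2*j) * f (lift_pair m b) (2*j+1))) / fact k" .
  have "(\<Prod>j\<in>{1..k}. cnj (\<zeta> j) - \<zeta> j) = (\<Prod>j<k. cnj (\<zeta> (j + 1)) - \<zeta> (j + 1))"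
    by (simp add: prod.atLeast1_atMost_eq)
  then have "Pf k ?A * (\<Prod>j\<in>{1..k}. cnj (\<zeta> j) - \<zeta> j) = (\<Sum>m\<in>injections k N. (\<Prod>i<k. c (m i)) *
        ((\<Prod>j<k. cnj (\<zeta> (j + 1)) - \<zeta> (j + 1)) *
         mixed_Pf k (\<lambda>j a b. f (lift_pair m a) (2*j) * f (lift_pair m b) (2*j+1)))) / fact k"
    unfolding Pf_eq by (simp only: times_divide_eq_left sum_distrib_right) (simp only: mult_ac)
  also have "(\<Sum>m\<in>injections k N. (\<Prod>i<k. c (m i)) *
        ((\<Prod>j<k. cnj (\<zeta> (j + 1)) - \<zeta> (j + 1)) *
         mixed_Pf k (\<lambda>j a b. f (lift_pair m a) (2*j) * f (lift_pair m b) (2*j+1)))) = correlation_sum N L n k \<zeta>"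
    unfolding correlation_sum_def
  proof (intro sum.cong refl)
    fix m
    define C where "C = (\<Prod>i<k. complex_of_real (G_prefactor L n * odd_coeff L n (m i)))"
    define Y where "Y j a b = skew_integrand L n (skew_poly L n (lift_pair m a)) (skew_poly L n (lift_pair m b)) (\<zeta> (j + 1))" for j a b
    have "(\<Prod>i<k. c (m i)) = (\<Prod>i<k. (-1) * complex_of_real (G_prefactor L n * odd_coeff L n (m i)))"
      by (intro prod.cong refl) (simp add: c_def)
    also have "\<dots> = (-1) ^ k * C"
      unfolding prod.distrib C_def by simp
    finally have c: "(\<Prod>i<k. c (m i)) = (-1) ^ k * C" .
    have "(\<Prod>j<k. cnj (\<zeta> (j + 1)) - \<zeta> (j + 1)) *
         mixed_Pf k (\<lambda>j a b. f (lift_pair m a) (2*j) * f (lift_pair m b) (2*j+1)) =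
       mixed_Pf k (\<lambda>j a b. (cnj (\<zeta> (j + 1)) - \<zeta> (j + 1)) * (f (lift_pair m a) (2*j) * f (lift_pair m b) (2*j+1)))"
      by (rule mixed_Pf_scale[symmetric])
    also have "\<dots> = mixed_Pf k (\<lambda>j a b. (-1) * Y j a b)"
    proof (rule mixed_Pf_cong)
      fix j a b assume "j < k"
      then have "j + 1 \<in> {1..k}" by simp
      note kf = kernel_factor_mult_cnj[OF \<zeta>(2)[OF this] \<zeta>(1)[OF this]]
      have z: "z (2 * j) = \<zeta> (j + 1)" "z (2 * j + 1) = cnj (\<zeta> (j + 1))" by (simp_all add: z_def)
      have "(cnj (\<zeta> (j + 1)) - \<zeta> (j + 1)) * (f (lift_pair m a) (2*j) * f (lift_pair m b) (2*j+1)) =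
          (kernel_factor L n (\<zeta> (j + 1)) * kernel_factor L n (cnj (\<zeta> (j + 1)))) * ((cnj (\<zeta> (j + 1)) - \<zeta> (j + 1)) *
            (poly (skew_poly L n (lift_pair m a)) (\<zeta> (j + 1)) * poly (skew_poly L n (lift_pair m b)) (cnj (\<zeta> (j + 1)))))"
        unfolding f_def z by (simp only: mult_ac)
      also have "\<dots> = (-1) * Y j a b"
        unfolding kf by (simp add: Y_def skew_integrand_def algebra_simps)
      finally show "(cnj (\<zeta> (j + 1)) - \<zeta> (j + 1)) * (f (lift_pair m a) (2*j) * f (lift_pair m b) (2*j+1)) = (-1) * Y j a b" .
    qed
    also have "\<dots> = (-1) ^ k * mixed_Pf k Y"
      unfolding mixed_Pf_scale by simp
    finally have f: "(\<Prod>j<k. cnj (\<zeta> (j + 1)) - \<zeta> (j + 1)) *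
         mixed_Pf k (\<lambda>j a b. f (lift_pair m a) (2*j) * f (lift_pair m b) (2*j+1)) = (-1) ^ k * mixed_Pf k Y" .
    have "(-1) ^ k * (-1) ^ k = (1 :: complex)" by (simp flip: power_mult_distrib)
    then have "(-1) ^ k * C * ((-1) ^ k * mixed_Pf k Y) = C * mixed_Pf k Y"
      by (metis (no_types, opaque_lifting) mult.assoc mult.left_commute mult_1)
    then show "(\<Prod>i<k. c (m i)) * ((\<Prod>j<k. cnj (\<zeta> (j + 1)) - \<zeta> (j + 1)) *
         mixed_Pf k (\<lambda>j a b. f (lift_pair m a) (2*j) * f (lift_pair m b) (2*j+1))) =
       C * mixed_Pf k (\<lambda>j a b. skew_integrand L n (skew_poly L n (lift_pair m a)) (skew_poly L n (lift_pair m b)) (\<zeta> (j + 1)))"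
      unfolding c f Y_def .
  qed
  finally show ?thesis .
qed

theorem proposition1p1:
  fixes N :: nat and L n :: real
  assumes "N \<ge> 1" and "L \<ge> 0" and "n \<ge> real N"
  shows "(\<forall>(k::nat) (\<zeta> :: nat \<Rightarrow> complex). (\<forall>j\<in>{1..k}. off_cuts L n (\<zeta> j)) \<longrightarrow>
            complex_of_real (R N L n k \<zeta>) =
              Pf k (from_blocks (\<lambda>j l.
                map (map (\<lambda>x. complex_of_real (\<omega> L n (\<zeta> j) * \<omega> L n (\<zeta> l)) * x))
                  [[\<kappa> N L n (\<zeta> j) (\<zeta> l),       \<kappa> N L n (\<zeta> j) (cnj (\<zeta> l))],
                   [\<kappa> N L n (cnj (\<zeta> j)) (\<zeta> l), \<kappa> N L n (cnj (\<zeta> j)) (cnj (\<zeta> l))]]))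
              * (\<Prod>j\<in>{1..k}. cnj (\<zeta> j) - \<zeta> j))
       \<and> (\<forall>\<zeta> \<eta> :: complex. off_cuts L n \<zeta> \<longrightarrow> off_cuts L n \<eta> \<longrightarrow>
            ((\<lambda>z. \<kappa> N L n z \<eta>) has_field_derivative
               1 / cpow (1 + \<zeta>\<^sup>2) (n + L + 1/2) *
               (I_N N L n \<zeta> \<eta> - II_N N L n \<zeta> \<eta> - III_N N L n \<zeta> \<eta>)) (at \<zeta>))"
proof (intro conjI allI impI)
  fix k :: nat and \<zeta> :: "nat \<Rightarrow> complex"
  assume \<zeta>: "\<forall>j\<in>{1..k}. off_cuts L n (\<zeta> j)"
  have R: "complex_of_real (R N L n k \<zeta>) = correlation_sum N L n k \<zeta> / fact k"
    by (rule correlation_function_eq[OF assms])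
  show "complex_of_real (R N L n k \<zeta>) =
              Pf k (from_blocks (\<lambda>j l.
                map (map (\<lambda>x. complex_of_real (\<omega> L n (\<zeta> j) * \<omega> L n (\<zeta> l)) * x))
                  [[\<kappa> N L n (\<zeta> j) (\<zeta> l),       \<kappa> N L n (\<zeta> j) (cnj (\<zeta> l))],
                   [\<kappa> N L n (cnj (\<zeta> j)) (\<zeta> l), \<kappa> N L n (cnj (\<zeta> j)) (cnj (\<zeta> l))]]))
              * (\<Prod>j\<in>{1..k}. cnj (\<zeta> j) - \<zeta> j)"
  proof (cases "\<exists>j\<in>{1..k}. \<zeta> j \<in> \<real>")
    case True
    then obtain j where j: "j \<in> {1..k}" "\<zeta> j \<in> \<real>" by blast
    then have "(\<Prod>j\<in>{1..k}. cnj (\<zeta> j) - \<zeta> j) = 0"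
      by (intro prod_zero) (auto simp: Reals_cnj_iff)
    then show ?thesis unfolding R correlation_sum_real[where \<zeta> = \<zeta>, OF j] by (simp only: mult_zero_right div_0)
  next
    case False
    then have "\<zeta> j \<noteq> 0" if "j \<in> {1..k}" for j using that by (metis Reals_0)
    with \<zeta> show ?thesis unfolding R by (intro Pf_kernel_eq[symmetric] assms(1)) blast+
  qed
qed (rule kernel_derivative[OF assms])

end
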